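(* Let $k\ge 2$ be a fixed integer and let $c>0$ be a fixed constant. There is a constant $K=K(k,c)$ such that the following holds for all positive integers $n,m$ and all non-negative integers $L_1,\dots,L_{k-1}$. Let $\mathcal D\subseteq[m]^n$ be the set of all inputs $x$ such that, for every $t=1,\dots,k-1$, the number of $t$-tuples in $x$ differs from $L_t$ by at most $c\,n^{1/4}$. Then the $k$-distinctness function restricted to $\mathcal D$ can be computed by a bounded-error quantum algorithm making at most $$K\, n^{1-2^{k-2}/(2^k-1)}$$ queries to the input. (That is, if the number of $t$-tuples in the input is known for all $t=1,\dots,k-1$ with precision $O(\sqrt[4]{n})$, then $k$-distinctness can be solved in $O(n^{1-2^{k-2}/(2^k-1)})$ quantum queries, where the constant behind the $O$ depends on $k$ but not on $n$.)
   Context: $[m]=\{1,\dots,m\}$. For an input $x=(x_1,\dots,x_n)\in[m]^n$, the $k$-distinctness function equals $1$ iff there is a set of $k$ distinct indices $i$ on which all values $x_i$ are equal, and $0$ otherwise. A $t$-tuple of $x$ is a set $I\subseteq[n]$ with $|I|=t$ such that $x_i=x_j$ for all $i,j\in I$ and $x_i\neq x_j$ for all $i\in I$, $j\in[n]\setminus I$ (a maximal set of indices with equal values, of size exactly $t$). Quantum query complexity is in the standard (black-box) model: the input is accessed by the oracle $|i\rangle|a\rangle\mapsto|i\rangle|a+x_i \bmod m\rangle$, and on every $x\in\mathcal D$ the algorithm must output the correct value with error probability at most $1/4$. The algorithm may depend on $n,m,k,c$ and $L_1,\dots,L_{k-1}$, and its behaviour on inputs outside $\mathcal D$ is arbitrary.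 *)

theory Defs
  imports "Jordan_Normal_Form.Schur_Decomposition" "HOL-Library.FuncSet"
begin

definition k_distinctness :: "nat \<Rightarrow> nat \<Rightarrow> (nat \<Rightarrow> nat) \<Rightarrow> bool" where
  "k_distinctness k n x \<longleftrightarrow>
     (\<exists>S. S \<subseteq> {1..n} \<and> card S = k \<and> (\<forall>i\<in>S. \<forall>j\<in>S. x i = x j))"

definition t_tuples :: "nat \<Rightarrow> nat \<Rightarrow> (nat \<Rightarrow> nat) \<Rightarrow> nat set set" where
  "t_tuples t n x = {I. I \<subseteq> {1..n} \<and> card I = t \<and>
     (\<forall>i\<in>I. \<forall>j\<in>I. x i = x j) \<and> (\<forall>i\<in>I. \<forall>j\<in>{1..n} - I. x i \<noteq> x j)}"

definition promise_set :: "nat \<Rightarrow> real \<Rightarrow> nat \<Rightarrow> nat \<Rightarrow> (nat \<Rightarrow> nat) \<Rightarrow> (nat \<Rightarrow> nat) set" where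
  "promise_set k c n m L = {x \<in> {1..n} \<rightarrow>\<^sub>E {1..m}. \<forall>t\<in>{1..k-1}.
     \<bar>real (card (t_tuples t n x)) - real (L t)\<bar> \<le> c * real n powr (1/4)}"

definition unitary_mat :: "nat \<Rightarrow> complex mat \<Rightarrow> bool" where
  "unitary_mat N U \<longleftrightarrow> U \<in> carrier_mat N N \<and>
     U * mat_adjoint U = 1\<^sub>m N \<and> mat_adjoint U * U = 1\<^sub>m N"

text \<open>
  The state space is spanned by the basis states \<open>|i\<rangle>|a\<rangle>|z\<rangle>\<close> with a query index
  \<open>i \<in> {1..n}\<close>, a response register \<open>a < m\<close> and a workspace of some finite dimension
  \<open>z < w\<close>. The function \<open>basis_index\<close> enumerates them as \<open>0, \<dots>, n * m * w - 1\<close>.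
\<close>

definition basis_index :: "nat \<Rightarrow> nat \<Rightarrow> nat \<Rightarrow> nat \<Rightarrow> nat \<Rightarrow> nat" where
  "basis_index m w i a z = ((i - 1) * m + a) * w + z"

text \<open>The matrix of \<open>|i\<rangle>|a\<rangle>|z\<rangle> \<mapsto> |i\<rangle>|a + x i mod m\<rangle>|z\<rangle>\<close>.\<close>

definition oracle_mat :: "nat \<Rightarrow> nat \<Rightarrow> nat \<Rightarrow> (nat \<Rightarrow> nat) \<Rightarrow> complex mat" where
  "oracle_mat n m w x = mat (n * m * w) (n * m * w) (\<lambda>(r, s).
     if \<exists>i\<in>{1..n}. \<exists>a<m. \<exists>z<w.
          s = basis_index m w i a z \<and> r = basis_index m w i ((a + x i) mod m) z
     then 1 else 0)"

text \<open>
  An algorithm with \<open>T = num_queries A\<close> applies \<open>U\<^sub>0, O\<^sub>x, U\<^sub>1, O\<^sub>x, \<dots>, O\<^sub>x, U\<^sub>T\<close> to the first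
  basis state, where \<open>U\<^sub>t = gate A t\<close> is independent of \<open>x\<close>. It then measures in the
  computational basis and outputs \<open>answer A j\<close> when it observes the basis state \<open>j\<close>.
\<close>

record query_algorithm =
  work_dim :: nat
  num_queries :: nat
  gate :: "nat \<Rightarrow> complex mat"
  answer :: "nat \<Rightarrow> bool"

definition alg_dim :: "nat \<Rightarrow> nat \<Rightarrow> query_algorithm \<Rightarrow> nat" where
  "alg_dim n m A = n * m * work_dim A"

definition quantum_query_algorithm :: "nat \<Rightarrow> nat \<Rightarrow> query_algorithm \<Rightarrow> bool" where
  "quantum_query_algorithm n m A \<longleftrightarrow>
     work_dim A > 0 \<and> (\<forall>t\<le>num_queries A. unitary_mat (alg_dim n m A) (gate A t))"

primrec state_after ::
    "nat \<Rightarrow> nat \<Rightarrow> query_algorithm \<Rightarrow> (nat \<Rightarrow> nat) \<Rightarrow> nat \<Rightarrow> complex vec" where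
  "state_after n m A x 0 = gate A 0 *\<^sub>v unit_vec (alg_dim n m A) 0"
| "state_after n m A x (Suc t) =
     gate A (Suc t) *\<^sub>v (oracle_mat n m (work_dim A) x *\<^sub>v state_after n m A x t)"

definition output_prob ::
    "nat \<Rightarrow> nat \<Rightarrow> query_algorithm \<Rightarrow> (nat \<Rightarrow> nat) \<Rightarrow> bool \<Rightarrow> real" where
  "output_prob n m A x b =
     (\<Sum>j | j < alg_dim n m A \<and> answer A j = b. (cmod (state_after n m A x (num_queries A) $ j))\<^sup>2)"

definition computes_with_error ::
    "nat \<Rightarrow> nat \<Rightarrow> query_algorithm \<Rightarrow> ((nat \<Rightarrow> nat) \<Rightarrow> bool) \<Rightarrow> (nat \<Rightarrow> nat) set \<Rightarrow> real \<Rightarrow> bool" where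
  "computes_with_error n m A f D \<epsilon> \<longleftrightarrow> (\<forall>x\<in>D. output_prob n m A x (\<not> f x) \<le> \<epsilon>)"

end

theory Submission
  imports Defs "HOL-Library.Product_Lexorder"
begin

text \<open>
  A feasible solution of the dual adversary bound of value \<open>W\<close> gives an algorithm with \<open>O(W)\<close>
  queries: one writes down the states that the run should have, checks that consecutive ones have
  the Gram matrices which make the gates unitary, and pays for the missing catalyst in the error.

  The feasible solution is a learning graph. On a positive input random tuples of \<open>s\<close> equal elements
  are loaded, about \<open>n powr size_exponent k s\<close> of them for each \<open>s < k\<close>, and then the \<open>k\<close> equal
  elements. For a negative input the path must leave it at the first element on which the two inputs
  differ. While a tuple is being loaded, its prefix of length \<open>l\<close> is hidden among the loaded
  \<open>l\<close>-tuples. The cost of a step is governed by the number of vertices consistent with a negative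
  input times the collision probability of the random edge on a positive one. Since tuples are drawn
  independently and may overlap, both are plain products, and the promise keeps the ratio of the two
  products bounded because only \<open>O(n powr (3/4))\<close> tuples are loaded.
\<close>

section \<open>Unitary matrices with prescribed values\<close>

text \<open>The pair sums of the adversary bound must equal 1 exactly, so no path may be lost. On a
  negative input only vertices whose lists are constant count: an s-tuple contributes O(n)
  possibilities instead of n^s, and a vertex that looks alike on both inputs is consistent with
  both, so nothing has to be discarded. The obstacle is the partly loaded tuple. Its prefix is one
  more list in the vertex, which multiplies the number of negative vertices by about n; hiding it
  among r_l tuples divides this price by about r_l. An element of a t-tuple then costs about sqrt (n
  / r_(t-1)), with another factor sqrt n for t = k, where the target is a single tuple and not one
  of at least n. With r_t = n^(e_t) and e_0 = 1, equal cost 1 - g on all levels means e_t + (1 -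
  e_(t-1)) / 2 = 1 - g for t < k and (1 - e_(k-1)) / 2 + 1/2 = 1 - g at the end. This forces g =
  2^(k-2) / (2^k - 1). Since e_1 = 1 - g is at most 3/4, a relative error of order n^(-3/4) per slot
  is harmless, which is an absolute error of order n^(1/4) in the tuple counts.\<close>

lemma index_mat_adjoint [simp]:
  "i < dim_col A \<Longrightarrow> j < dim_row A \<Longrightarrow> mat_adjoint A $$ (i, j) = conjugate (A $$ (j, i))"
  unfolding mat_adjoint_def by (auto simp: mat_of_rows_def)

lemma dim_mat_adjoint [simp]:
  "dim_row (mat_adjoint A) = dim_col A" "dim_col (mat_adjoint A) = dim_row A"
  by (simp_all add: mat_adjoint_def)

lemma mat_adjoint_carrier: "A \<in> carrier_mat r s \<Longrightarrow> mat_adjoint A \<in> carrier_mat s r"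
  by (intro carrier_matI) auto

lemma mat_adjoint_mult:
  fixes A B :: "complex mat"
  assumes A: "A \<in> carrier_mat r s" and B: "B \<in> carrier_mat s t"
  shows "mat_adjoint (A * B) = mat_adjoint B * mat_adjoint A"
proof (rule eq_matI)
  have AB: "A * B \<in> carrier_mat r t" using A B by simp
  show "dim_row (mat_adjoint (A * B)) = dim_row (mat_adjoint B * mat_adjoint A)"
    using mat_adjoint_carrier[OF AB] mat_adjoint_carrier[OF A] mat_adjoint_carrier[OF B] by simp
  show "dim_col (mat_adjoint (A * B)) = dim_col (mat_adjoint B * mat_adjoint A)"
    using mat_adjoint_carrier[OF AB] mat_adjoint_carrier[OF A] mat_adjoint_carrier[OF B] by simp
  fix i j assume "i < dim_row (mat_adjoint B * mat_adjoint A)" "j < dim_col (mat_adjoint B * mat_adjoint A)"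
  then have i: "i < t" and j: "j < r"
    using mat_adjoint_carrier[OF A] mat_adjoint_carrier[OF B] by auto
  have "mat_adjoint (A * B) $$ (i, j) = cnj (\<Sum>l<s. A $$ (j, l) * B $$ (l, i))"
    using i j A B by (simp add: scalar_prod_def lessThan_atLeast0)
  also have "\<dots> = (\<Sum>l<s. mat_adjoint B $$ (i, l) * mat_adjoint A $$ (l, j))"
    using i j A B by (simp add: mult.commute)
  also have "\<dots> = (mat_adjoint B * mat_adjoint A) $$ (i, j)"
    using i j A B by (simp add: scalar_prod_def lessThan_atLeast0)
  finally show "mat_adjoint (A * B) $$ (i, j) = (mat_adjoint B * mat_adjoint A) $$ (i, j)" .
qed

lemma unitary_mat_carrier: "unitary_mat N U \<Longrightarrow> U \<in> carrier_mat N N"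
  by (simp add: unitary_mat_def)

lemma unitary_mat_one: "unitary_mat N (1\<^sub>m N)"
proof -
  have "mat_adjoint (1\<^sub>m N) = (1\<^sub>m N :: complex mat)"
    using mat_adjoint_carrier[of "1\<^sub>m N :: complex mat" N N]
    by (intro eq_matI) (auto simp del: mat_adjoint_carrier)
  then show ?thesis by (simp add: unitary_mat_def)
qed

lemma unitary_mat_mult:
  assumes "unitary_mat N U" "unitary_mat N V"
  shows "unitary_mat N (U * V)"
proof -
  have U: "U \<in> carrier_mat N N" "mat_adjoint U \<in> carrier_mat N N"
    and V: "V \<in> carrier_mat N N" "mat_adjoint V \<in> carrier_mat N N"
    using assms by (auto simp: unitary_mat_def)
  have assoc: "A * B * (C * E) = A * (B * C * E)"
    if "A \<in> carrier_mat N N" "B \<in> carrier_mat N N" "C \<in> carrier_mat N N" "E \<in> carrier_mat N N"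
    for A B C E :: "complex mat"
    using that by (simp add: assoc_mult_mat[of _ N N _ N _ N])
  have "U * V * (mat_adjoint V * mat_adjoint U) = U * (V * mat_adjoint V * mat_adjoint U)"
    using U V by (intro assoc)
  moreover have "mat_adjoint V * mat_adjoint U * (U * V) = mat_adjoint V * (mat_adjoint U * U * V)"
    using U V by (intro assoc)
  moreover have "U * (V * mat_adjoint V * mat_adjoint U) = 1\<^sub>m N"
    "mat_adjoint V * (mat_adjoint U * U * V) = 1\<^sub>m N"
    using assms U V by (simp_all add: unitary_mat_def)
  ultimately show ?thesis
    using U V by (simp add: unitary_mat_def mat_adjoint_mult[OF U(1) V(1)] del: assoc_mult_mat)
qed

lemma cscalar_prod_sum:
  fixes v w :: "complex vec"
  assumes "w \<in> carrier_vec N"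
  shows "v \<bullet>c w = (\<Sum>i<N. v $ i * cnj (w $ i))"
  using assms by (auto simp: scalar_prod_def lessThan_atLeast0 intro!: sum.cong)

lemma mult_mat_vec_index_sum:
  assumes "A \<in> carrier_mat r s" "v \<in> carrier_vec s" "i < r"
  shows "(A *\<^sub>v v) $ i = (\<Sum>j<s. A $$ (i, j) * v $ j)"
  using assms by (auto simp: scalar_prod_def lessThan_atLeast0 intro!: sum.cong)

lemma unitary_mat_cscalar_prod:
  assumes U: "unitary_mat N U" and v: "v \<in> carrier_vec N" and w: "w \<in> carrier_vec N"
  shows "(U *\<^sub>v v) \<bullet>c (U *\<^sub>v w) = v \<bullet>c w"
proof -
  have Uc: "U \<in> carrier_mat N N" using U by (rule unitary_mat_carrier)
  have orth: "(\<Sum>i<N. U $$ (i, j) * cnj (U $$ (i, k))) = (if j = k then 1 else 0)"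
    if "j < N" "k < N" for j k
  proof -
    have "(mat_adjoint U * U) $$ (k, j) = (if j = k then 1 else 0)"
      using U that by (auto simp: unitary_mat_def)
    moreover have "(mat_adjoint U * U) $$ (k, j) = (\<Sum>i<N. cnj (U $$ (i, k)) * U $$ (i, j))"
      using that carrier_matD[OF Uc] by (simp add: scalar_prod_def lessThan_atLeast0)
    ultimately show ?thesis by (simp add: mult.commute)
  qed
  have "(U *\<^sub>v v) \<bullet>c (U *\<^sub>v w)
      = (\<Sum>i<N. (\<Sum>j<N. U $$ (i, j) * v $ j) * cnj (\<Sum>k<N. U $$ (i, k) * w $ k))"
    using Uc v w by (subst cscalar_prod_sum[where N = N])
      (auto simp: mult_mat_vec_index_sum[OF Uc] simp del: index_mult_mat_vec)
  also have "\<dots> = (\<Sum>i<N. \<Sum>j<N. \<Sum>k<N. v $ j * cnj (w $ k) * (U $$ (i, j) * cnj (U $$ (i, k))))"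
    by (simp add: sum_product mult_ac)
  also have "\<dots> = (\<Sum>j<N. \<Sum>i<N. \<Sum>k<N. v $ j * cnj (w $ k) * (U $$ (i, j) * cnj (U $$ (i, k))))"
    by (rule sum.swap)
  also have "\<dots> = (\<Sum>j<N. \<Sum>k<N. v $ j * cnj (w $ k) * (\<Sum>i<N. U $$ (i, j) * cnj (U $$ (i, k))))"
    unfolding sum_distrib_left by (intro sum.cong refl sum.swap)
  also have "\<dots> = (\<Sum>j<N. \<Sum>k<N. v $ j * cnj (w $ k) * (if j = k then 1 else 0))"
    by (intro sum.cong refl) (simp add: orth)
  also have "\<dots> = v \<bullet>c w"
    using w by (simp add: cscalar_prod_sum mult.commute if_distrib sum.delta cong: if_cong)
  finally show ?thesis .
qed

text \<open>The complex analogue of a Householder reflection: with \<open>d = a - b\<close> and \<open>c = 1 / \<langle>a, d\<rangle>\<close> the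
  matrix \<open>1 - c d d\<^sup>*\<close> is unitary because \<open>2 Re (1 / c) = \<parallel>d\<parallel>\<^sup>2\<close> whenever \<open>\<parallel>a\<parallel> = \<parallel>b\<parallel>\<close>.\<close>

lemma unitary_mapping_vec:
  fixes a b :: "complex vec"
  assumes a: "a \<in> carrier_vec N" and b: "b \<in> carrier_vec N" and norm: "a \<bullet>c a = b \<bullet>c b"
  shows "\<exists>R. unitary_mat N R \<and> R *\<^sub>v a = b \<and>
    (\<forall>v \<in> carrier_vec N. v \<bullet>c a = v \<bullet>c b \<longrightarrow> R *\<^sub>v v = v)"
proof (cases "a = b")
  case True
  then show ?thesis using a unitary_mat_one by (intro exI[of _ "1\<^sub>m N"]) auto
next
  case False
  define d where "d i = a $ i - b $ i" for i
  define s where "s = (\<Sum>i<N. a $ i * cnj (d i))"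
  define c where "c = 1 / s"
  define R where "R = mat N N (\<lambda>(i, j). (if i = j then 1 else 0) - c * d i * cnj (d j))"
  have RC: "R \<in> carrier_mat N N" by (simp add: R_def)
  have aa: "(\<Sum>i<N. a $ i * cnj (a $ i)) = (\<Sum>i<N. b $ i * cnj (b $ i))"
    using norm a b by (simp add: cscalar_prod_sum)
  \<comment> \<open>Equality of the norms enters here. The identity also shows
    \<open>s \<noteq> 0\<close>, since \<open>s = 0\<close> would force
    \<open>d = 0\<close>.\<close>
  have dd: "(\<Sum>i<N. d i * cnj (d i)) = s + cnj s"
  proof -
    have "(\<Sum>i<N. d i * cnj (d i)) = (\<Sum>i<N. a $ i * cnj (d i)) + (\<Sum>i<N. cnj (a $ i) * d i)
       + ((\<Sum>i<N. b $ i * cnj (b $ i)) - (\<Sum>i<N. a $ i * cnj (a $ i)))"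
      unfolding sum_subtractf[symmetric] sum.distrib[symmetric] d_def
      by (intro sum.cong refl) (simp add: algebra_simps)
    then show ?thesis using aa by (simp add: s_def)
  qed
  have s0: "s \<noteq> 0"
  proof
    assume "s = 0"
    then have "(\<Sum>i<N. d i * cnj (d i)) = 0" using dd by simp
    then have "(\<Sum>i<N. complex_of_real ((cmod (d i))\<^sup>2)) = 0" by (simp only: complex_norm_square)
    then have "complex_of_real (\<Sum>i<N. (cmod (d i))\<^sup>2) = 0" by simp
    then have "(\<Sum>i<N. (cmod (d i))\<^sup>2) = 0" by (simp only: of_real_eq_0_iff)
    then have "\<forall>i<N. d i = 0" by (subst (asm) sum_nonneg_eq_0_iff) auto
    then have "a = b" using a b by (intro eq_vecI) (auto simp: d_def)
    then show False using False by simp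
  qed
  have key: "c * cnj c * (\<Sum>j<N. cnj (d j) * d j) = c + cnj c"
  proof -
    have "(\<Sum>j<N. cnj (d j) * d j) = s + cnj s" using dd by (simp add: mult.commute)
    then show ?thesis using s0 by (simp add: c_def field_simps)
  qed
  \<comment> \<open>Stated for a general \<open>e\<close> because it serves twice: with
    \<open>e = c\<close> for \<open>R * mat_adjoint R\<close> and with \<open>e = cnj c\<close> for
    \<open>mat_adjoint R * R\<close>.\<close>
  have RR: "(\<Sum>j<N. ((if i = j then 1 else 0) - e * d i * cnj (d j)) *
       ((if k = j then 1 else 0) - cnj e * cnj (d k) * d j)) = (if i = k then 1 else 0)"
    if "i < N" "k < N" and e: "e * cnj e * (\<Sum>j<N. cnj (d j) * d j) = e + cnj e" for i k e
  proof -
    have "(\<Sum>j<N. ((if i = j then 1 else 0) - e * d i * cnj (d j)) *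
       ((if k = j then 1 else 0) - cnj e * cnj (d k) * d j))
      = (\<Sum>j<N. (if i = j then (if k = j then 1 else 0) else 0)
          - (if i = j then cnj e * cnj (d k) * d j else 0)
          - (if k = j then e * d i * cnj (d j) else 0)
          + e * cnj e * d i * cnj (d k) * (cnj (d j) * d j))"
      by (intro sum.cong refl) (simp add: ring_distribs mult_ac)
    also have "\<dots> = (if i = k then 1 else 0) - cnj e * cnj (d k) * d i - e * d i * cnj (d k)
        + d i * cnj (d k) * (e * cnj e * (\<Sum>j<N. cnj (d j) * d j))"
      unfolding sum.distrib sum_subtractf sum_distrib_left[symmetric]
      using that(1,2) by (simp only: sum.delta sum.delta' finite_lessThan lessThan_iff if_True mult_ac eq_commute[of k i])
    also have "\<dots> = (if i = k then 1 else 0)" unfolding e by (simp add: algebra_simps)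
    finally show ?thesis .
  qed
  have uni: "unitary_mat N R"
  proof -
    have "R * mat_adjoint R = 1\<^sub>m N"
    proof (rule eq_matI)
      fix i k assume "i < dim_row (1\<^sub>m N :: complex mat)" "k < dim_col (1\<^sub>m N :: complex mat)"
      then have ik: "i < N" "k < N" by auto
      have "(R * mat_adjoint R) $$ (i, k) = (\<Sum>j<N. R $$ (i, j) * cnj (R $$ (k, j)))"
        using ik RC mat_adjoint_carrier[OF RC]
        by (auto simp: scalar_prod_def lessThan_atLeast0 intro!: sum.cong)
      also have "\<dots> = (if i = k then 1 else 0)"
        using ik RR[OF ik key]
        by (simp add: R_def if_distrib[of cnj] cong: if_cong)
      finally show "(R * mat_adjoint R) $$ (i, k) = 1\<^sub>m N $$ (i, k)" using ik by simp
    qed (use RC mat_adjoint_carrier[OF RC] in auto)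
    moreover have "mat_adjoint R * R = 1\<^sub>m N"
    proof (rule eq_matI)
      fix i k assume "i < dim_row (1\<^sub>m N :: complex mat)" "k < dim_col (1\<^sub>m N :: complex mat)"
      then have ik: "i < N" "k < N" by auto
      have key': "cnj c * cnj (cnj c) * (\<Sum>j<N. cnj (d j) * d j) = cnj c + cnj (cnj c)"
        using key by (simp add: mult.commute add.commute)
      have "(mat_adjoint R * R) $$ (i, k) = (\<Sum>j<N. cnj (R $$ (j, i)) * R $$ (j, k))"
        using ik RC mat_adjoint_carrier[OF RC]
        by (auto simp: scalar_prod_def lessThan_atLeast0 intro!: sum.cong)
      also have "\<dots> = (\<Sum>j<N. ((if i = j then 1 else 0) - cnj c * d i * cnj (d j)) *
       ((if k = j then 1 else 0) - cnj (cnj c) * cnj (d k) * d j))"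
        using ik by (intro sum.cong refl) (auto simp: R_def mult_ac)
      also have "\<dots> = (if i = k then 1 else 0)" by (rule RR[OF ik key'])
      finally show "(mat_adjoint R * R) $$ (i, k) = 1\<^sub>m N $$ (i, k)" using ik by simp
    qed (use RC mat_adjoint_carrier[OF RC] in auto)
    ultimately show ?thesis using RC by (simp add: unitary_mat_def)
  qed
  have Rv: "(R *\<^sub>v v) $ i = v $ i - c * d i * (\<Sum>j<N. v $ j * cnj (d j))"
    if "v \<in> carrier_vec N" "i < N" for v i
  proof -
    have "(R *\<^sub>v v) $ i = (\<Sum>j<N. (if i = j then v $ j else 0) - c * d i * (v $ j * cnj (d j)))"
      using that by (subst mult_mat_vec_index_sum[OF RC that(1,2)])
        (auto simp: R_def algebra_simps intro!: sum.cong)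
    also have "\<dots> = v $ i - c * d i * (\<Sum>j<N. v $ j * cnj (d j))"
      using that by (simp add: sum_subtractf sum.delta sum_distrib_left)
    finally show ?thesis .
  qed
  have "R *\<^sub>v a = b"
  proof (rule eq_vecI)
    fix i assume "i < dim_vec b"
    then have i: "i < N" using b by simp
    have "(R *\<^sub>v a) $ i = a $ i - c * d i * s" using Rv[OF a i] by (simp add: s_def)
    also have "\<dots> = b $ i" using s0 by (simp add: c_def d_def)
    finally show "(R *\<^sub>v a) $ i = b $ i" .
  qed (use RC b in auto)
  moreover have "R *\<^sub>v v = v" if v: "v \<in> carrier_vec N" and eq: "v \<bullet>c a = v \<bullet>c b" for v
  proof (rule eq_vecI)
    fix i assume "i < dim_vec v"
    then have i: "i < N" using v by simp
    have "(\<Sum>j<N. v $ j * cnj (d j)) = v \<bullet>c a - v \<bullet>c b"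
      using a b by (simp add: cscalar_prod_sum d_def sum_subtractf right_diff_distrib)
    then show "(R *\<^sub>v v) $ i = v $ i" using Rv[OF v i] eq by simp
  qed (use RC v in auto)
  ultimately show ?thesis using uni by blast
qed

text \<open>Vectors are treated one at a time: a reflection moves \<open>U *\<^sub>v a z\<close> to
  \<open>b z\<close>. It fixes the images \<open>b x\<close> already reached, because equal Gram
  entries give \<open>b x\<close> the same inner product with both endpoints. Linear dependence
  therefore causes no trouble.\<close>

lemma unitary_from_gram:
  fixes a b :: "'x \<Rightarrow> complex vec"
  assumes "finite X"
    and "\<And>x. x \<in> X \<Longrightarrow> a x \<in> carrier_vec N" and "\<And>x. x \<in> X \<Longrightarrow> b x \<in> carrier_vec N"
    and "\<And>x y. x \<in> X \<Longrightarrow> y \<in> X \<Longrightarrow> a x \<bullet>c a y = b x \<bullet>c b y"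
  shows "\<exists>U. unitary_mat N U \<and> (\<forall>x\<in>X. U *\<^sub>v a x = b x)"
  using assms
proof (induction X rule: finite_induct)
  case empty
  then show ?case using unitary_mat_one by blast
next
  case (insert z X)
  then obtain U where U: "unitary_mat N U" and UX: "\<And>x. x \<in> X \<Longrightarrow> U *\<^sub>v a x = b x" by blast
  have Uc: "U \<in> carrier_mat N N" using U by (rule unitary_mat_carrier)
  have az: "U *\<^sub>v a z \<in> carrier_vec N" and bz: "b z \<in> carrier_vec N"
    using Uc insert.prems by auto
  have "(U *\<^sub>v a z) \<bullet>c (U *\<^sub>v a z) = b z \<bullet>c b z"
    using unitary_mat_cscalar_prod[OF U] insert.prems by simp
  then obtain R where R: "unitary_mat N R" and Rz: "R *\<^sub>v (U *\<^sub>v a z) = b z"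
    and Rfix: "\<forall>v \<in> carrier_vec N. v \<bullet>c (U *\<^sub>v a z) = v \<bullet>c b z \<longrightarrow> R *\<^sub>v v = v"
    using unitary_mapping_vec[OF az bz] by blast
  have Rc: "R \<in> carrier_mat N N" using R by (rule unitary_mat_carrier)
  have "(R * U) *\<^sub>v a x = b x" if "x \<in> insert z X" for x
  proof -
    have ax: "a x \<in> carrier_vec N" using insert.prems that by blast
    have *: "(R * U) *\<^sub>v a x = R *\<^sub>v (U *\<^sub>v a x)" using Rc Uc ax by (rule assoc_mult_mat_vec)
    show ?thesis
    proof (cases "x = z")
      case True
      then show ?thesis using * Rz by simp
    next
      case False
      then have xX: "x \<in> X" using that by simp
      have "b x \<bullet>c (U *\<^sub>v a z) = a x \<bullet>c a z"
        using unitary_mat_cscalar_prod[OF U, of "a x" "a z"] UX[OF xX] insert.prems(1) xX by simp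
      then have "b x \<bullet>c (U *\<^sub>v a z) = b x \<bullet>c b z" using insert.prems(3) xX by simp
      then show ?thesis using * UX[OF xX] Rfix insert.prems(2) xX by auto
    qed
  qed
  then show ?case using unitary_mat_mult[OF R U] by blast
qed

section \<open>From adversary bounds to algorithms\<close>

lemma sum_lessThan_mult:
  fixes h :: "nat \<Rightarrow> nat \<Rightarrow> 'a :: comm_monoid_add"
  shows "(\<Sum>r<a * b. h (r div b) (r mod b)) = (\<Sum>i<a. \<Sum>j<b. h i j)"
proof -
  have "(\<Sum>r<a * b. h (r div b) (r mod b)) = (\<Sum>i<a. \<Sum>r\<in>{i * b..<i * b + b}. h (r div b) (r mod b))"
    by (simp add: sum.nat_group)
  also have "\<dots> = (\<Sum>i<a. \<Sum>j<b. h i j)"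
  proof (rule sum.cong[OF refl])
    fix i
    show "(\<Sum>r\<in>{i * b..<i * b + b}. h (r div b) (r mod b)) = (\<Sum>j<b. h i j)"
      using sum.shift_bounds_nat_ivl[of "\<lambda>r. h (r div b) (r mod b)" 0 "i * b" b]
      by (simp add: add.commute lessThan_atLeast0)
  qed
  finally show ?thesis .
qed

lemma sum_basis_index:
  fixes h :: "nat \<Rightarrow> nat \<Rightarrow> nat \<Rightarrow> 'a :: comm_monoid_add"
  shows "(\<Sum>r<n * m * w. h (r div w div m + 1) (r div w mod m) (r mod w))
    = (\<Sum>i\<in>{1..n}. \<Sum>a<m. \<Sum>z<w. h i a z)"
proof -
  have "(\<Sum>r<n * m * w. h (r div w div m + 1) (r div w mod m) (r mod w))
    = (\<Sum>i<n. \<Sum>a<m. \<Sum>z<w. h (i + 1) a z)"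
    by (subst sum_lessThan_mult, subst sum_lessThan_mult) (rule refl)
  also have "\<dots> = (\<Sum>i\<in>{1..n}. \<Sum>a<m. \<Sum>z<w. h i a z)"
    by (rule sum.reindex_bij_witness[of _ "\<lambda>i. i - 1" "\<lambda>i. i + 1"]) auto
  finally show ?thesis .
qed

lemma basis_index_decode:
  assumes "1 \<le> i" "a < m" "z < w"
  shows "basis_index m w i a z div w div m + 1 = i"
    and "basis_index m w i a z div w mod m = a"
    and "basis_index m w i a z mod w = z"
  using assms by (simp_all add: basis_index_def)

lemma basis_index_encode:
  "basis_index m w (r div w div m + 1) (r div w mod m) (r mod w) = r"
  by (simp add: basis_index_def)

lemma basis_index_less:
  assumes "i \<in> {1..n}" "a < m" "z < w"
  shows "basis_index m w i a z < n * m * w"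
proof -
  have "basis_index m w i a z < ((i - 1) * m + a + 1) * w"
    using assms by (simp add: basis_index_def)
  also have "(i - 1) * m + a + 1 \<le> (i - 1) * m + m" using assms by simp
  also have "\<dots> = i * m" using assms by (cases i) auto
  also have "\<dots> \<le> n * m" using assms by simp
  finally show ?thesis by simp
qed

lemma decode_bounds:
  fixes r :: nat
  assumes "r < n * m * w"
  shows "r div w div m + 1 \<in> {1..n}" "r div w mod m < m" "r mod w < w"
proof -
  have w: "w > 0" and m: "m > 0" using assms by (auto intro: gr0I)
  have "r div w < n * m" using assms w by (simp add: less_mult_imp_div_less)
  then have "r div w div m < n" by (simp add: less_mult_imp_div_less)
  then show "r div w div m + 1 \<in> {1..n}" by simp
  show "r div w mod m < m" "r mod w < w" using m w by simp_all
qed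

definition oracle_perm :: "nat \<Rightarrow> nat \<Rightarrow> (nat \<Rightarrow> nat) \<Rightarrow> nat \<Rightarrow> nat" where
  "oracle_perm m w x r = basis_index m w (r div w div m + 1)
     ((r div w mod m + x (r div w div m + 1)) mod m) (r mod w)"

lemma add_mod_left_inj:
  fixes a b t m :: nat
  assumes "(a + t) mod m = (b + t) mod m" "a < m" "b < m"
  shows "a = b"
proof -
  have "int m dvd (int a + int t) - (int b + int t)"
    using assms(1) by (metis mod_eq_dvd_iff of_nat_add of_nat_mod)
  then have "int a mod int m = int b mod int m" by (simp add: mod_eq_dvd_iff)
  then show ?thesis using assms(2,3) by simp
qed

lemma bij_betw_oracle_perm: "bij_betw (oracle_perm m w x) {..<n * m * w} {..<n * m * w}"
proof -
  have inj: "inj_on (oracle_perm m w x) {..<n * m * w}"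
  proof (rule inj_onI)
    fix r s assume "r \<in> {..<n * m * w}" "s \<in> {..<n * m * w}"
      and eq: "oracle_perm m w x r = oracle_perm m w x s"
    then have r: "r < n * m * w" and s: "s < n * m * w" by auto
    have m: "m > 0" using r by (auto intro: gr0I)
    note dr = decode_bounds[OF r] and ds = decode_bounds[OF s]
    note Dr = basis_index_decode[of "r div w div m + 1" "(r div w mod m + x (r div w div m + 1)) mod m" m "r mod w" w]
    note Ds = basis_index_decode[of "s div w div m + 1" "(s div w mod m + x (s div w div m + 1)) mod m" m "s mod w" w]
    have i: "r div w div m + 1 = s div w div m + 1"
      using Dr(1) Ds(1) eq dr ds m unfolding oracle_perm_def by (metis atLeastAtMost_iff mod_less_divisor)
    have z: "r mod w = s mod w"
      using Dr(3) Ds(3) eq dr ds m unfolding oracle_perm_def by (metis atLeastAtMost_iff mod_less_divisor)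
    have "(r div w mod m + x (r div w div m + 1)) mod m = (s div w mod m + x (s div w div m + 1)) mod m"
      using Dr(2) Ds(2) eq dr ds m unfolding oracle_perm_def by (metis atLeastAtMost_iff mod_less_divisor)
    then have "r div w mod m = s div w mod m"
      using i dr(2) ds(2) by (metis add_mod_left_inj)
    then show "r = s" using i z basis_index_encode by metis
  qed
  moreover have "oracle_perm m w x ` {..<n * m * w} \<subseteq> {..<n * m * w}"
  proof (clarify)
    fix r assume "r < n * m * w"
    note d = decode_bounds[OF this]
    then show "oracle_perm m w x r < n * m * w"
      unfolding oracle_perm_def by (intro basis_index_less) (auto intro!: mod_less_divisor)
  qed
  ultimately show ?thesis
    by (simp add: bij_betw_def endo_inj_surj)
qed

lemma oracle_mat_mult_vec:
  assumes v: "v \<in> carrier_vec (n * m * w)" and s: "s < n * m * w"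
  shows "(oracle_mat n m w x *\<^sub>v v) $ oracle_perm m w x s = v $ s"
proof -
  have O: "oracle_mat n m w x \<in> carrier_mat (n * m * w) (n * m * w)" by (simp add: oracle_mat_def)
  have ps: "oracle_perm m w x r < n * m * w" if "r < n * m * w" for r
    using bij_betw_oracle_perm[of m w x n] that by (auto simp: bij_betw_def)
  have entry: "oracle_mat n m w x $$ (oracle_perm m w x s, t) = (if t = s then 1 else 0)"
    if t: "t < n * m * w" for t
  proof -
    have "(\<exists>i\<in>{1..n}. \<exists>a<m. \<exists>z<w. t = basis_index m w i a z \<and>
        oracle_perm m w x s = basis_index m w i ((a + x i) mod m) z) \<longleftrightarrow>
      oracle_perm m w x s = oracle_perm m w x t" (is "?L \<longleftrightarrow> ?R")
    proof
      assume ?L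
      then obtain i a z where "i \<in> {1..n}" "a < m" "z < w" and
        eq: "t = basis_index m w i a z" "oracle_perm m w x s = basis_index m w i ((a + x i) mod m) z" by blast
      then show ?R using basis_index_decode[of i a m z w] by (simp add: oracle_perm_def)
    next
      assume ?R
      then show ?L using decode_bounds[OF t] basis_index_encode[of m w t]
        unfolding oracle_perm_def by metis
    qed
    also have "\<dots> \<longleftrightarrow> t = s"
      using inj_on_eq_iff[OF bij_betw_imp_inj_on[OF bij_betw_oracle_perm[of m w x n]], of s t] s t by auto
    finally show ?thesis using ps[OF s] t by (simp add: oracle_mat_def)
  qed
  have "(oracle_mat n m w x *\<^sub>v v) $ oracle_perm m w x s
     = (\<Sum>t<n * m * w. (if t = s then 1 else 0) * v $ t)"
    using mult_mat_vec_index_sum[OF O v ps[OF s]] by (simp add: entry)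
  also have "\<dots> = v $ s" using s by (simp add: if_distrib[of "\<lambda>c. c * _"] sum.delta cong: if_cong)
  finally show ?thesis .
qed

definition sqnorm :: "complex vec \<Rightarrow> real" where
  "sqnorm v = (\<Sum>i<dim_vec v. (cmod (v $ i))\<^sup>2)"

lemma cscalar_prod_self: "v \<bullet>c v = complex_of_real (sqnorm v)"
  by (subst cscalar_prod_sum[of v "dim_vec v"])
    (auto simp: sqnorm_def complex_norm_square simp del: of_real_power)

lemma sqnorm_oracle:
  assumes v: "v \<in> carrier_vec (n * m * w)"
  shows "sqnorm (oracle_mat n m w x *\<^sub>v v) = sqnorm v"
proof -
  have "sqnorm (oracle_mat n m w x *\<^sub>v v)
      = (\<Sum>r<n * m * w. (cmod ((oracle_mat n m w x *\<^sub>v v) $ r))\<^sup>2)"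
    by (simp add: sqnorm_def oracle_mat_def)
  also have "\<dots> = (\<Sum>s<n * m * w. (cmod ((oracle_mat n m w x *\<^sub>v v) $ oracle_perm m w x s))\<^sup>2)"
    by (rule sum.reindex_bij_betw[OF bij_betw_oracle_perm, symmetric])
  also have "\<dots> = sqnorm v"
    using v by (auto simp: sqnorm_def oracle_mat_mult_vec[OF v] intro!: sum.cong)
  finally show ?thesis .
qed

lemma sqnorm_unitary:
  assumes "unitary_mat N U" "v \<in> carrier_vec N"
  shows "sqnorm (U *\<^sub>v v) = sqnorm v"
  using unitary_mat_cscalar_prod[OF assms assms(2)] unfolding cscalar_prod_self of_real_eq_iff .

definition basis_vec :: "nat \<Rightarrow> nat \<Rightarrow> nat \<Rightarrow> (nat \<Rightarrow> nat \<Rightarrow> nat \<Rightarrow> real) \<Rightarrow> complex vec" where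
  "basis_vec n m w g = vec (n * m * w)
     (\<lambda>r. complex_of_real (g (r div w div m + 1) (r div w mod m) (r mod w)))"

lemma basis_vec_carrier [simp]: "basis_vec n m w g \<in> carrier_vec (n * m * w)"
  by (simp add: basis_vec_def)

lemma cscalar_prod_basis_vec:
  "basis_vec n m w g \<bullet>c basis_vec n m w h
     = complex_of_real (\<Sum>i\<in>{1..n}. \<Sum>a<m. \<Sum>z<w. g i a z * h i a z)"
proof -
  have "basis_vec n m w g \<bullet>c basis_vec n m w h = complex_of_real (\<Sum>r<n * m * w.
      (\<lambda>i a z. g i a z * h i a z) (r div w div m + 1) (r div w mod m) (r mod w))"
    by (subst cscalar_prod_sum[where N = "n * m * w"]) (auto simp: basis_vec_def)
  then show ?thesis by (subst (asm) sum_basis_index) simp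
qed

lemma oracle_mat_basis_vec:
  assumes "\<And>i a z. i \<in> {1..n} \<Longrightarrow> a < m \<Longrightarrow> z < w \<Longrightarrow> g' i ((a + x i) mod m) z = g i a z"
  shows "oracle_mat n m w x *\<^sub>v basis_vec n m w g = basis_vec n m w g'"
proof (rule eq_vecI)
  fix r assume "r < dim_vec (basis_vec n m w g')"
  then have "r \<in> {..<n * m * w}" by (simp add: basis_vec_def)
  then obtain s where s: "s < n * m * w" and r: "r = oracle_perm m w x s"
    using bij_betw_oracle_perm[of m w x n] unfolding bij_betw_def by blast
  note d = decode_bounds[OF s]
  have m: "m > 0" using d by simp
  let ?i = "s div w div m + 1" and ?a = "s div w mod m" and ?z = "s mod w"
  have pr: "r < n * m * w" using \<open>r \<in> _\<close> by simp
  have "(oracle_mat n m w x *\<^sub>v basis_vec n m w g) $ r = basis_vec n m w g $ s"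
    using oracle_mat_mult_vec[OF basis_vec_carrier s] r by simp
  also have "\<dots> = complex_of_real (g ?i ?a ?z)" using s by (simp add: basis_vec_def)
  also have "\<dots> = complex_of_real (g' ?i ((?a + x ?i) mod m) ?z)" using assms[OF d] by simp
  also have "\<dots> = basis_vec n m w g' $ r"
  proof -
    have "1 \<le> ?i" "(?a + x ?i) mod m < m" using m by simp_all
    note D = basis_index_decode[OF this d(3)]
    show ?thesis unfolding basis_vec_def index_vec[OF pr] unfolding r oracle_perm_def D ..
  qed
  finally show "(oracle_mat n m w x *\<^sub>v basis_vec n m w g) $ r = basis_vec n m w g' $ r" .
qed (simp add: basis_vec_def oracle_mat_def)

section \<open>Ideal states and their Gram matrices\<close>

lemma sum_lessThan_pairs:
  fixes f :: "nat \<Rightarrow> 'a :: comm_monoid_add"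
  shows "(\<Sum>z<2 * q + 3. f z) = f 0 + f 1 + f 2 + (\<Sum>z<q. f (2 * z + 3) + f (2 * z + 4))"
proof (induction q)
  case 0
  then show ?case by (simp add: eval_nat_numeral lessThan_Suc add_ac)
next
  case (Suc q)
  have "{..<2 * Suc q + 3} = insert (2 * q + 4) (insert (2 * q + 3) {..<2 * q + 3})" by auto
  then show ?case using Suc by (simp add: add_ac)
qed

text \<open>Workspace value \<open>0\<close> marks the initial part, \<open>1\<close> and \<open>2\<close> the answers, uniformly spread over the
  response register so that the oracle fixes them. The values \<open>2 z + 3\<close> and \<open>2 z + 4\<close> hold the two
  halves of the catalyst.\<close>

definition amp :: "nat \<Rightarrow> real \<Rightarrow> real \<Rightarrow> bool \<Rightarrow> (nat \<Rightarrow> nat) \<Rightarrow> (nat \<Rightarrow> nat \<Rightarrow> real) \<Rightarrow>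
    (nat \<Rightarrow> nat) \<Rightarrow> (nat \<Rightarrow> nat \<Rightarrow> real) \<Rightarrow> nat \<Rightarrow> nat \<Rightarrow> nat \<Rightarrow> real" where
  "amp m al be b P U Q V i a z =
    (if z < 3 then
       (if i = 1 then (if z = 0 then al else if (z = 1) = b then be else 0) / sqrt (real m) else 0)
     else if odd z then (if a = P i then U i ((z - 3) div 2) else 0)
     else (if a = Q i then V i ((z - 3) div 2) else 0))"

lemma sum_mult_delta:
  fixes c d :: real and A B m :: nat
  assumes "A < m"
  shows "(\<Sum>a<m. (if a = A then c else 0) * (if a = B then d else 0)) = (if A = B then c * d else 0)"
proof -
  have "(\<Sum>a<m. (if a = A then c else 0) * (if a = B then d else 0))
     = (\<Sum>a<m. if a = A then (if A = B then c * d else 0) else 0)"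
    by (intro sum.cong) auto
  also have "\<dots> = (if A = B then c * d else 0)"
    using assms sum.delta[of "{..<m}" A "\<lambda>_. if A = B then c * d else 0"] by simp
  finally show ?thesis .
qed

lemma sum_amp:
  assumes n: "n > 0" and m: "m > 0"
    and PQ: "\<And>i. i \<in> {1..n} \<Longrightarrow> P i < m \<and> Q i < m"
  shows "(\<Sum>i\<in>{1..n}. \<Sum>a<m. \<Sum>z<2 * q + 3. amp m al be b P U Q V i a z * amp m al' be' b' P' U' Q' V' i a z)
    = al * al' + (if b = b' then be * be' else 0) +
      (\<Sum>i\<in>{1..n}. \<Sum>z<q. (if P i = P' i then U i z * U' i z else 0) + (if Q i = Q' i then V i z * V' i z else 0))"
proof -
  let ?t = "al * al' + (if b = b' then be * be' else 0)"
  have "(\<Sum>a<m. \<Sum>z<2 * q + 3. amp m al be b P U Q V i a z * amp m al' be' b' P' U' Q' V' i a z)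
    = (if i = 1 then ?t else 0) +
      (\<Sum>z<q. (if P i = P' i then U i z * U' i z else 0) + (if Q i = Q' i then V i z * V' i z else 0))"
    if i: "i \<in> {1..n}" for i
  proof -
    have "(\<Sum>a<m. \<Sum>z<2 * q + 3. amp m al be b P U Q V i a z * amp m al' be' b' P' U' Q' V' i a z)
      = (\<Sum>a<m. (if i = 1 then ?t / real m else 0) + (\<Sum>z<q.
          (if a = P i then U i z else 0) * (if a = P' i then U' i z else 0) +
          (if a = Q i then V i z else 0) * (if a = Q' i then V' i z else 0)))"
      using m unfolding sum_lessThan_pairs
      by (intro sum.cong refl arg_cong2[of _ _ _ _ "(+)"])
        (auto simp: amp_def field_simps)
    also have "\<dots> = (if i = 1 then ?t else 0) + (\<Sum>a<m. \<Sum>z<q.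
          (if a = P i then U i z else 0) * (if a = P' i then U' i z else 0) +
          (if a = Q i then V i z else 0) * (if a = Q' i then V' i z else 0))"
      using m by (simp only: sum.distrib sum_constant card_lessThan) auto
    also have "(\<Sum>a<m. \<Sum>z<q.
          (if a = P i then U i z else 0) * (if a = P' i then U' i z else 0) +
          (if a = Q i then V i z else 0) * (if a = Q' i then V' i z else 0))
       = (\<Sum>z<q. \<Sum>a<m.
          (if a = P i then U i z else 0) * (if a = P' i then U' i z else 0) +
          (if a = Q i then V i z else 0) * (if a = Q' i then V' i z else 0))"
      by (rule sum.swap)
    also have "\<dots> = (\<Sum>z<q. (if P i = P' i then U i z * U' i z else 0) + (if Q i = Q' i then V i z * V' i z else 0))"
      using PQ[OF i] by (intro sum.cong refl) (simp only: sum.distrib sum_mult_delta)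
    finally show ?thesis .
  qed
  then have "(\<Sum>i\<in>{1..n}. \<Sum>a<m. \<Sum>z<2 * q + 3. amp m al be b P U Q V i a z * amp m al' be' b' P' U' Q' V' i a z)
    = (\<Sum>i\<in>{1..n}. (if i = 1 then ?t else 0) +
      (\<Sum>z<q. (if P i = P' i then U i z * U' i z else 0) + (if Q i = Q' i then V i z * V' i z else 0)))"
    by (intro sum.cong refl) blast
  then show ?thesis using n by (simp only: sum.distrib) (simp add: sum.delta)
qed

lemma power2_norm_add_le: "(cmod (a + b))\<^sup>2 \<le> 2 * (cmod a)\<^sup>2 + 2 * (cmod b)\<^sup>2"
proof -
  have "(cmod (a + b))\<^sup>2 \<le> (cmod a + cmod b)\<^sup>2"
    by (intro power_mono norm_triangle_ineq) simp
  also have "\<dots> \<le> 2 * (cmod a)\<^sup>2 + 2 * (cmod b)\<^sup>2"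
    using zero_le_power2[of "cmod a - cmod b"] by (simp add: power2_sum power2_diff)
  finally show ?thesis .
qed

text \<open>The actual run starts from an input-independent vector, and its distance to the ideal run never
  changes.\<close>

lemma query_algorithm_from_gram:
  fixes \<Phi> \<Psi> :: "nat \<Rightarrow> (nat \<Rightarrow> nat) \<Rightarrow> complex vec"
  assumes D: "finite D" and w: "w > 0" and nm: "n > 0" "m > 0"
    and \<Phi>: "\<And>t x. x \<in> D \<Longrightarrow> \<Phi> t x \<in> carrier_vec (n * m * w)"
    and \<Psi>: "\<And>t x. x \<in> D \<Longrightarrow> oracle_mat n m w x *\<^sub>v \<Phi> t x = \<Psi> t x"
    and gram: "\<And>t x y. t < T \<Longrightarrow> x \<in> D \<Longrightarrow> y \<in> D \<Longrightarrow> \<Psi> t x \<bullet>c \<Psi> t y = \<Phi> (Suc t) x \<bullet>c \<Phi> (Suc t) y"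
    and v0: "v0 \<in> carrier_vec (n * m * w)" "v0 \<bullet>c v0 = 1"
    and init: "\<And>x. x \<in> D \<Longrightarrow> sqnorm (v0 - \<Phi> 0 x) \<le> \<epsilon>"
    and wrong: "\<And>x. x \<in> D \<Longrightarrow> (\<Sum>j | j < n * m * w \<and> ans j = (\<not> f x). (cmod (\<Phi> T x $ j))\<^sup>2) \<le> \<epsilon>"
  shows "\<exists>A. quantum_query_algorithm n m A \<and> computes_with_error n m A f D (4 * \<epsilon>) \<and> num_queries A = T"
proof -
  define N where "N = n * m * w"
  have N: "N > 0" using w nm by (simp add: N_def)
  have O: "oracle_mat n m w x \<in> carrier_mat N N" for x by (simp add: oracle_mat_def N_def)
  note \<Phi>' = \<Phi>[folded N_def]
  have "\<exists>U. unitary_mat N U \<and> (\<forall>x\<in>{()}. U *\<^sub>v unit_vec N 0 = v0)"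
  proof (rule unitary_from_gram[where a = "\<lambda>_. unit_vec N 0" and b = "\<lambda>_. v0"])
    have "unit_vec N 0 \<bullet>c unit_vec N 0 = (1 :: complex)"
      using N by (subst cscalar_prod_sum[where N = N])
        (auto simp: unit_vec_def if_distrib[of cnj] if_distrib[of "\<lambda>c. c * _"] cong: if_cong)
    then show "unit_vec N 0 \<bullet>c unit_vec N 0 = v0 \<bullet>c v0" using v0 by simp
  qed (use v0 in \<open>auto simp: N_def\<close>)
  then obtain U0 where U0: "unitary_mat N U0" "U0 *\<^sub>v unit_vec N 0 = v0" by blast
  have "\<exists>U. unitary_mat N U \<and> (\<forall>x\<in>D. U *\<^sub>v \<Psi> t x = \<Phi> (Suc t) x)" if "t < T" for t
  proof (rule unitary_from_gram[OF D])
    show "\<Psi> t x \<in> carrier_vec N" if "x \<in> D" for x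
      using mult_mat_vec_carrier[OF O \<Phi>'[OF that]] \<Psi>[OF that] by metis
  qed (use gram that \<Phi>' in auto)
  then obtain U where U: "\<And>t. t < T \<Longrightarrow> unitary_mat N (U t)"
    "\<And>t x. t < T \<Longrightarrow> x \<in> D \<Longrightarrow> U t *\<^sub>v \<Psi> t x = \<Phi> (Suc t) x" by metis
  define A where "A = \<lparr>work_dim = w, num_queries = T,
    gate = (\<lambda>t. case t of 0 \<Rightarrow> U0 | Suc t' \<Rightarrow> U t'), answer = ans\<rparr>"
  have sel [simp]: "work_dim A = w" "num_queries A = T" "gate A 0 = U0" "\<And>t. gate A (Suc t) = U t"
    "answer A = ans" "alg_dim n m A = N"
    by (simp_all add: A_def alg_dim_def N_def)
  have "quantum_query_algorithm n m A"
    using w U0(1) U(1) unfolding quantum_query_algorithm_def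
    by (auto split: nat.splits simp: less_eq_Suc_le elim!: allE) (metis not0_implies_Suc Suc_le_lessD sel(3,4))
  moreover have dist: "state_after n m A x t \<in> carrier_vec N \<and> sqnorm (state_after n m A x t - \<Phi> t x) \<le> \<epsilon>"
    if x: "x \<in> D" and "t \<le> T" for x t
    using \<open>t \<le> T\<close>
  proof (induction t)
    case 0
    then show ?case using U0(2) init[OF x] v0(1) by (simp add: N_def)
  next
    case (Suc t)
    then have t: "t < T" by simp
    let ?s = "state_after n m A x t" and ?O = "oracle_mat n m w x"
    have s: "?s \<in> carrier_vec N" and le: "sqnorm (?s - \<Phi> t x) \<le> \<epsilon>" using Suc by auto
    have Uc: "U t \<in> carrier_mat N N" using U(1)[OF t] by (rule unitary_mat_carrier)
    have Os: "?O *\<^sub>v ?s \<in> carrier_vec N" and OP: "?O *\<^sub>v \<Phi> t x \<in> carrier_vec N"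
      using O s \<Phi>'[OF x] by (auto intro: mult_mat_vec_carrier)
    have "state_after n m A x (Suc t) - \<Phi> (Suc t) x = U t *\<^sub>v (?O *\<^sub>v ?s) - U t *\<^sub>v (?O *\<^sub>v \<Phi> t x)"
      using U(2)[OF t x] \<Psi>[OF x] by simp
    also have "\<dots> = U t *\<^sub>v (?O *\<^sub>v (?s - \<Phi> t x))"
      using mult_minus_distrib_mat_vec[OF Uc Os OP] mult_minus_distrib_mat_vec[OF O s \<Phi>'[OF x]] by simp
    finally have eq: "state_after n m A x (Suc t) - \<Phi> (Suc t) x = U t *\<^sub>v (?O *\<^sub>v (?s - \<Phi> t x))" .
    have dc: "?s - \<Phi> t x \<in> carrier_vec N" using s \<Phi>'[OF x] by simp
    have "sqnorm (state_after n m A x (Suc t) - \<Phi> (Suc t) x) = sqnorm (?s - \<Phi> t x)"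
      unfolding eq using sqnorm_unitary[OF U(1)[OF t] mult_mat_vec_carrier[OF O dc]]
        sqnorm_oracle[OF dc[unfolded N_def]] by simp
    then show ?case using le mult_mat_vec_carrier[OF Uc Os] by simp
  qed
  have "output_prob n m A x (\<not> f x) \<le> 4 * \<epsilon>" if x: "x \<in> D" for x
  proof -
    let ?s = "state_after n m A x T" and ?J = "{j. j < N \<and> ans j = (\<not> f x)}"
    have s: "?s \<in> carrier_vec N" and le: "sqnorm (?s - \<Phi> T x) \<le> \<epsilon>" using dist[OF x] by auto
    have "output_prob n m A x (\<not> f x) = (\<Sum>j\<in>?J. (cmod (?s $ j))\<^sup>2)"
      by (simp add: output_prob_def)
    \<comment> \<open>The ideal mass on wrong answers and the squared distance to the ideal run are
      both at most \<open>\<epsilon>\<close>; each is doubled, hence the factor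
      \<open>4\<close>.\<close>
    also have "\<dots> \<le> (\<Sum>j\<in>?J. 2 * (cmod (\<Phi> T x $ j))\<^sup>2 + 2 * (cmod ((?s - \<Phi> T x) $ j))\<^sup>2)"
    proof (rule sum_mono)
      fix j assume "j \<in> ?J"
      then have "?s $ j = \<Phi> T x $ j + (?s - \<Phi> T x) $ j" using s \<Phi>'[OF x, of T] by simp
      then show "(cmod (?s $ j))\<^sup>2 \<le> 2 * (cmod (\<Phi> T x $ j))\<^sup>2 + 2 * (cmod ((?s - \<Phi> T x) $ j))\<^sup>2"
        by (metis power2_norm_add_le)
    qed
    also have "\<dots> = 2 * (\<Sum>j\<in>?J. (cmod (\<Phi> T x $ j))\<^sup>2) + 2 * (\<Sum>j\<in>?J. (cmod ((?s - \<Phi> T x) $ j))\<^sup>2)"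
      by (simp only: sum.distrib sum_distrib_left)
    also have "(\<Sum>j\<in>?J. (cmod ((?s - \<Phi> T x) $ j))\<^sup>2) \<le> sqnorm (?s - \<Phi> T x)"
      unfolding sqnorm_def using s \<Phi>'[OF x, of T] by (intro sum_mono2) auto
    also have "2 * (\<Sum>j\<in>?J. (cmod (\<Phi> T x $ j))\<^sup>2) + 2 * sqnorm (?s - \<Phi> T x) \<le> 4 * \<epsilon>"
      using wrong[OF x, folded N_def] le by simp
    finally show ?thesis by simp
  qed
  ultimately show ?thesis by (intro exI[of _ A]) (simp add: computes_with_error_def)
qed

text \<open>After \<open>t\<close> of \<open>T\<close> queries the ideal state is \<open>sqrt (1 - t / T)\<close> times the initial part plus
  \<open>sqrt (t / T)\<close> times the answer, plus a catalyst that does not depend on \<open>t\<close>. The catalyst holds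
  \<open>u x i\<close> in response \<open>0\<close> and plus or minus \<open>u x i\<close> in response \<open>- x i\<close>: a query sends these
  responses to \<open>x i\<close> and \<open>0\<close>, and the resulting change of the Gram matrix is what one step moves
  from initial part to answer.\<close>

theorem adversary_upper_bound:
  fixes u :: "(nat \<Rightarrow> nat) \<Rightarrow> nat \<Rightarrow> nat \<Rightarrow> real"
  assumes D: "finite D" and nm: "n > 0" "m > 0"
    and range: "\<And>x i. x \<in> D \<Longrightarrow> i \<in> {1..n} \<Longrightarrow> x i \<in> {1..m}"
    and pair: "\<And>x y. x \<in> D \<Longrightarrow> y \<in> D \<Longrightarrow> f x \<Longrightarrow> \<not> f y \<Longrightarrow>
      (\<Sum>i\<in>{1..n}. if x i \<noteq> y i then \<Sum>z<q. u x i z * u y i z else 0) = 1"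
    and cost: "\<And>x. x \<in> D \<Longrightarrow> (\<Sum>i\<in>{1..n}. \<Sum>z<q. (u x i z)\<^sup>2) \<le> W"
    and W: "W \<ge> 0"
  shows "\<exists>A. quantum_query_algorithm n m A \<and> computes_with_error n m A f D (1/4) \<and>
    real (num_queries A) \<le> 16 * W + 2"
proof -
  \<comment> \<open>\<open>T \<ge> 16 * W\<close> bounds the squared norm \<open>W / T\<close> of
    the catalyst by \<open>1/16\<close>, which the factor \<open>4\<close> of
    \<open>query_algorithm_from_gram\<close> turns into error \<open>1/4\<close>. The
    \<open>+ 1\<close> keeps \<open>T\<close> positive.\<close>
  define T where "T = nat \<lceil>16 * W\<rceil> + 1"
  have T0: "T > 0" and TW: "16 * W \<le> real T" and T2: "real T \<le> 16 * W + 2"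
    using W unfolding T_def by linarith+
  \<comment> \<open>For inputs with different answers a query changes the Gram entry by
    \<open>2 * (s * s)\<close> times the pair sum, which is \<open>1\<close>; this has to be the
    \<open>1 / T\<close> moved in one step.\<close>
  define s where "s = sqrt (1 / (2 * real T))"
  have s2: "s * s = 1 / (2 * real T)" by (simp add: s_def)
  define sg where "sg x = (if f x then 1 else -1 :: real)" for x
  define al where "al t = sqrt (1 - real t / real T)" for t
  define be where "be t = sqrt (real t / real T)" for t
  have al2: "al t * al t = 1 - real t / real T" if "t \<le> T" for t
    using that T0 by (simp add: al_def)
  have be2: "be t * be t = real t / real T" for t by (simp add: be_def)
  define w where "w = 2 * q + 3"
  define U where "U x i z = s * u x i z" for x i z
  define V where "V x i z = s * sg x * u x i z" for x i z
  \<comment> \<open>Since \<open>x i\<close> lies in \<open>{1..m}\<close>, \<open>m - x i\<close>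
    is already below \<open>m\<close> and represents \<open>- x i\<close> without a reduction; it is
    \<open>0\<close> for \<open>x i = m\<close>.\<close>
  define \<Phi> where "\<Phi> t x = basis_vec n m w (amp m (al t) (be t) (f x) (\<lambda>_. 0) (U x) (\<lambda>i. m - x i) (V x))" for t x
  define \<Psi> where "\<Psi> t x = basis_vec n m w (amp m (al t) (be t) (f x) (\<lambda>i. x i mod m) (U x) (\<lambda>_. 0) (V x))" for t x
  define v0 where "v0 = basis_vec n m w (amp m 1 0 True (\<lambda>_. 0) (\<lambda>_ _. 0) (\<lambda>_. 0) (\<lambda>_ _. 0))"
  have mod_iff: "x i mod m = y i mod m \<longleftrightarrow> x i = y i" "m - x i = m - y i \<longleftrightarrow> x i = y i"
    if "x \<in> D" "y \<in> D" "i \<in> {1..n}" for x y i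
  proof -
    have xy: "x i \<in> {1..m}" "y i \<in> {1..m}" using range that by auto
    then show "m - x i = m - y i \<longleftrightarrow> x i = y i" by auto
    have "x i mod m = (if x i = m then 0 else x i)" "y i mod m = (if y i = m then 0 else y i)"
      using xy by auto
    with xy show "x i mod m = y i mod m \<longleftrightarrow> x i = y i" by auto
  qed
  have query: "oracle_mat n m w x *\<^sub>v \<Phi> t x = \<Psi> t x" if x: "x \<in> D" for t x
    unfolding \<Phi>_def \<Psi>_def
  proof (rule oracle_mat_basis_vec)
    fix i a z assume i: "i \<in> {1..n}" and a: "a < m"
    have xi: "x i \<in> {1..m}" using range x i by auto
    have "(a + x i) mod m = x i mod m \<longleftrightarrow> a = 0"
      using add_mod_left_inj[of a "x i" m 0] a nm by auto
    moreover have "(a + x i) mod m = 0 \<longleftrightarrow> a = m - x i"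
      using add_mod_left_inj[of a "x i" m "m - x i"] a xi by auto
    ultimately show "amp m (al t) (be t) (f x) (\<lambda>i. x i mod m) (U x) (\<lambda>_. 0) (V x) i ((a + x i) mod m) z
      = amp m (al t) (be t) (f x) (\<lambda>_. 0) (U x) (\<lambda>i. m - x i) (V x) i a z"
      by (simp add: amp_def)
  qed
  \<comment> \<open>With equal answers the two halves just exchange roles. With different answers
    both sums keep only the positions where \<open>x i \<noteq> y i\<close>, with opposite signs, so
    they differ by twice the scaled pair sum.\<close>
  have diff: "(\<Sum>i\<in>{1..n}. \<Sum>z<q. (if x i = y i then U x i z * U y i z else 0) + V x i z * V y i z)
     = (\<Sum>i\<in>{1..n}. \<Sum>z<q. U x i z * U y i z + (if x i = y i then V x i z * V y i z else 0))
       - (if f x = f y then 0 else 1 / real T)"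
    if x: "x \<in> D" and y: "y \<in> D" for x y
  proof (cases "f x = f y")
    case True
    then have V: "V x i z * V y i z = U x i z * U y i z" for i z
      by (simp add: U_def V_def sg_def)
    show ?thesis using True unfolding V by (simp add: add.commute)
  next
    case False
    then have V: "V x i z * V y i z = - (U x i z * U y i z)" for i z
      by (simp add: U_def V_def sg_def)
    have "(\<Sum>i\<in>{1..n}. if x i \<noteq> y i then \<Sum>z<q. u x i z * u y i z else 0) = 1"
    proof (cases "f x")
      case True
      then show ?thesis using pair[OF x y] False by simp
    next
      case nfx: False
      then have "(\<Sum>i\<in>{1..n}. if y i \<noteq> x i then \<Sum>z<q. u y i z * u x i z else 0) = 1"
        using pair[OF y x] False by simp
      moreover have "(if y i \<noteq> x i then \<Sum>z<q. u y i z * u x i z else 0)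
          = (if x i \<noteq> y i then \<Sum>z<q. u x i z * u y i z else 0)" for i
        by (auto simp: mult.commute)
      ultimately show ?thesis by simp
    qed
    then have "1 / real T = 2 * (s * s) * (\<Sum>i\<in>{1..n}. if x i \<noteq> y i then \<Sum>z<q. u x i z * u y i z else 0)"
      by (simp add: s2)
    also have "\<dots> = (\<Sum>i\<in>{1..n}. \<Sum>z<q. if x i \<noteq> y i then 2 * (U x i z * U y i z) else 0)"
      unfolding sum_distrib_left
      by (intro sum.cong refl) (auto simp: sum_distrib_left U_def mult_ac)
    finally have "1 / real T = (\<Sum>i\<in>{1..n}. \<Sum>z<q. if x i \<noteq> y i then 2 * (U x i z * U y i z) else 0)" .
    moreover have "(\<Sum>i\<in>{1..n}. \<Sum>z<q. U x i z * U y i z + (if x i = y i then V x i z * V y i z else 0))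
       - (\<Sum>i\<in>{1..n}. \<Sum>z<q. if x i \<noteq> y i then 2 * (U x i z * U y i z) else 0)
      = (\<Sum>i\<in>{1..n}. \<Sum>z<q. (if x i = y i then U x i z * U y i z else 0) + V x i z * V y i z)"
      unfolding sum_subtractf[symmetric] by (intro sum.cong refl) (auto simp: V)
    ultimately show ?thesis using False by simp
  qed
  have gram: "\<Psi> t x \<bullet>c \<Psi> t y = \<Phi> (Suc t) x \<bullet>c \<Phi> (Suc t) y" if t: "t < T" and x: "x \<in> D" and y: "y \<in> D" for t x y
  proof -
    have "\<Psi> t x \<bullet>c \<Psi> t y = complex_of_real (al t * al t + (if f x = f y then be t * be t else 0) +
      (\<Sum>i\<in>{1..n}. \<Sum>z<q. (if x i mod m = y i mod m then U x i z * U y i z else 0) + (if (0::nat) = 0 then V x i z * V y i z else 0)))"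
      unfolding \<Psi>_def cscalar_prod_basis_vec unfolding w_def
      using nm by (subst sum_amp) auto
    also have "\<dots> = complex_of_real (al t * al t + (if f x = f y then be t * be t else 0) +
      (\<Sum>i\<in>{1..n}. \<Sum>z<q. (if x i = y i then U x i z * U y i z else 0) + V x i z * V y i z))"
      by (intro arg_cong[of _ _ complex_of_real] arg_cong2[of _ _ _ _ "(+)"] refl sum.cong) (simp add: mod_iff x y)+
    also have "\<dots> = complex_of_real (al (Suc t) * al (Suc t) + (if f x = f y then be (Suc t) * be (Suc t) else 0) +
      (\<Sum>i\<in>{1..n}. \<Sum>z<q. U x i z * U y i z + (if x i = y i then V x i z * V y i z else 0)))"
      unfolding diff[OF x y] be2 using t T0 by (simp add: al2 field_simps)
    also have "\<dots> = complex_of_real (al (Suc t) * al (Suc t) + (if f x = f y then be (Suc t) * be (Suc t) else 0) +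
      (\<Sum>i\<in>{1..n}. \<Sum>z<q. (if (0::nat) = 0 then U x i z * U y i z else 0) + (if m - x i = m - y i then V x i z * V y i z else 0)))"
      by (intro arg_cong[of _ _ complex_of_real] arg_cong2[of _ _ _ _ "(+)"] refl sum.cong) (simp add: mod_iff x y)+
    also have "\<dots> = \<Phi> (Suc t) x \<bullet>c \<Phi> (Suc t) y"
      unfolding \<Phi>_def cscalar_prod_basis_vec unfolding w_def
      using nm range[OF x] range[OF y] by (subst sum_amp) (auto simp: Suc_le_eq)
    finally show ?thesis .
  qed
  have cat: "(\<Sum>i\<in>{1..n}. \<Sum>z<q. U x i z * U x i z + V x i z * V x i z) \<le> 1 / 16" if x: "x \<in> D" for x
  proof -
    have "U x i z * U x i z + V x i z * V x i z = 1 / real T * (u x i z)\<^sup>2" for i z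
    proof -
      have "U x i z * U x i z + V x i z * V x i z = 2 * (s * s) * (u x i z)\<^sup>2"
        by (simp add: U_def V_def sg_def power2_eq_square)
      then show ?thesis by (simp add: s2)
    qed
    then have "(\<Sum>i\<in>{1..n}. \<Sum>z<q. U x i z * U x i z + V x i z * V x i z)
        = 1 / real T * (\<Sum>i\<in>{1..n}. \<Sum>z<q. (u x i z)\<^sup>2)"
      by (simp only: sum_distrib_left)
    also have "\<dots> \<le> 1 / real T * W" using cost[OF x] by (intro mult_left_mono) auto
    also have "\<dots> \<le> 1 / 16" using TW T0 by (simp add: field_simps)
    finally show ?thesis .
  qed
  have sq_basis: "sqnorm (basis_vec n m w g) = (\<Sum>i\<in>{1..n}. \<Sum>a<m. \<Sum>z<w. g i a z * g i a z)" for g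
    using cscalar_prod_basis_vec[of n m w g g] unfolding cscalar_prod_self of_real_eq_iff .
  define ans where "ans r \<longleftrightarrow> r mod w = 1" for r :: nat
  have "\<exists>A. quantum_query_algorithm n m A \<and> computes_with_error n m A f D (4 * (1/16)) \<and> num_queries A = T"
  proof (rule query_algorithm_from_gram[where \<Phi> = \<Phi> and \<Psi> = \<Psi>, OF D _ nm _ query gram])
    show "w > 0" by (simp add: w_def)
    show "\<Phi> t x \<in> carrier_vec (n * m * w)" for t x by (simp add: \<Phi>_def)
    show "v0 \<in> carrier_vec (n * m * w)" by (simp add: v0_def)
    show "v0 \<bullet>c v0 = 1"
      unfolding v0_def cscalar_prod_basis_vec unfolding w_def
      using nm by (subst sum_amp) auto
  next
    fix x assume x: "x \<in> D"
    have "v0 - \<Phi> 0 x = basis_vec n m w (amp m 0 0 True (\<lambda>_. 0) (\<lambda>i z. - U x i z) (\<lambda>i. m - x i) (\<lambda>i z. - V x i z))"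
      using T0 unfolding v0_def \<Phi>_def basis_vec_def
      by (intro eq_vecI) (auto simp: amp_def al_def be_def)
    moreover have "sqnorm \<dots> = (\<Sum>i\<in>{1..n}. \<Sum>z<q. U x i z * U x i z + V x i z * V x i z)"
      unfolding sq_basis unfolding w_def using nm range[OF x] by (subst sum_amp) (auto simp: Suc_le_eq)
    ultimately show "sqnorm (v0 - \<Phi> 0 x) \<le> 1/16" using cat[OF x] by simp
  next
    fix x assume x: "x \<in> D"
    let ?g = "amp m (al T) (be T) (f x) (\<lambda>_. 0) (U x) (\<lambda>i. m - x i) (V x)"
    let ?h = "amp m 0 0 True (\<lambda>_. 0) (U x) (\<lambda>i. m - x i) (V x)"
    have "(\<Sum>j | j < n * m * w \<and> ans j = (\<not> f x). (cmod (\<Phi> T x $ j))\<^sup>2) \<le>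
       (\<Sum>j | j < n * m * w \<and> ans j = (\<not> f x). (cmod (basis_vec n m w ?h $ j))\<^sup>2)"
    proof (rule sum_mono)
      fix j assume "j \<in> {j. j < n * m * w \<and> ans j = (\<not> f x)}"
      then have j: "j < n * m * w" and ans: "(j mod w = 1) = (\<not> f x)" by (auto simp: ans_def)
      have "?g i a (j mod w) = ?h i a (j mod w)" for i a
        using ans T0 by (auto simp: amp_def al_def)
      then show "(cmod (\<Phi> T x $ j))\<^sup>2 \<le> (cmod (basis_vec n m w ?h $ j))\<^sup>2"
        using j by (simp add: \<Phi>_def basis_vec_def)
    qed
    also have "\<dots> \<le> sqnorm (basis_vec n m w ?h)"
      unfolding sqnorm_def by (intro sum_mono2) (auto simp: basis_vec_def)
    also have "\<dots> = (\<Sum>i\<in>{1..n}. \<Sum>z<q. U x i z * U x i z + V x i z * V x i z)"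
      unfolding sq_basis unfolding w_def using nm range[OF x] by (subst sum_amp) (auto simp: Suc_le_eq)
    finally show "(\<Sum>j | j < n * m * w \<and> ans j = (\<not> f x). (cmod (\<Phi> T x $ j))\<^sup>2) \<le> 1/16"
      using cat[OF x] by simp
  qed auto
  then show ?thesis using T2 by auto
qed

lemma balancing_weight:
  fixes A B :: "'a \<Rightarrow> real"
  assumes "finite P" "finite Q" and C: "C > 0"
    and A: "\<And>x. x \<in> P \<Longrightarrow> A x \<ge> 0" and B: "\<And>y. y \<in> Q \<Longrightarrow> B y \<ge> 0"
    and AB: "\<And>x y. x \<in> P \<Longrightarrow> y \<in> Q \<Longrightarrow> A x * B y \<le> C\<^sup>2"
  shows "\<exists>w>0. (\<forall>x\<in>P. A x * w \<le> C) \<and> (\<forall>y\<in>Q. B y / w \<le> C)"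
proof (cases "\<exists>y\<in>Q. B y > 0")
  case True
  define b where "b = Max (B ` Q)"
  have "Q \<noteq> {}" using True by auto
  then have b: "b \<in> B ` Q" and le: "\<And>y. y \<in> Q \<Longrightarrow> B y \<le> b"
    using \<open>finite Q\<close> unfolding b_def by auto
  have b0: "b > 0" using True le by (meson less_le_trans)
  have "A x * (b / C) \<le> C" if "x \<in> P" for x
    using b AB[OF that] C by (auto simp: field_simps power2_eq_square)
  moreover have "B y / (b / C) \<le> C" if "y \<in> Q" for y
    using le[OF that] b0 C by (simp add: field_simps)
  ultimately show ?thesis using b0 C by (intro exI[of _ "b / C"]) auto
next
  case False
  then have B0: "B y = 0" if "y \<in> Q" for y using B[OF that] that by force
  have S: "sum A P \<ge> 0" by (intro sum_nonneg A)
  \<comment> \<open>Every \<open>B y\<close> is \<open>0\<close> here and \<open>w\<close> only has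
    to be small; \<open>1 + sum A P\<close> bounds each \<open>A x\<close> and is positive even for
    empty \<open>P\<close>.\<close>
  have "A x * (C / (1 + sum A P)) \<le> C" if "x \<in> P" for x
  proof -
    have "A x \<le> 1 + sum A P" using member_le_sum[OF that, of A] A assms(1) by force
    then have "C * A x \<le> C * (1 + sum A P)" using C by (intro mult_left_mono) auto
    then show ?thesis using S by (simp add: field_simps)
  qed
  then show ?thesis using C S B0 by (intro exI[of _ "C / (1 + sum A P)"]) auto
qed

text \<open>Scaling the vectors of step \<open>\<sigma>\<close> by \<open>sqrt (w \<sigma>)\<close>
  on positive and by its inverse on negative inputs preserves the mixed products, so each step is
  balanced separately and the costs add up.\<close>

lemma adversary_upper_bound_steps:
  fixes u :: "'i \<Rightarrow> (nat \<Rightarrow> nat) \<Rightarrow> nat \<Rightarrow> 'z \<Rightarrow> real"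
  assumes D: "finite D" and nm: "n > 0" "m > 0"
    and range: "\<And>x i. x \<in> D \<Longrightarrow> i \<in> {1..n} \<Longrightarrow> x i \<in> {1..m}"
    and I: "finite I" and Z: "\<And>\<sigma>. \<sigma> \<in> I \<Longrightarrow> finite (Z \<sigma>)"
    and pair: "\<And>x y. x \<in> D \<Longrightarrow> y \<in> D \<Longrightarrow> f x \<Longrightarrow> \<not> f y \<Longrightarrow>
      (\<Sum>\<sigma>\<in>I. \<Sum>i\<in>{1..n}. if x i \<noteq> y i then \<Sum>z\<in>Z \<sigma>. u \<sigma> x i z * u \<sigma> y i z else 0) = 1"
    and C: "\<And>\<sigma>. \<sigma> \<in> I \<Longrightarrow> C \<sigma> > 0"
    and cost: "\<And>\<sigma> x y. \<sigma> \<in> I \<Longrightarrow> x \<in> D \<Longrightarrow> y \<in> D \<Longrightarrow> f x \<Longrightarrow> \<not> f y \<Longrightarrow>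
      (\<Sum>i\<in>{1..n}. \<Sum>z\<in>Z \<sigma>. (u \<sigma> x i z)\<^sup>2) * (\<Sum>i\<in>{1..n}. \<Sum>z\<in>Z \<sigma>. (u \<sigma> y i z)\<^sup>2) \<le> (C \<sigma>)\<^sup>2"
  shows "\<exists>A. quantum_query_algorithm n m A \<and> computes_with_error n m A f D (1/4) \<and>
    real (num_queries A) \<le> 16 * (\<Sum>\<sigma>\<in>I. C \<sigma>) + 2"
proof -
  have "\<exists>w>0. (\<forall>x\<in>{x \<in> D. f x}. (\<Sum>i\<in>{1..n}. \<Sum>z\<in>Z \<sigma>. (u \<sigma> x i z)\<^sup>2) * w \<le> C \<sigma>) \<and>
      (\<forall>y\<in>{y \<in> D. \<not> f y}. (\<Sum>i\<in>{1..n}. \<Sum>z\<in>Z \<sigma>. (u \<sigma> y i z)\<^sup>2) / w \<le> C \<sigma>)" if "\<sigma> \<in> I" for \<sigma>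
    using D C[OF that] cost[OF that] by (intro balancing_weight) (auto intro!: sum_nonneg)
  then obtain w where w: "\<And>\<sigma>. \<sigma> \<in> I \<Longrightarrow> w \<sigma> > 0"
    "\<And>\<sigma> x. \<sigma> \<in> I \<Longrightarrow> x \<in> D \<Longrightarrow> f x \<Longrightarrow> (\<Sum>i\<in>{1..n}. \<Sum>z\<in>Z \<sigma>. (u \<sigma> x i z)\<^sup>2) * w \<sigma> \<le> C \<sigma>"
    "\<And>\<sigma> y. \<sigma> \<in> I \<Longrightarrow> y \<in> D \<Longrightarrow> \<not> f y \<Longrightarrow> (\<Sum>i\<in>{1..n}. \<Sum>z\<in>Z \<sigma>. (u \<sigma> y i z)\<^sup>2) / w \<sigma> \<le> C \<sigma>"
    by (simp only: mem_Collect_eq Ball_def) metis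
  define v where "v \<sigma> x i z = (if f x then sqrt (w \<sigma>) else sqrt (1 / w \<sigma>)) * u \<sigma> x i z" for \<sigma> x i z
  define M where "M = Sigma I Z"
  have M: "finite M" using I Z by (auto simp: M_def)
  \<comment> \<open>\<open>adversary_upper_bound\<close> numbers the coordinates by
    \<open>z < q\<close>, so the pairs of a step and a coordinate are enumerated.\<close>
  obtain h where h: "bij_betw h {..<card M} M"
    using ex_bij_betw_nat_finite[OF M] by (auto simp: lessThan_atLeast0)
  define U where "U x i z = v (fst (h z)) x i (snd (h z))" for x i z
  have flat: "(\<Sum>z<card M. g (fst (h z)) (snd (h z))) = (\<Sum>\<sigma>\<in>I. \<Sum>z\<in>Z \<sigma>. g \<sigma> z)" for g :: "'i \<Rightarrow> 'z \<Rightarrow> real"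
  proof -
    have "(\<Sum>z<card M. g (fst (h z)) (snd (h z))) = (\<Sum>p\<in>M. g (fst p) (snd p))"
      by (rule sum.reindex_bij_betw[OF h])
    also have "\<dots> = (\<Sum>\<sigma>\<in>I. \<Sum>z\<in>Z \<sigma>. g \<sigma> z)"
      unfolding M_def using I Z by (subst sum.Sigma) (auto simp: case_prod_unfold)
    finally show ?thesis .
  qed
  show ?thesis
  proof (rule adversary_upper_bound[where u = U and q = "card M", OF D nm])
    show "x i \<in> {1..m}" if "x \<in> D" "i \<in> {1..n}" for x i using range that .
  next
    fix x y assume xy: "x \<in> D" "y \<in> D" "f x" "\<not> f y"
    have "v \<sigma> x i z * v \<sigma> y i z = u \<sigma> x i z * u \<sigma> y i z" if "\<sigma> \<in> I" for \<sigma> i z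
      using w(1)[OF that] xy by (simp add: v_def real_sqrt_divide field_simps)
    then have "(\<Sum>z<card M. U x i z * U y i z) = (\<Sum>\<sigma>\<in>I. \<Sum>z\<in>Z \<sigma>. u \<sigma> x i z * u \<sigma> y i z)" for i
      unfolding U_def by (subst flat) (auto intro!: sum.cong)
    then have "(\<Sum>i\<in>{1..n}. if x i \<noteq> y i then \<Sum>z<card M. U x i z * U y i z else 0)
      = (\<Sum>i\<in>{1..n}. \<Sum>\<sigma>\<in>I. if x i \<noteq> y i then \<Sum>z\<in>Z \<sigma>. u \<sigma> x i z * u \<sigma> y i z else 0)"
      by (intro sum.cong refl) auto
    also have "\<dots> = 1" using pair[OF xy] by (subst sum.swap)
    finally show "(\<Sum>i\<in>{1..n}. if x i \<noteq> y i then \<Sum>z<card M. U x i z * U y i z else 0) = 1" .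
  next
    fix x assume x: "x \<in> D"
    have "(\<Sum>z<card M. (U x i z)\<^sup>2) = (\<Sum>\<sigma>\<in>I. \<Sum>z\<in>Z \<sigma>. (v \<sigma> x i z)\<^sup>2)" for i
      unfolding U_def by (rule flat)
    then have "(\<Sum>i\<in>{1..n}. \<Sum>z<card M. (U x i z)\<^sup>2) = (\<Sum>\<sigma>\<in>I. \<Sum>i\<in>{1..n}. \<Sum>z\<in>Z \<sigma>. (v \<sigma> x i z)\<^sup>2)"
      by (simp only:) (rule sum.swap)
    also have "\<dots> \<le> (\<Sum>\<sigma>\<in>I. C \<sigma>)"
    proof (rule sum_mono)
      fix \<sigma> assume \<sigma>: "\<sigma> \<in> I"
      have "(\<Sum>i\<in>{1..n}. \<Sum>z\<in>Z \<sigma>. (v \<sigma> x i z)\<^sup>2)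
        = (if f x then w \<sigma> else 1 / w \<sigma>) * (\<Sum>i\<in>{1..n}. \<Sum>z\<in>Z \<sigma>. (u \<sigma> x i z)\<^sup>2)"
        using w(1)[OF \<sigma>] by (simp add: v_def power_mult_distrib sum_distrib_left)
      then show "(\<Sum>i\<in>{1..n}. \<Sum>z\<in>Z \<sigma>. (v \<sigma> x i z)\<^sup>2) \<le> C \<sigma>"
        using w(2,3)[OF \<sigma> x] by (simp add: mult.commute split: if_splits)
    qed
    finally show "(\<Sum>i\<in>{1..n}. \<Sum>z<card M. (U x i z)\<^sup>2) \<le> (\<Sum>\<sigma>\<in>I. C \<sigma>)" .
  qed (auto intro!: sum_nonneg less_imp_le[OF C])
qed

text \<open>A randomized loading procedure for positive inputs: step \<open>\<sigma>\<close> with random seed \<open>\<omega>\<close> queries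
  \<open>idx \<sigma> \<omega>\<close> at the vertex \<open>lab \<sigma> \<omega>\<close> of a learning graph, and \<open>view G x\<close> is what is known about the
  input \<open>x\<close> at vertex \<open>G\<close>.\<close>

lemma loading_procedure_upper_bound:
  fixes lab :: "'i \<Rightarrow> 'w \<Rightarrow> 'l" and idx :: "'i \<Rightarrow> 'w \<Rightarrow> nat" and \<Omega> :: "'i \<Rightarrow> (nat \<Rightarrow> nat) \<Rightarrow> 'w set"
    and view :: "'i \<Rightarrow> 'l \<Rightarrow> (nat \<Rightarrow> nat) \<Rightarrow> 'v" and Valid :: "'i \<Rightarrow> (nat \<Rightarrow> nat) \<Rightarrow> 'l set"
  defines "p \<equiv> (\<lambda>\<sigma> x G i. real (card {\<omega> \<in> \<Omega> \<sigma> x. lab \<sigma> \<omega> = G \<and> idx \<sigma> \<omega> = i}) / real (card (\<Omega> \<sigma> x)))"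
  assumes D: "finite D" and nm: "n > 0" "m > 0"
    and range: "\<And>x i. x \<in> D \<Longrightarrow> i \<in> {1..n} \<Longrightarrow> x i \<in> {1..m}"
    and I: "finite I" and \<Omega>: "\<And>\<sigma> x. \<sigma> \<in> I \<Longrightarrow> x \<in> D \<Longrightarrow> f x \<Longrightarrow> finite (\<Omega> \<sigma> x)"
    and Valid: "\<And>\<sigma> x. \<sigma> \<in> I \<Longrightarrow> x \<in> D \<Longrightarrow> finite (Valid \<sigma> x)"
    and cross: "\<And>x y. x \<in> D \<Longrightarrow> y \<in> D \<Longrightarrow> f x \<Longrightarrow> \<not> f y \<Longrightarrow>
      (\<Sum>\<sigma>\<in>I. real (card {\<omega> \<in> \<Omega> \<sigma> x. lab \<sigma> \<omega> \<in> Valid \<sigma> x \<inter> Valid \<sigma> y \<and> view \<sigma> (lab \<sigma> \<omega>) x = view \<sigma> (lab \<sigma> \<omega>) y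
          \<and> idx \<sigma> \<omega> \<in> {1..n} \<and> x (idx \<sigma> \<omega>) \<noteq> y (idx \<sigma> \<omega>)}) / real (card (\<Omega> \<sigma> x))) = 1"
    and C: "\<And>\<sigma>. \<sigma> \<in> I \<Longrightarrow> C \<sigma> > 0"
    and cost: "\<And>\<sigma> x y. \<sigma> \<in> I \<Longrightarrow> x \<in> D \<Longrightarrow> y \<in> D \<Longrightarrow> f x \<Longrightarrow> \<not> f y \<Longrightarrow>
      (\<Sum>i\<in>{1..n}. \<Sum>G\<in>Valid \<sigma> x. (p \<sigma> x G i)\<^sup>2) * (real n * real (card (Valid \<sigma> y))) \<le> (C \<sigma>)\<^sup>2"
  shows "\<exists>A. quantum_query_algorithm n m A \<and> computes_with_error n m A f D (1/4) \<and>
    real (num_queries A) \<le> 16 * (\<Sum>\<sigma>\<in>I. C \<sigma>) + 2"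
proof -
  \<comment> \<open>A coordinate is a vertex together with its view: two inputs meet in it exactly
    if the vertex is valid for both and shows them the same.\<close>
  define Z where "Z \<sigma> = (\<Union>x\<in>D. (\<lambda>G. (G, view \<sigma> G x)) ` Valid \<sigma> x)" for \<sigma>
  \<comment> \<open>Positive inputs carry the probability of the edge, negative ones amplitude
    \<open>1\<close> on every valid vertex. Mixed products are thus probabilities, and the negative
    cost is \<open>n\<close> times the number of valid vertices.\<close>
  define g where "g \<sigma> x i G = (if f x then p \<sigma> x G i else 1)" for \<sigma> x i G
  define u where "u \<sigma> x i z = (if z \<in> (\<lambda>G. (G, view \<sigma> G x)) ` Valid \<sigma> x then g \<sigma> x i (fst z) else 0)" for \<sigma> x i z
  have finZ: "finite (Z \<sigma>)" if "\<sigma> \<in> I" for \<sigma> using D Valid[OF that] by (simp add: Z_def)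
  have sq: "(\<Sum>z\<in>Z \<sigma>. (u \<sigma> x i z)\<^sup>2) = (\<Sum>G\<in>Valid \<sigma> x. (g \<sigma> x i G)\<^sup>2)" if "\<sigma> \<in> I" "x \<in> D" for \<sigma> x i
  proof -
    have "(\<Sum>z\<in>Z \<sigma>. (u \<sigma> x i z)\<^sup>2) = (\<Sum>z\<in>(\<lambda>G. (G, view \<sigma> G x)) ` Valid \<sigma> x. (g \<sigma> x i (fst z))\<^sup>2)"
      using that finZ[OF that(1)] by (intro sum.mono_neutral_cong_right) (auto simp: Z_def u_def)
    also have "\<dots> = (\<Sum>G\<in>Valid \<sigma> x. (g \<sigma> x i G)\<^sup>2)"
      by (subst sum.reindex) (auto simp: inj_on_def)
    finally show ?thesis .
  qed
  show ?thesis
  proof (rule adversary_upper_bound_steps[where u = u and Z = Z and C = C, OF D nm _ I])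
    show "x i \<in> {1..m}" if "x \<in> D" "i \<in> {1..n}" for x i using range that .
    show "finite (Z \<sigma>)" if "\<sigma> \<in> I" for \<sigma> using finZ that .
    show "C \<sigma> > 0" if "\<sigma> \<in> I" for \<sigma> using C that .
  next
    fix x y assume xy: "x \<in> D" "y \<in> D" "f x" "\<not> f y"
    have "(\<Sum>i\<in>{1..n}. if x i \<noteq> y i then \<Sum>z\<in>Z \<sigma>. u \<sigma> x i z * u \<sigma> y i z else 0)
      = real (card {\<omega> \<in> \<Omega> \<sigma> x. lab \<sigma> \<omega> \<in> Valid \<sigma> x \<inter> Valid \<sigma> y \<and> view \<sigma> (lab \<sigma> \<omega>) x = view \<sigma> (lab \<sigma> \<omega>) y
          \<and> idx \<sigma> \<omega> \<in> {1..n} \<and> x (idx \<sigma> \<omega>) \<noteq> y (idx \<sigma> \<omega>)}) / real (card (\<Omega> \<sigma> x))"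
      (is "?lhs = real (card ?S) / _") if \<sigma>: "\<sigma> \<in> I" for \<sigma>
    proof -
      let ?V = "{G \<in> Valid \<sigma> x \<inter> Valid \<sigma> y. view \<sigma> G x = view \<sigma> G y}"
      let ?T = "\<lambda>i G. {\<omega> \<in> \<Omega> \<sigma> x. lab \<sigma> \<omega> = G \<and> idx \<sigma> \<omega> = i}"
      let ?J = "{i \<in> {1..n}. x i \<noteq> y i}"
      have "(\<Sum>z\<in>Z \<sigma>. u \<sigma> x i z * u \<sigma> y i z) = (\<Sum>G\<in>?V. p \<sigma> x G i)" for i
      proof -
        have "(\<Sum>z\<in>Z \<sigma>. u \<sigma> x i z * u \<sigma> y i z) = (\<Sum>z\<in>(\<lambda>G. (G, view \<sigma> G x)) ` ?V. p \<sigma> x (fst z) i)"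
          using xy finZ[OF \<sigma>] by (intro sum.mono_neutral_cong_right) (auto simp: Z_def u_def g_def)
        also have "\<dots> = (\<Sum>G\<in>?V. p \<sigma> x G i)" by (subst sum.reindex) (auto simp: inj_on_def)
        finally show ?thesis .
      qed
      then have "?lhs = (\<Sum>i\<in>?J. \<Sum>G\<in>?V. p \<sigma> x G i)"
        by (simp only: sum.inter_filter finite_atLeastAtMost)
      also have "\<dots> = real (\<Sum>i\<in>?J. \<Sum>G\<in>?V. card (?T i G)) / real (card (\<Omega> \<sigma> x))"
        by (simp add: p_def sum_divide_distrib)
      also have "(\<Sum>i\<in>?J. \<Sum>G\<in>?V. card (?T i G)) = (\<Sum>e\<in>?J \<times> ?V. card (?T (fst e) (snd e)))"
        by (simp add: sum.cartesian_product case_prod_unfold)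
      also have "\<dots> = card (\<Union>e\<in>?J \<times> ?V. ?T (fst e) (snd e))"
        using Valid[OF \<sigma> xy(1)] \<Omega>[OF \<sigma> xy(1,3)] by (subst card_UN_disjoint) auto
      also have "(\<Union>e\<in>?J \<times> ?V. ?T (fst e) (snd e)) = ?S" by auto
      finally show ?thesis .
    qed
    then show "(\<Sum>\<sigma>\<in>I. \<Sum>i\<in>{1..n}. if x i \<noteq> y i then \<Sum>z\<in>Z \<sigma>. u \<sigma> x i z * u \<sigma> y i z else 0) = 1"
      using cross[OF xy] by simp
  next
    fix \<sigma> x y assume \<sigma>: "\<sigma> \<in> I" and xy: "x \<in> D" "y \<in> D" "f x" "\<not> f y"
    show "(\<Sum>i\<in>{1..n}. \<Sum>z\<in>Z \<sigma>. (u \<sigma> x i z)\<^sup>2) * (\<Sum>i\<in>{1..n}. \<Sum>z\<in>Z \<sigma>. (u \<sigma> y i z)\<^sup>2) \<le> (C \<sigma>)\<^sup>2"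
      using cost[OF \<sigma> xy] xy by (simp add: sq \<sigma> g_def)
  qed
qed

section \<open>Loading tuples of equal elements\<close>

text \<open>The first bad step is the minimum of a nonempty finite set. Its uniqueness makes the
  crossing probabilities add up to exactly \<open>1\<close>.\<close>

lemma card_first_bad:
  fixes S :: "'a :: linorder set"
  assumes "finite S" "\<exists>\<sigma>\<in>S. bad \<sigma>"
  shows "card {\<sigma> \<in> S. bad \<sigma> \<and> (\<forall>\<sigma>'\<in>S. \<sigma>' < \<sigma> \<longrightarrow> \<not> bad \<sigma>')} = 1"
proof -
  let ?B = "{\<sigma> \<in> S. bad \<sigma>}"
  have B: "finite ?B" "?B \<noteq> {}" using assms by auto
  have "{\<sigma> \<in> S. bad \<sigma> \<and> (\<forall>\<sigma>'\<in>S. \<sigma>' < \<sigma> \<longrightarrow> \<not> bad \<sigma>')} = {Min ?B}"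
  proof (intro equalityI subsetI)
    fix \<sigma> assume "\<sigma> \<in> {\<sigma> \<in> S. bad \<sigma> \<and> (\<forall>\<sigma>'\<in>S. \<sigma>' < \<sigma> \<longrightarrow> \<not> bad \<sigma>')}"
    then have "Min ?B = \<sigma>" using B by (intro Min_eqI) (auto simp: not_less[symmetric])
    then show "\<sigma> \<in> {Min ?B}" by simp
  next
    fix \<sigma> assume "\<sigma> \<in> {Min ?B}"
    then have \<sigma>: "\<sigma> = Min ?B" by simp
    have "\<sigma> \<in> ?B" using Min_in[OF B] \<sigma> by simp
    moreover have "\<not> \<sigma>' < \<sigma>" if "\<sigma>' \<in> ?B" for \<sigma>' using Min_le[OF B(1) that] \<sigma> by (simp add: not_less)
    ultimately show "\<sigma> \<in> {\<sigma> \<in> S. bad \<sigma> \<and> (\<forall>\<sigma>'\<in>S. \<sigma>' < \<sigma> \<longrightarrow> \<not> bad \<sigma>')}" by blast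
  qed
  then show ?thesis by simp
qed

text \<open>Lists with repetitions instead of sets: slots need not be disjoint, counts become
  powers, and a prefix of such a list is again one.\<close>

definition eqlists :: "(nat \<Rightarrow> 'v) \<Rightarrow> nat \<Rightarrow> nat \<Rightarrow> nat list set" where
  "eqlists val N s = {xs. length xs = s \<and> set xs \<subseteq> {1..N} \<and> (\<forall>i\<in>set xs. \<forall>j\<in>set xs. val i = val j)}"

lemma finite_eqlists: "finite (eqlists val N s)"
  by (rule finite_subset[OF _ finite_lists_length_eq[of "{1..N}" s]]) (auto simp: eqlists_def)

lemma take_eqlists: "xs \<in> eqlists val N t \<Longrightarrow> l \<le> t \<Longrightarrow> take l xs \<in> eqlists val N l"
  by (auto simp: eqlists_def dest: in_set_takeD)

text \<open>Transfers validity of a vertex from a positive input to a negative one that looks the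
  same there, so that no path is lost.\<close>

lemma eqlists_cong:
  assumes "map v xs = map w xs" "xs \<in> eqlists v N s"
  shows "xs \<in> eqlists w N s"
proof -
  have "w i = v i" if "i \<in> set xs" for i using assms(1) that by simp
  moreover have "v i = v j" if "i \<in> set xs" "j \<in> set xs" for i j
    using assms(2) that unfolding eqlists_def by blast
  ultimately have "w i = w j" if "i \<in> set xs" "j \<in> set xs" for i j using that by metis
  then show ?thesis using assms(2) unfolding eqlists_def by blast
qed

text \<open>Slot \<open>(s, a)\<close> receives an \<open>s\<close>-tuple of equal elements; the single slot \<open>(k, 0)\<close> comes last and
  receives the \<open>k\<close> equal elements of a positive input. Step \<open>((t, j), l)\<close> loads element \<open>l\<close> of the
  tuple in slot \<open>(t, j)\<close>.

  At that step the prefix loaded so far is an \<open>l\<close>-tuple. It is hidden among the tuples in the slots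
  \<open>(l, a)\<close>: it takes the place \<open>(l, q)\<close> for a random \<open>q \<le> r l\<close>, and the tuple displaced by it moves to
  the extra place \<open>(l, r l)\<close>. This is what makes the loading cheap.\<close>

locale loading_scheme =
  fixes k :: nat and r :: "nat \<Rightarrow> nat"
  assumes r0: "r 0 = 0" and rk: "r k = 1"
begin

definition slots :: "(nat \<times> nat) set" where
  "slots = Sigma {1..k} (\<lambda>s. {..<r s})"

text \<open>The order on pairs is lexicographic: all slots of lower levels come first, so the tuples
  among which a prefix is hidden are already loaded.\<close>

definition before :: "nat \<times> nat \<Rightarrow> (nat \<times> nat) set" where
  "before \<tau> = {\<rho> \<in> slots. \<rho> < \<tau>}"

definition steps :: "((nat \<times> nat) \<times> nat) set" where
  "steps = Sigma slots (\<lambda>\<tau>. {..<fst \<tau>})"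

text \<open>The extra place lies just beyond the slots of its level. For \<open>l = 0\<close> it is
  \<open>(0, 0)\<close> and holds the empty prefix.\<close>

definition places :: "(nat \<times> nat) \<times> nat \<Rightarrow> (nat \<times> nat) set" where
  "places \<sigma> = insert (snd \<sigma>, r (snd \<sigma>)) (before (fst \<sigma>))"

definition seeds :: "(nat \<Rightarrow> nat list set) \<Rightarrow> (nat \<times> nat \<Rightarrow> nat list) set" where
  "seeds C = PiE slots (\<lambda>\<rho>. C (fst \<rho>))"

text \<open>For \<open>snd \<omega> = r l\<close> the first branch already fills the extra place and
  nothing is displaced, so the second branch only reads genuine slots.\<close>

definition label :: "(nat \<times> nat) \<times> nat \<Rightarrow> (nat \<times> nat \<Rightarrow> nat list) \<times> nat \<Rightarrow> nat \<times> nat \<Rightarrow> nat list" where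
  "label \<sigma> \<omega> = (\<lambda>\<rho>\<in>places \<sigma>.
     if \<rho> = (snd \<sigma>, snd \<omega>) then take (snd \<sigma>) (fst \<omega> (fst \<sigma>))
     else if \<rho> = (snd \<sigma>, r (snd \<sigma>)) then fst \<omega> (snd \<sigma>, snd \<omega>)
     else fst \<omega> \<rho>)"

definition index :: "(nat \<times> nat) \<times> nat \<Rightarrow> (nat \<times> nat \<Rightarrow> nat list) \<times> nat \<Rightarrow> nat" where
  "index \<sigma> \<omega> = fst \<omega> (fst \<sigma>) ! snd \<sigma>"

definition labels :: "(nat \<Rightarrow> 'v) \<Rightarrow> nat \<Rightarrow> (nat \<times> nat) \<times> nat \<Rightarrow> (nat \<times> nat \<Rightarrow> nat list) set" where
  "labels val N \<sigma> = PiE (places \<sigma>) (\<lambda>\<rho>. eqlists val N (fst \<rho>))"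

lemma finite_slots [simp]: "finite slots" by (simp add: slots_def)
lemma finite_before [simp]: "finite (before \<tau>)" by (simp add: before_def)
lemma finite_steps [simp]: "finite steps" by (simp add: steps_def)
lemma finite_places [simp]: "finite (places \<sigma>)" by (simp add: places_def)

lemma finite_labels: "finite (labels val N \<sigma>)"
  unfolding labels_def by (intro finite_PiE finite_places finite_eqlists)

lemma before_subset: "before \<tau> \<subseteq> slots" by (auto simp: before_def)

lemma extra_place_notin: "(l, r l) \<notin> slots" by (simp add: slots_def)

lemma place_in_before:
  assumes "(\<tau>, l) \<in> steps" "a < r l"
  shows "(l, a) \<in> before \<tau>"
proof -
  have "l \<noteq> 0" using assms(2) r0 by (auto intro: gr0I)
  moreover have "l < fst \<tau>" "fst \<tau> \<le> k" using assms(1) by (auto simp: steps_def slots_def)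
  ultimately show ?thesis using assms(2) by (cases \<tau>) (auto simp: before_def slots_def)
qed

text \<open>Hiding only rearranges: the prefix and the displaced tuple exchange places, and the
  collection of lists does not depend on \<open>q\<close>.\<close>

lemma image_label:
  assumes \<sigma>: "(\<tau>, l) \<in> steps" and q: "q \<le> r l"
  shows "label (\<tau>, l) (F, q) ` places (\<tau>, l) = insert (take l (F \<tau>)) (F ` before \<tau>)"
proof (cases "q = r l")
  case True
  have "label (\<tau>, l) (F, q) \<rho> = F \<rho>" if "\<rho> \<in> before \<tau>" for \<rho>
    using that True extra_place_notin[of l] before_subset[of \<tau>] by (auto simp: label_def places_def)
  moreover have "label (\<tau>, l) (F, q) (l, r l) = take l (F \<tau>)"
    using True by (auto simp: label_def places_def)
  ultimately show ?thesis by (simp add: places_def)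
next
  case False
  then have lq: "(l, q) \<in> before \<tau>" using place_in_before[OF \<sigma>] q by simp
  have "label (\<tau>, l) (F, q) (l, r l) = F (l, q)" "label (\<tau>, l) (F, q) (l, q) = take l (F \<tau>)"
    using False lq by (auto simp: label_def places_def)
  moreover have "label (\<tau>, l) (F, q) ` (before \<tau> - {(l, q)}) = F ` (before \<tau> - {(l, q)})"
    using extra_place_notin[of l] before_subset[of \<tau>]
    by (intro image_cong refl) (auto simp: label_def places_def)
  moreover have "places (\<tau>, l) = insert (l, r l) (insert (l, q) (before \<tau> - {(l, q)}))"
    using lq by (auto simp: places_def)
  moreover have "F ` before \<tau> = insert (F (l, q)) (F ` (before \<tau> - {(l, q)}))" using lq by blast
  ultimately show ?thesis by (simp only: image_insert) blast
qed

lemma label_in_labels: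
  assumes \<sigma>: "(\<tau>, l) \<in> steps" and q: "q \<le> r l" and F: "F \<in> seeds C"
    and C: "\<And>s. s \<in> {1..k} \<Longrightarrow> C s \<subseteq> eqlists val N s"
  shows "label (\<tau>, l) (F, q) \<in> labels val N (\<tau>, l)"
proof -
  have Fe: "F \<rho> \<in> eqlists val N (fst \<rho>)" if "\<rho> \<in> slots" for \<rho>
  proof -
    have "F \<rho> \<in> C (fst \<rho>)" using F that by (auto simp: seeds_def dest: PiE_mem)
    then show ?thesis using that C[of "fst \<rho>"] by (auto simp: slots_def)
  qed
  have \<tau>: "\<tau> \<in> slots" "l < fst \<tau>" using \<sigma> by (auto simp: steps_def)
  have "take l (F \<tau>) \<in> eqlists val N l" using Fe[OF \<tau>(1)] \<tau>(2) by (auto intro: take_eqlists)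
  moreover have "F (l, q) \<in> eqlists val N l" if "q \<noteq> r l"
    using Fe[of "(l, q)"] place_in_before[OF \<sigma>, of q] that q before_subset[of \<tau>] by auto
  ultimately show ?thesis
    using Fe before_subset[of \<tau>] unfolding labels_def
    by (auto simp: label_def places_def split: if_splits)
qed

text \<open>By \<open>image_label\<close> a vertex shows precisely the elements of all earlier
  steps, wherever the prefix is hidden. Equal views therefore mean that no earlier step separates
  the inputs.\<close>

lemma views_agree_iff:
  assumes \<sigma>: "(\<tau>, l) \<in> steps" and q: "q \<le> r l"
    and len: "\<And>\<rho>. \<rho> \<in> slots \<Longrightarrow> length (F \<rho>) = fst \<rho>"
  shows "(\<forall>\<rho>\<in>places (\<tau>, l). map v (label (\<tau>, l) (F, q) \<rho>) = map w (label (\<tau>, l) (F, q) \<rho>)) \<longleftrightarrow>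
     (\<forall>\<sigma>'\<in>steps. \<sigma>' < (\<tau>, l) \<longrightarrow> v (F (fst \<sigma>') ! snd \<sigma>') = w (F (fst \<sigma>') ! snd \<sigma>'))"
proof -
  have \<tau>: "\<tau> \<in> slots" "l < fst \<tau>" using \<sigma> by (auto simp: steps_def)
  have "(\<forall>\<rho>\<in>places (\<tau>, l). map v (label (\<tau>, l) (F, q) \<rho>) = map w (label (\<tau>, l) (F, q) \<rho>)) \<longleftrightarrow>
    (\<forall>xs\<in>label (\<tau>, l) (F, q) ` places (\<tau>, l). map v xs = map w xs)" by blast
  also have "\<dots> \<longleftrightarrow> (\<forall>b<l. v (F \<tau> ! b) = w (F \<tau> ! b)) \<and>
      (\<forall>\<rho>\<in>before \<tau>. \<forall>b<fst \<rho>. v (F \<rho> ! b) = w (F \<rho> ! b))"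
    unfolding image_label[OF \<sigma> q] using \<tau> len before_subset[of \<tau>]
    by (auto simp: list_eq_iff_nth_eq subset_iff)
  also have "\<dots> \<longleftrightarrow> (\<forall>\<sigma>'\<in>steps. \<sigma>' < (\<tau>, l) \<longrightarrow> v (F (fst \<sigma>') ! snd \<sigma>') = w (F (fst \<sigma>') ! snd \<sigma>'))"
    using \<tau> by (fastforce simp: steps_def before_def less_prod_def')
  finally show ?thesis .
qed

lemma card_seeds: "card (seeds C) = (\<Prod>\<rho>\<in>slots. card (C (fst \<rho>)))"
  unfolding seeds_def by (rule card_PiE) simp

end

text \<open>The choices \<open>C s\<close> that the loading procedure of one input \<open>val\<close> makes for its slots \<open>(s, a)\<close>.\<close>

locale loading_choices = loading_scheme +
  fixes C :: "nat \<Rightarrow> nat list set" and val :: "nat \<Rightarrow> 'v" and N \<kappa> :: nat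
  assumes C: "\<And>s. s \<in> {1..k} \<Longrightarrow> C s \<subseteq> eqlists val N s"
    and C0: "\<And>s. s \<in> {1..k} \<Longrightarrow> C s \<noteq> {}"
    and fiber: "\<And>s v. s \<in> {1..k} \<Longrightarrow> card {b \<in> C s. \<exists>j\<in>set b. val j = v} \<le> \<kappa>"
begin

section \<open>Counting the seeds behind a vertex and an edge\<close>

lemma finite_C: "s \<in> {1..k} \<Longrightarrow> finite (C s)"
  using C finite_eqlists finite_subset by blast

lemma finite_seeds: "finite (seeds C)"
  unfolding seeds_def by (intro finite_PiE) (auto simp: slots_def intro: finite_C)

lemma card_C_pos: "s \<in> {1..k} \<Longrightarrow> card (C s) > 0"
  using C0 finite_C by (simp add: card_gt_0_iff)

lemma seeds_nonempty: "seeds C \<noteq> {}"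
  using C0 unfolding seeds_def by (auto simp: PiE_eq_empty_iff slots_def)

lemma seed_in_C: "F \<in> seeds C \<Longrightarrow> \<rho> \<in> slots \<Longrightarrow> F \<rho> \<in> C (fst \<rho>)"
  by (auto simp: seeds_def)

lemma seed_length: "F \<in> seeds C \<Longrightarrow> \<rho> \<in> slots \<Longrightarrow> length (F \<rho>) = fst \<rho>"
  using seed_in_C[of F \<rho>] C[of "fst \<rho>"] by (auto simp: slots_def eqlists_def)

lemma seed_values:
  "F \<in> seeds C \<Longrightarrow> \<rho> \<in> slots \<Longrightarrow> i \<in> set (F \<rho>) \<Longrightarrow> j \<in> set (F \<rho>) \<Longrightarrow> val i = val j"
  using seed_in_C[of F \<rho>] C[of "fst \<rho>"] by (fastforce simp: slots_def eqlists_def)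

text \<open>Slots are independent: once \<open>F \<tau>\<close> is fixed, \<open>F \<rho>\<close>
  satisfies the relation with probability at most \<open>\<kappa> / card (C (fst \<rho>))\<close>.
  The bound is multiplied out to stay in the naturals.\<close>

lemma card_seeds_pair:
  assumes \<rho>: "\<rho> \<in> slots" and \<tau>: "\<tau> \<in> slots" and ne: "\<rho> \<noteq> \<tau>"
    and P: "\<And>b. b \<in> C (fst \<tau>) \<Longrightarrow> card {c \<in> C (fst \<rho>). P c b} \<le> \<kappa>"
  shows "card {F \<in> seeds C. P (F \<rho>) (F \<tau>)} * card (C (fst \<rho>)) \<le> card (seeds C) * \<kappa>"
proof -
  let ?R = "\<Prod>\<rho>'\<in>slots - {\<rho>, \<tau>}. card (C (fst \<rho>'))"
  let ?A = "\<lambda>b \<rho>'. if \<rho>' = \<tau> then {b} else if \<rho>' = \<rho> then {c \<in> C (fst \<rho>). P c b} else C (fst \<rho>')"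
  have slots: "slots = insert \<rho> (insert \<tau> (slots - {\<rho>, \<tau>}))" using \<rho> \<tau> by auto
  have split: "(\<Prod>\<rho>'\<in>slots. g \<rho>') = g \<rho> * (g \<tau> * (\<Prod>\<rho>'\<in>slots - {\<rho>, \<tau>}. g \<rho>'))" for g :: "nat \<times> nat \<Rightarrow> nat"
    using ne by (subst slots) (simp add: prod.insert)
  have "card {F \<in> seeds C. P (F \<rho>) (F \<tau>)} \<le> card (\<Union>b\<in>C (fst \<tau>). PiE slots (?A b))"
  proof (rule card_mono)
    have "finite (C (fst \<tau>))" "\<And>\<rho>'. \<rho>' \<in> slots \<Longrightarrow> finite (C (fst \<rho>'))"
      using finite_C \<tau> by (auto simp: slots_def)
    then show "finite (\<Union>b\<in>C (fst \<tau>). PiE slots (?A b))"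
      using \<rho> by (auto intro!: finite_PiE)
    show "{F \<in> seeds C. P (F \<rho>) (F \<tau>)} \<subseteq> (\<Union>b\<in>C (fst \<tau>). PiE slots (?A b))"
    proof
      fix F assume F: "F \<in> {F \<in> seeds C. P (F \<rho>) (F \<tau>)}"
      then have "F \<in> PiE slots (?A (F \<tau>))" using ne by (auto simp: seeds_def PiE_iff)
      moreover have "F \<tau> \<in> C (fst \<tau>)" using F \<tau> seed_in_C by blast
      ultimately show "F \<in> (\<Union>b\<in>C (fst \<tau>). PiE slots (?A b))" by blast
    qed
  qed
  also have "\<dots> \<le> (\<Sum>b\<in>C (fst \<tau>). card (PiE slots (?A b)))"
    using finite_C \<tau> by (intro card_UN_le) (auto simp: slots_def)
  also have "\<dots> \<le> (\<Sum>b\<in>C (fst \<tau>). \<kappa> * ?R)"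
  proof (rule sum_mono)
    fix b assume b: "b \<in> C (fst \<tau>)"
    have "card (PiE slots (?A b)) = card {c \<in> C (fst \<rho>). P c b} * (1 * ?R)"
      using ne by (simp add: card_PiE split)
    also have "\<dots> \<le> \<kappa> * ?R" using P[OF b] by simp
    finally show "card (PiE slots (?A b)) \<le> \<kappa> * ?R" .
  qed
  also have "\<dots> = card (C (fst \<tau>)) * ?R * \<kappa>" by simp
  finally have "card {F \<in> seeds C. P (F \<rho>) (F \<tau>)} \<le> card (C (fst \<tau>)) * ?R * \<kappa>" .
  then have "card {F \<in> seeds C. P (F \<rho>) (F \<tau>)} * card (C (fst \<rho>))
     \<le> card (C (fst \<tau>)) * ?R * \<kappa> * card (C (fst \<rho>))" by (rule mult_right_mono) simp
  also have "\<dots> = card (seeds C) * \<kappa>" unfolding card_seeds split by (simp add: mult_ac)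
  finally show ?thesis .
qed

text \<open>The places of \<open>G\<close> that could hide the prefix of a tuple containing
  \<open>i\<close>. Their number measures how ambiguous \<open>q\<close> is for someone who sees
  only the edge.\<close>

definition match :: "(nat \<times> nat \<Rightarrow> nat list) \<Rightarrow> nat \<Rightarrow> nat \<Rightarrow> nat set" where
  "match G l i = {q. q \<le> r l \<and> (\<forall>j\<in>set (G (l, q)). val j = val i)}"

text \<open>Given the edge and a matching \<open>q\<close>, the slots before \<open>\<tau>\<close>
  are determined, the tuple in \<open>\<tau>\<close> contains \<open>i\<close> and has at most
  \<open>\<kappa>\<close> possibilities, and the later slots are free.\<close>

lemma card_same_label:
  assumes \<sigma>: "(\<tau>, l) \<in> steps"
  shows "card {\<omega> \<in> seeds C \<times> {..r l}. label (\<tau>, l) \<omega> = G \<and> index (\<tau>, l) \<omega> = i}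
    * (\<Prod>\<rho>\<in>before \<tau>. card (C (fst \<rho>))) * card (C (fst \<tau>)) \<le> card (match G l i) * \<kappa> * card (seeds C)"
proof -
  have \<tau>: "\<tau> \<in> slots" "l < fst \<tau>" using \<sigma> by (auto simp: steps_def)
  let ?after = "slots - before \<tau> - {\<tau>}"
  let ?Z = "{b \<in> C (fst \<tau>). \<exists>j\<in>set b. val j = val i}"
  \<comment> \<open>All earlier slots can be read off \<open>G\<close>; the tuple displaced from
    \<open>(l, q)\<close> stands in the extra place \<open>(l, r l)\<close>.\<close>
  let ?A = "\<lambda>q \<rho>. if \<rho> \<in> before \<tau> then {if \<rho> = (l, q) then G (l, r l) else G \<rho>}
     else if \<rho> = \<tau> then ?Z else C (fst \<rho>)"
  let ?R = "\<Prod>\<rho>\<in>?after. card (C (fst \<rho>))"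
  let ?S = "{\<omega> \<in> seeds C \<times> {..r l}. label (\<tau>, l) \<omega> = G \<and> index (\<tau>, l) \<omega> = i}"
  have \<tau>b: "\<tau> \<notin> before \<tau>" by (simp add: before_def)
  have split: "(\<Prod>\<rho>\<in>slots. g \<rho>) = (\<Prod>\<rho>\<in>before \<tau>. g \<rho>) * (g \<tau> * (\<Prod>\<rho>\<in>?after. g \<rho>))" for g :: "nat \<times> nat \<Rightarrow> nat"
  proof -
    have "slots = before \<tau> \<union> insert \<tau> ?after" using \<tau> before_subset[of \<tau>] by auto
    moreover have "prod g (before \<tau> \<union> insert \<tau> ?after) = prod g (before \<tau>) * prod g (insert \<tau> ?after)"
      using \<tau>b by (intro prod.union_disjoint) auto
    moreover have "prod g (insert \<tau> ?after) = g \<tau> * prod g ?after"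
      by (rule prod.insert) auto
    ultimately show ?thesis by simp
  qed
  have fin: "finite (match G l i)" by (simp add: match_def)
  have finC: "\<rho> \<in> slots \<Longrightarrow> finite (C (fst \<rho>))" for \<rho> using finite_C by (auto simp: slots_def)
  have sub: "?S \<subseteq> (\<Union>q\<in>match G l i. PiE slots (?A q) \<times> {q})"
  proof
    fix \<omega> assume "\<omega> \<in> ?S"
    then obtain F q where \<omega>: "\<omega> = (F, q)" and F: "F \<in> seeds C" and q: "q \<le> r l"
      and G: "label (\<tau>, l) (F, q) = G" and i: "F \<tau> ! l = i"
      by (auto simp: index_def)
    have i\<tau>: "i \<in> set (F \<tau>)" using i seed_length[OF F \<tau>(1)] \<tau>(2) by auto
    have "(l, q) \<in> places (\<tau>, l)" using q place_in_before[OF \<sigma>, of q] by (cases "q = r l") (auto simp: places_def)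
    then have "G (l, q) = take l (F \<tau>)" unfolding G[symmetric] by (simp add: label_def)
    then have "q \<in> match G l i"
      using q seed_values[OF F \<tau>(1) _ i\<tau>] by (auto simp: match_def dest: in_set_takeD)
    moreover have "F \<in> PiE slots (?A q)"
    proof (rule PiE_I)
      fix \<rho> assume \<rho>: "\<rho> \<in> slots"
      have "F \<rho> = (if \<rho> = (l, q) then G (l, r l) else G \<rho>)" if b: "\<rho> \<in> before \<tau>"
      proof -
        have ne: "\<rho> \<noteq> (l, r l)" using \<rho> extra_place_notin by auto
        then show ?thesis using b unfolding G[symmetric] by (auto simp: label_def places_def)
      qed
      moreover have "F \<tau> \<in> ?Z" using seed_in_C[OF F \<tau>(1)] i\<tau> by auto
      ultimately show "F \<rho> \<in> ?A q \<rho>" using seed_in_C[OF F \<rho>] by auto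
    qed (use F in \<open>auto simp: seeds_def\<close>)
    ultimately show "\<omega> \<in> (\<Union>q\<in>match G l i. PiE slots (?A q) \<times> {q})" using \<omega> by blast
  qed
  have "card ?S \<le> card (\<Union>q\<in>match G l i. PiE slots (?A q) \<times> {q})"
    using sub fin finC \<tau> by (intro card_mono) (auto intro!: finite_PiE finite_cartesian_product)
  also have "\<dots> \<le> (\<Sum>q\<in>match G l i. card (PiE slots (?A q) \<times> {q}))" by (rule card_UN_le[OF fin])
  also have "\<dots> \<le> (\<Sum>q\<in>match G l i. \<kappa> * ?R)"
  proof (rule sum_mono)
    fix q assume "q \<in> match G l i"
    have "card (PiE slots (?A q)) = (\<Prod>\<rho>\<in>before \<tau>. 1) * (card ?Z * ?R)"
      unfolding card_PiE[OF finite_slots] split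
      using \<tau>b by (intro arg_cong2[of _ _ _ _ "(*)"] prod.cong refl) auto
    also have "\<dots> \<le> \<kappa> * ?R" using fiber[of "fst \<tau>" "val i"] \<tau> by (auto simp: slots_def)
    finally show "card (PiE slots (?A q) \<times> {q}) \<le> \<kappa> * ?R" by (simp add: card_cartesian_product)
  qed
  also have "\<dots> = card (match G l i) * \<kappa> * ?R" by simp
  finally have "card ?S \<le> card (match G l i) * \<kappa> * ?R" .
  then have "card ?S * ((\<Prod>\<rho>\<in>before \<tau>. card (C (fst \<rho>))) * card (C (fst \<tau>)))
    \<le> card (match G l i) * \<kappa> * ?R * ((\<Prod>\<rho>\<in>before \<tau>. card (C (fst \<rho>))) * card (C (fst \<tau>)))"
    by (rule mult_right_mono) simp
  then show ?thesis unfolding card_seeds split by (simp add: mult_ac)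
qed

text \<open>Besides the true hiding place \<open>q\<close>, a place matches only if the tuple drawn
  for it has the value of \<open>i\<close> by coincidence. The displaced tuple is counted under its
  original slot, whence the renaming of \<open>q\<close> to \<open>r l\<close>.\<close>

lemma card_match_le:
  assumes \<sigma>: "(\<tau>, l) \<in> steps" and q: "q \<le> r l"
  shows "card (match (label (\<tau>, l) (F, q)) l i) \<le> 1 + card {a. a < r l \<and> (\<forall>j\<in>set (F (l, a)). val j = val i)}"
    (is "_ \<le> 1 + card ?A")
proof -
  let ?G = "label (\<tau>, l) (F, q)"
  have "match ?G l i \<subseteq> insert q ((\<lambda>a. if a = q then r l else a) ` ?A)"
  proof
    fix q' assume q': "q' \<in> match ?G l i"
    show "q' \<in> insert q ((\<lambda>a. if a = q then r l else a) ` ?A)"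
    proof (cases "q' = q")
      case False
      show ?thesis
      proof (cases "q' = r l")
        case True
        have "?G (l, q') = F (l, q)" using False True by (simp add: label_def places_def)
        then have "q \<in> ?A" using q' q False True by (auto simp: match_def)
        then show ?thesis using True by force
      next
        case False2: False
        then have lt: "q' < r l" using q' by (simp add: match_def)
        have "?G (l, q') = F (l, q')"
          using False False2 place_in_before[OF \<sigma> lt] by (auto simp: label_def places_def)
        then have "q' \<in> ?A" using q' lt by (auto simp: match_def)
        then show ?thesis using False by force
      qed
    qed simp
  qed
  then have "card (match ?G l i) \<le> card (insert q ((\<lambda>a. if a = q then r l else a) ` ?A))"
    by (intro card_mono) auto
  also have "\<dots> \<le> 1 + card ((\<lambda>a. if a = q then r l else a) ` ?A)"
    by (simp add: card_insert_if)
  also have "\<dots> \<le> 1 + card ?A" by (intro add_left_mono card_image_le) auto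
  finally show ?thesis .
qed

text \<open>A random seed has O(1) matching places on average: each of the \<open>r l\<close> tuples
  coincides with probability at most \<open>\<kappa> / card (C l)\<close>, and
  \<open>r l \<le> B * card (C l)\<close>. For \<open>l = 0\<close> there are no tuples to
  coincide.\<close>

lemma sum_card_match_le:
  assumes \<sigma>: "(\<tau>, l) \<in> steps" and B: "l > 0 \<Longrightarrow> r l \<le> B * card (C l)"
  shows "(\<Sum>\<omega>\<in>seeds C \<times> {..r l}. card (match (label (\<tau>, l) \<omega>) l (index (\<tau>, l) \<omega>)))
    \<le> card (seeds C) * (r l + 1) * (1 + B * \<kappa>)"
proof -
  have \<tau>: "\<tau> \<in> slots" "l < fst \<tau>" "l < k" using \<sigma> by (auto simp: steps_def slots_def)
  let ?A = "\<lambda>F. {a. a < r l \<and> (\<forall>j\<in>set (F (l, a)). val j = val (F \<tau> ! l))}"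
  have "(\<Sum>F\<in>seeds C. card (?A F)) = (\<Sum>a<r l. card {F \<in> seeds C. \<forall>j\<in>set (F (l, a)). val j = val (F \<tau> ! l)})"
  proof -
    have "(\<Sum>F\<in>seeds C. card (?A F)) = (\<Sum>F\<in>seeds C. \<Sum>a<r l. if \<forall>j\<in>set (F (l, a)). val j = val (F \<tau> ! l) then 1 else 0)"
      by (intro sum.cong refl) (simp add: sum.inter_filter[symmetric] lessThan_def)
    also have "\<dots> = (\<Sum>a<r l. \<Sum>F\<in>seeds C. if \<forall>j\<in>set (F (l, a)). val j = val (F \<tau> ! l) then 1 else 0)"
      by (rule sum.swap)
    finally show ?thesis using finite_seeds by (simp add: sum.inter_filter[symmetric])
  qed
  also have "\<dots> \<le> card (seeds C) * (B * \<kappa>)"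
  proof (cases "l = 0")
    case True
    then show ?thesis by (simp add: r0)
  next
    case False
    then have l: "l \<in> {1..k}" using \<tau> by auto
    have le: "card {F \<in> seeds C. \<forall>j\<in>set (F (l, a)). val j = val (F \<tau> ! l)} * card (C l) \<le> card (seeds C) * \<kappa>"
      if a: "a < r l" for a
    proof -
      have \<rho>: "(l, a) \<in> slots" "(l, a) \<noteq> \<tau>"
        using place_in_before[OF \<sigma> a] by (auto simp: before_def)
      have "card {c \<in> C (fst (l, a)). \<forall>j\<in>set c. val j = val (b ! l)} \<le> \<kappa>" for b
      proof -
        have "{c \<in> C l. \<forall>j\<in>set c. val j = val (b ! l)} \<subseteq> {c \<in> C l. \<exists>j\<in>set c. val j = val (b ! l)}"
        proof
          fix c assume c: "c \<in> {c \<in> C l. \<forall>j\<in>set c. val j = val (b ! l)}"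
          then have "length c = l" using C[OF l] by (auto simp: eqlists_def)
          then have "hd c \<in> set c" using False by (cases c) auto
          then show "c \<in> {c \<in> C l. \<exists>j\<in>set c. val j = val (b ! l)}" using c by auto
        qed
        then have "card {c \<in> C l. \<forall>j\<in>set c. val j = val (b ! l)} \<le> card {c \<in> C l. \<exists>j\<in>set c. val j = val (b ! l)}"
          using finite_C[OF l] by (intro card_mono) auto
        then show ?thesis using fiber[OF l, of "val (b ! l)"] by simp
      qed
      then show ?thesis
        using card_seeds_pair[OF \<rho>(1) \<tau>(1) \<rho>(2), of "\<lambda>c b. \<forall>j\<in>set c. val j = val (b ! l)"] by simp
    qed
    have "(\<Sum>a<r l. card {F \<in> seeds C. \<forall>j\<in>set (F (l, a)). val j = val (F \<tau> ! l)}) * card (C l)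
      \<le> (\<Sum>a<r l. card (seeds C) * \<kappa>)"
      unfolding sum_distrib_right by (intro sum_mono le) auto
    also have "\<dots> = r l * (card (seeds C) * \<kappa>)" by simp
    also have "\<dots> \<le> B * card (C l) * (card (seeds C) * \<kappa>)"
      using B False by (intro mult_right_mono) auto
    finally have "(\<Sum>a<r l. card {F \<in> seeds C. \<forall>j\<in>set (F (l, a)). val j = val (F \<tau> ! l)}) * card (C l)
      \<le> (card (seeds C) * (B * \<kappa>)) * card (C l)" by (simp add: mult_ac)
    then show ?thesis using card_C_pos[OF l] by simp
  qed
  finally have A: "(\<Sum>F\<in>seeds C. card (?A F)) \<le> card (seeds C) * (B * \<kappa>)" .
  have "(\<Sum>\<omega>\<in>seeds C \<times> {..r l}. card (match (label (\<tau>, l) \<omega>) l (index (\<tau>, l) \<omega>)))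
    = (\<Sum>F\<in>seeds C. \<Sum>q\<le>r l. card (match (label (\<tau>, l) (F, q)) l (F \<tau> ! l)))"
    by (simp add: sum.cartesian_product index_def case_prod_unfold)
  also have "\<dots> \<le> (\<Sum>F\<in>seeds C. \<Sum>q\<le>r l. 1 + card (?A F))"
    by (intro sum_mono card_match_le[OF \<sigma>]) simp
  also have "\<dots> = (\<Sum>F\<in>seeds C. 1 + card (?A F)) * (r l + 1)"
    unfolding sum_distrib_right by (intro sum.cong refl) (simp add: algebra_simps)
  also have "(\<Sum>F\<in>seeds C. 1 + card (?A F)) = card (seeds C) + (\<Sum>F\<in>seeds C. card (?A F))"
    by (simp only: sum.distrib) simp
  also have "(card (seeds C) + (\<Sum>F\<in>seeds C. card (?A F))) * (r l + 1)
    \<le> (card (seeds C) + card (seeds C) * (B * \<kappa>)) * (r l + 1)"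
    using A by (intro mult_right_mono) auto
  finally show ?thesis by (simp add: algebra_simps)
qed

text \<open>Crossing at \<open>\<sigma>\<close> means that \<open>\<sigma>\<close> is the first step
  at which the inputs differ, independently of \<open>q\<close>, and every seed has exactly one such
  step.\<close>

lemma card_crossing:
  assumes bad: "\<And>F. F \<in> seeds C \<Longrightarrow> \<exists>\<sigma>\<in>steps. val (F (fst \<sigma>) ! snd \<sigma>) \<noteq> w (F (fst \<sigma>) ! snd \<sigma>)"
  shows "(\<Sum>\<sigma>\<in>steps. real (card {\<omega> \<in> seeds C \<times> {..r (snd \<sigma>)}.
      (\<forall>\<rho>\<in>places \<sigma>. map val (label \<sigma> \<omega> \<rho>) = map w (label \<sigma> \<omega> \<rho>)) \<and>
      val (index \<sigma> \<omega>) \<noteq> w (index \<sigma> \<omega>)}) / real (card (seeds C \<times> {..r (snd \<sigma>)}))) = 1"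
proof -
  let ?bad = "\<lambda>F \<sigma>. val (F (fst \<sigma>) ! snd \<sigma>) \<noteq> w (F (fst \<sigma>) ! snd \<sigma>)"
  let ?first = "\<lambda>F \<sigma>. ?bad F \<sigma> \<and> (\<forall>\<sigma>'\<in>steps. \<sigma>' < \<sigma> \<longrightarrow> \<not> ?bad F \<sigma>')"
  have ne: "real (card (seeds C)) > 0" using seeds_nonempty finite_seeds by (simp add: card_gt_0_iff)
  have "real (card {\<omega> \<in> seeds C \<times> {..r (snd \<sigma>)}.
      (\<forall>\<rho>\<in>places \<sigma>. map val (label \<sigma> \<omega> \<rho>) = map w (label \<sigma> \<omega> \<rho>)) \<and>
      val (index \<sigma> \<omega>) \<noteq> w (index \<sigma> \<omega>)}) / real (card (seeds C \<times> {..r (snd \<sigma>)}))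
    = real (card {F \<in> seeds C. ?first F \<sigma>}) / real (card (seeds C))" (is "real (card ?L) / _ = _")
    if \<sigma>: "\<sigma> \<in> steps" for \<sigma>
  proof -
    have "?L = {F \<in> seeds C. ?first F \<sigma>} \<times> {..r (snd \<sigma>)}"
    proof (rule Set.set_eqI)
      fix \<omega> :: "(nat \<times> nat \<Rightarrow> nat list) \<times> nat"
      obtain F q where \<omega>: "\<omega> = (F, q)" by force
      show "\<omega> \<in> ?L \<longleftrightarrow> \<omega> \<in> {F \<in> seeds C. ?first F \<sigma>} \<times> {..r (snd \<sigma>)}"
        using views_agree_iff[of "fst \<sigma>" "snd \<sigma>" q F val w] \<sigma> seed_length[of F]
        by (auto simp: \<omega> index_def)
    qed
    then show ?thesis
      by (simp only: card_cartesian_product of_nat_mult) (rule mult_divide_mult_cancel_right, simp)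
  qed
  then have "(\<Sum>\<sigma>\<in>steps. real (card {\<omega> \<in> seeds C \<times> {..r (snd \<sigma>)}.
      (\<forall>\<rho>\<in>places \<sigma>. map val (label \<sigma> \<omega> \<rho>) = map w (label \<sigma> \<omega> \<rho>)) \<and>
      val (index \<sigma> \<omega>) \<noteq> w (index \<sigma> \<omega>)}) / real (card (seeds C \<times> {..r (snd \<sigma>)})))
    = real (\<Sum>\<sigma>\<in>steps. card {F \<in> seeds C. ?first F \<sigma>}) / real (card (seeds C))"
    by (simp add: sum_divide_distrib)
  also have "(\<Sum>\<sigma>\<in>steps. card {F \<in> seeds C. ?first F \<sigma>}) = (\<Sum>\<sigma>\<in>steps. \<Sum>F\<in>seeds C. if ?first F \<sigma> then 1 else 0)"
    by (intro sum.cong refl) (simp add: sum.inter_filter[symmetric] finite_seeds)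
  also have "\<dots> = (\<Sum>F\<in>seeds C. \<Sum>\<sigma>\<in>steps. if ?first F \<sigma> then 1 else 0)" by (rule sum.swap)
  also have "\<dots> = (\<Sum>F\<in>seeds C. card {\<sigma> \<in> steps. ?first F \<sigma>})"
    by (intro sum.cong refl) (simp add: sum.inter_filter[symmetric])
  also have "\<dots> = (\<Sum>F\<in>seeds C. 1)"
    by (intro sum.cong refl card_first_bad bad) auto
  finally show ?thesis using ne by simp
qed

end

text \<open>Summing over edges weighted by their seeds is summing over seeds; only an inequality,
  because \<open>J\<close> and \<open>L\<close> need not cover all edges.\<close>

lemma sum_card_fiber_le:
  fixes g :: "'a \<Rightarrow> 'b \<Rightarrow> nat"
  assumes "finite \<Omega>" "finite J" "finite L"
  shows "(\<Sum>i\<in>J. \<Sum>G\<in>L. card {\<omega> \<in> \<Omega>. a \<omega> = G \<and> b \<omega> = i} * g G i) \<le> (\<Sum>\<omega>\<in>\<Omega>. g (a \<omega>) (b \<omega>))"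
proof -
  have "(\<Sum>i\<in>J. \<Sum>G\<in>L. card {\<omega> \<in> \<Omega>. a \<omega> = G \<and> b \<omega> = i} * g G i)
     = (\<Sum>(i, G)\<in>J \<times> L. \<Sum>\<omega>\<in>{\<omega> \<in> \<Omega>. (b \<omega>, a \<omega>) = (i, G)}. g (a \<omega>) (b \<omega>))"
    unfolding sum.cartesian_product
    by (intro sum.cong refl) (auto simp: conj_commute)
  also have "\<dots> = (\<Sum>e\<in>J \<times> L. \<Sum>\<omega>\<in>{\<omega> \<in> {\<omega> \<in> \<Omega>. (b \<omega>, a \<omega>) \<in> J \<times> L}. (b \<omega>, a \<omega>) = e}. g (a \<omega>) (b \<omega>))"
    by (intro sum.cong refl) (auto intro!: arg_cong[where f = card])
  also have "\<dots> = (\<Sum>\<omega>\<in>{\<omega> \<in> \<Omega>. (b \<omega>, a \<omega>) \<in> J \<times> L}. g (a \<omega>) (b \<omega>))"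
    using assms by (intro sum.group) auto
  also have "\<dots> \<le> (\<Sum>\<omega>\<in>\<Omega>. g (a \<omega>) (b \<omega>))"
    using assms by (intro sum_mono2) auto
  finally show ?thesis .
qed

section \<open>Collision probability of the random edge and the cost of a step\<close>

context loading_choices
begin

definition edge_prob :: "(nat \<times> nat) \<times> nat \<Rightarrow> (nat \<times> nat \<Rightarrow> nat list) \<Rightarrow> nat \<Rightarrow> real" where
  "edge_prob \<sigma> G i = real (card {\<omega> \<in> seeds C \<times> {..r (snd \<sigma>)}. label \<sigma> \<omega> = G \<and> index \<sigma> \<omega> = i})
     / real (card (seeds C \<times> {..r (snd \<sigma>)}))"

text \<open>One factor \<open>edge_prob\<close> is bounded pointwise by the number of matching
  places via \<open>card_same_label\<close>; the other averages that number over the seeds, where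
  \<open>sum_card_match_le\<close> applies.\<close>

lemma sum_edge_prob_squares:
  assumes \<sigma>: "(\<tau>, l) \<in> steps" and B: "l > 0 \<Longrightarrow> r l \<le> B * card (C l)" and fin: "finite J" "finite L"
  shows "(\<Sum>i\<in>J. \<Sum>G\<in>L. (edge_prob (\<tau>, l) G i)\<^sup>2) *
     ((\<Prod>\<rho>\<in>before \<tau>. real (card (C (fst \<rho>)))) * real (card (C (fst \<tau>))) * (real (r l) + 1))
     \<le> real \<kappa> * (1 + real B * real \<kappa>)"
proof -
  let ?\<Omega> = "seeds C \<times> {..r l}"
  let ?S = "\<lambda>G i. {\<omega> \<in> ?\<Omega>. label (\<tau>, l) \<omega> = G \<and> index (\<tau>, l) \<omega> = i}"
  define X where "X = (\<Prod>\<rho>\<in>before \<tau>. real (card (C (fst \<rho>)))) * real (card (C (fst \<tau>)))"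
  have S: "real (card (seeds C)) > 0" using seeds_nonempty finite_seeds by (simp add: card_gt_0_iff)
  have \<Omega>: "real (card ?\<Omega>) = real (card (seeds C)) * (real (r l) + 1)"
    by (simp add: card_cartesian_product algebra_simps)
  have \<Omega>0: "real (card ?\<Omega>) > 0" unfolding \<Omega> using S by (intro mult_pos_pos) auto
  have p: "edge_prob (\<tau>, l) G i = real (card (?S G i)) / real (card ?\<Omega>)" for G i
    by (simp add: edge_prob_def)
  have X0: "X \<ge> 0" by (simp add: X_def prod_nonneg)
  have pX: "edge_prob (\<tau>, l) G i * (X * (real (r l) + 1)) \<le> real (card (match G l i)) * real \<kappa>" for G i
  proof -
    have "real (card (?S G i) * (\<Prod>\<rho>\<in>before \<tau>. card (C (fst \<rho>))) * card (C (fst \<tau>)))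
       \<le> real (card (match G l i) * \<kappa> * card (seeds C))"
      using card_same_label[OF \<sigma>, of G i] by (rule of_nat_mono)
    then have "real (card (?S G i)) * X \<le> real (card (match G l i)) * real \<kappa> * real (card (seeds C))"
      by (simp add: X_def mult.assoc)
    then show ?thesis using S unfolding p \<Omega> by (simp add: divide_simps add_pos_nonneg)
  qed
  have "(\<Sum>i\<in>J. \<Sum>G\<in>L. (edge_prob (\<tau>, l) G i)\<^sup>2) * (X * (real (r l) + 1))
    = (\<Sum>i\<in>J. \<Sum>G\<in>L. edge_prob (\<tau>, l) G i * (edge_prob (\<tau>, l) G i * (X * (real (r l) + 1))))"
    by (simp add: sum_distrib_right power2_eq_square mult.assoc)
  also have "\<dots> \<le> (\<Sum>i\<in>J. \<Sum>G\<in>L. edge_prob (\<tau>, l) G i * (real (card (match G l i)) * real \<kappa>))"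
    using pX by (intro sum_mono mult_left_mono) (auto simp: edge_prob_def)
  also have "\<dots> = real \<kappa> * real (\<Sum>i\<in>J. \<Sum>G\<in>L. card (?S G i) * card (match G l i)) / real (card ?\<Omega>)"
    unfolding p by (simp add: sum_distrib_left sum_divide_distrib mult_ac)
  also have "\<dots> \<le> real \<kappa> * real (card (seeds C) * (r l + 1) * (1 + B * \<kappa>)) / real (card ?\<Omega>)"
  proof -
    have "(\<Sum>i\<in>J. \<Sum>G\<in>L. card (?S G i) * card (match G l i))
      \<le> (\<Sum>\<omega>\<in>?\<Omega>. card (match (label (\<tau>, l) \<omega>) l (index (\<tau>, l) \<omega>)))"
      using fin finite_seeds by (intro sum_card_fiber_le) auto
    also have "\<dots> \<le> card (seeds C) * (r l + 1) * (1 + B * \<kappa>)" by (rule sum_card_match_le[OF \<sigma> B])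
    finally show ?thesis by (intro divide_right_mono mult_left_mono of_nat_mono) auto
  qed
  also have "\<dots> = real \<kappa> * (1 + real B * real \<kappa>)"
  proof -
    have "real (card (seeds C) * (r l + 1) * (1 + B * \<kappa>)) = real (card ?\<Omega>) * (1 + real B * real \<kappa>)"
      unfolding \<Omega> by (simp add: algebra_simps)
    then show ?thesis using \<Omega>0 by simp
  qed
  finally show ?thesis by (simp only: X_def)
qed

text \<open>Slot by slot, the negative count \<open>card (eqlists w N s)\<close> cancels against the
  positive \<open>card (C s)\<close> up to \<open>\<gamma>\<close>. Left over are the extra place in
  the numerator, and the tuple being loaded and the \<open>r l + 1\<close> hiding places in the
  denominator.\<close>

lemma step_cost:
  fixes w :: "nat \<Rightarrow> 'u" and \<gamma> :: real
  assumes \<sigma>: "(\<tau>, l) \<in> steps" and B: "l > 0 \<Longrightarrow> r l \<le> B * card (C l)" and fin: "finite J" "finite L"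
    and \<gamma>: "\<gamma> \<ge> 1" "\<And>s. s \<in> {1..<k} \<Longrightarrow> real (card (eqlists w N s)) \<le> \<gamma> * real (card (C s))"
  shows "(\<Sum>i\<in>J. \<Sum>G\<in>L. (edge_prob (\<tau>, l) G i)\<^sup>2) * (real n * real (card (labels w N (\<tau>, l))))
     \<le> real n * (real \<kappa> * (1 + real B * real \<kappa>)) * \<gamma> ^ card slots
        * (real (card (eqlists w N l)) / ((real (r l) + 1) * real (card (C (fst \<tau>)))))"
proof -
  let ?E = "\<lambda>s. real (card (eqlists w N s))"
  let ?P = "\<Sum>i\<in>J. \<Sum>G\<in>L. (edge_prob (\<tau>, l) G i)\<^sup>2"
  let ?X = "\<Prod>\<rho>\<in>before \<tau>. real (card (C (fst \<rho>)))"
  have \<tau>: "\<tau> \<in> slots" using \<sigma> by (simp add: steps_def)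
  \<comment> \<open>By \<open>r k = 1\<close> the only slot of level \<open>k\<close> is the last
    one. This matters because the ratio \<open>\<gamma>\<close> is assumed for levels below
    \<open>k\<close> only.\<close>
  have fst_before: "fst \<rho> \<in> {1..<k}" if "\<rho> \<in> before \<tau>" for \<rho>
    using that \<tau> rk by (cases \<rho>; cases \<tau>) (auto simp: before_def slots_def le_less)
  have Ct: "real (card (C (fst \<tau>))) > 0" using card_C_pos \<tau> by (auto simp: slots_def)
  have "real (card (labels w N (\<tau>, l))) = ?E l * (\<Prod>\<rho>\<in>before \<tau>. ?E (fst \<rho>))"
  proof -
    have "(l, r l) \<notin> before \<tau>" using extra_place_notin[of l] before_subset[of \<tau>] by blast
    then show ?thesis by (simp add: labels_def card_PiE places_def)
  qed
  also have "(\<Prod>\<rho>\<in>before \<tau>. ?E (fst \<rho>)) \<le> (\<Prod>\<rho>\<in>before \<tau>. \<gamma> * real (card (C (fst \<rho>))))"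
    using \<gamma> fst_before by (intro prod_mono) auto
  also have "\<dots> = \<gamma> ^ card (before \<tau>) * ?X" by (simp add: prod.distrib)
  also have "\<dots> \<le> \<gamma> ^ card slots * ?X"
    using \<gamma>(1) before_subset[of \<tau>]
    by (intro mult_right_mono power_increasing card_mono) (auto intro!: prod_nonneg)
  finally have lab: "real (card (labels w N (\<tau>, l))) \<le> ?E l * (\<gamma> ^ card slots * ?X)"
    by (simp add: mult_left_mono)
  have P0: "?P \<ge> 0" by (intro sum_nonneg) auto
  have "?P * (real n * real (card (labels w N (\<tau>, l)))) \<le> ?P * (real n * (?E l * (\<gamma> ^ card slots * ?X)))"
    using lab P0 by (intro mult_left_mono) auto
  also have "\<dots> = real n * \<gamma> ^ card slots * (?E l / ((real (r l) + 1) * real (card (C (fst \<tau>)))))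
      * (?P * (?X * real (card (C (fst \<tau>))) * (real (r l) + 1)))"
    using Ct by (simp add: divide_simps)
  also have "\<dots> \<le> real n * \<gamma> ^ card slots * (?E l / ((real (r l) + 1) * real (card (C (fst \<tau>)))))
      * (real \<kappa> * (1 + real B * real \<kappa>))"
    using sum_edge_prob_squares[OF \<sigma> B fin] \<gamma>(1) by (intro mult_left_mono) auto
  finally show ?thesis by (simp add: mult_ac)
qed

end

section \<open>Counting tuples under the promise\<close>

text \<open>The input is padded with \<open>n\<close> indices carrying unique values, so that there are always at least
  \<open>n\<close> choices for a tuple.\<close>

definition padded :: "nat \<Rightarrow> nat \<Rightarrow> (nat \<Rightarrow> nat) \<Rightarrow> nat \<Rightarrow> nat" where
  "padded n m x i = (if i \<le> n then x i else m + i)"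

text \<open>The promise controls classes of fewer than \<open>k\<close> elements only, so a positive
  input must not draw its random tuples from larger ones. The singletons are the padding.\<close>

definition small_classes :: "nat \<Rightarrow> nat \<Rightarrow> (nat \<Rightarrow> nat) \<Rightarrow> nat set set" where
  "small_classes k n x = (\<Union>t\<in>{1..<k}. t_tuples t n x) \<union> (\<lambda>j. {j}) ` {n + 1..2 * n}"

definition choices :: "nat \<Rightarrow> nat \<Rightarrow> (nat \<Rightarrow> nat) \<Rightarrow> nat \<Rightarrow> nat list set" where
  "choices k n x s = (\<Union>J\<in>small_classes k n x. {xs. set xs \<subseteq> J \<and> length xs = s})"

lemma finite_t_tuples: "finite (t_tuples t n x)"
  by (rule finite_subset[of _ "Pow {1..n}"]) (auto simp: t_tuples_def)

lemma finite_small_classes: "finite (small_classes k n x)"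
  by (simp add: small_classes_def finite_t_tuples)

lemma card_t_tuples_le:
  assumes "t \<ge> 1"
  shows "card (t_tuples t n x) \<le> n"
proof -
  have "t_tuples t n x \<subseteq> (\<lambda>i. {j \<in> {1..n}. x j = x i}) ` {1..n}"
  proof
    fix I assume I: "I \<in> t_tuples t n x"
    then have "I \<noteq> {}" using assms by (auto simp: t_tuples_def)
    then obtain i where i: "i \<in> I" by blast
    have "I = {j \<in> {1..n}. x j = x i}"
    proof (intro equalityI subsetI)
      fix j assume "j \<in> I"
      then show "j \<in> {j \<in> {1..n}. x j = x i}" using I i unfolding t_tuples_def by blast
    next
      fix j assume j: "j \<in> {j \<in> {1..n}. x j = x i}"
      show "j \<in> I"
      proof (rule ccontr)
        assume "j \<notin> I"
        then have "x i \<noteq> x j" using I i j unfolding t_tuples_def by blast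
        then show False using j by simp
      qed
    qed
    moreover have "i \<in> {1..n}" using I i unfolding t_tuples_def by blast
    ultimately show "I \<in> (\<lambda>i. {j \<in> {1..n}. x j = x i}) ` {1..n}" by blast
  qed
  then have "card (t_tuples t n x) \<le> card ((\<lambda>i. {j \<in> {1..n}. x j = x i}) ` {1..n})"
    by (intro card_mono) auto
  also have "\<dots> \<le> n" using card_image_le[of "{1..n}" "\<lambda>i. {j \<in> {1..n}. x j = x i}"] by simp
  finally show ?thesis .
qed

context
  fixes k n m :: nat and x :: "nat \<Rightarrow> nat"
  assumes k2: "k \<ge> 2" and x: "\<And>i. i \<in> {1..n} \<Longrightarrow> x i \<in> {1..m}"
begin

lemma small_class:
  assumes "J \<in> small_classes k n x"
  shows "J \<subseteq> {1..2 * n}" "J \<noteq> {}" "finite J" "card J < k"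
    and "\<And>i j. i \<in> J \<Longrightarrow> j \<in> {1..2 * n} \<Longrightarrow> padded n m x i = padded n m x j \<longleftrightarrow> j \<in> J"
proof -
  have "J \<subseteq> {1..2 * n} \<and> J \<noteq> {} \<and> card J < k \<and>
    (\<forall>i\<in>J. \<forall>j\<in>{1..2 * n}. padded n m x i = padded n m x j \<longleftrightarrow> j \<in> J)"
  proof (cases "\<exists>t\<in>{1..<k}. J \<in> t_tuples t n x")
    case True
    then obtain t where t: "t \<in> {1..<k}" and sub: "J \<subseteq> {1..n}" and card: "card J = t"
      and eq: "\<And>i j. i \<in> J \<Longrightarrow> j \<in> J \<Longrightarrow> x i = x j"
      and ne: "\<And>i j. i \<in> J \<Longrightarrow> j \<in> {1..n} - J \<Longrightarrow> x i \<noteq> x j"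
      unfolding t_tuples_def by blast
    have "padded n m x i = padded n m x j \<longleftrightarrow> j \<in> J" if i: "i \<in> J" and j: "j \<in> {1..2 * n}" for i j
    proof (cases "j \<le> n")
      case True
      then have "j \<in> {1..n}" "i \<le> n" using i j sub by auto
      then show ?thesis using eq[OF i, of j] ne[OF i, of j] by (auto simp: padded_def)
    next
      case False
      moreover have "i \<in> {1..n}" using i sub by auto
      then have "x i \<le> m" "i \<le> n" using x by fastforce+
      ultimately show ?thesis using sub by (auto simp: padded_def)
    qed
    then show ?thesis using t sub card by auto
  next
    case False
    then obtain l where l: "l \<in> {n + 1..2 * n}" "J = {l}" using assms by (auto simp: small_classes_def)
    have "padded n m x l = padded n m x j \<longleftrightarrow> j = l" if "j \<in> {1..2 * n}" for j
      using l that x[of j] by (auto simp: padded_def)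
    then show ?thesis using l k2 by auto
  qed
  then show "J \<subseteq> {1..2 * n}" "J \<noteq> {}" "card J < k"
    "\<And>i j. i \<in> J \<Longrightarrow> j \<in> {1..2 * n} \<Longrightarrow> padded n m x i = padded n m x j \<longleftrightarrow> j \<in> J" by blast+
  then show "finite J" using finite_subset by blast
qed

lemma small_classes_disjoint:
  assumes "J \<in> small_classes k n x" "J' \<in> small_classes k n x" "i \<in> J" "i \<in> J'"
  shows "J = J'"
proof -
  have "j \<in> J \<longleftrightarrow> j \<in> J'" if "j \<in> {1..2 * n}" for j
    using small_class(5)[OF assms(1,3) that] small_class(5)[OF assms(2,4) that] by simp
  then show ?thesis using small_class(1)[OF assms(1)] small_class(1)[OF assms(2)] by blast
qed

lemma choices_subset_eqlists: "choices k n x s \<subseteq> eqlists (padded n m x) (2 * n) s"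
proof
  fix xs assume "xs \<in> choices k n x s"
  then obtain J where J: "J \<in> small_classes k n x" and xs: "set xs \<subseteq> J" "length xs = s"
    by (auto simp: choices_def)
  have "padded n m x i = padded n m x j" if "i \<in> set xs" "j \<in> set xs" for i j
    using small_class(5)[OF J, of i j] small_class(1)[OF J] xs that by blast
  then show "xs \<in> eqlists (padded n m x) (2 * n) s"
    using xs small_class(1)[OF J] unfolding eqlists_def by blast
qed

text \<open>A class of size \<open>t\<close> yields \<open>t ^ s\<close> lists, and for
  \<open>s \<ge> 1\<close> the first entry determines the class. The count is thus affine in the
  numbers of \<open>t\<close>-tuples, which the promise controls.\<close>

lemma card_choices:
  assumes s: "s \<ge> 1"
  shows "card (choices k n x s) = (\<Sum>t\<in>{1..<k}. card (t_tuples t n x) * t ^ s) + n"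
proof -
  have nz: "card (choices k n x s) = (\<Sum>J\<in>small_classes k n x. card {xs. set xs \<subseteq> J \<and> length xs = s})"
    unfolding choices_def
  proof (rule card_UN_disjoint)
    show "\<forall>J\<in>small_classes k n x. finite {xs. set xs \<subseteq> J \<and> length xs = s}"
      using small_class(3) finite_lists_length_eq by blast
    show "\<forall>J\<in>small_classes k n x. \<forall>J'\<in>small_classes k n x. J \<noteq> J' \<longrightarrow>
      {xs. set xs \<subseteq> J \<and> length xs = s} \<inter> {xs. set xs \<subseteq> J' \<and> length xs = s} = {}"
    proof (intro ballI impI)
      fix J J' assume J: "J \<in> small_classes k n x" "J' \<in> small_classes k n x" "J \<noteq> J'"
      have False if xs: "set xs \<subseteq> J" "set xs \<subseteq> J'" "length xs = s" for xs
      proof -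
        have "hd xs \<in> set xs" using s xs by (cases xs) auto
        then show False using small_classes_disjoint[OF J(1,2), of "hd xs"] J(3) xs by blast
      qed
      then show "{xs. set xs \<subseteq> J \<and> length xs = s} \<inter> {xs. set xs \<subseteq> J' \<and> length xs = s} = {}" by blast
    qed
  qed (rule finite_small_classes)
  also have "\<dots> = (\<Sum>J\<in>small_classes k n x. card J ^ s)"
    by (intro sum.cong refl card_lists_length_eq small_class(3))
  also have "\<dots> = (\<Sum>J\<in>(\<Union>t\<in>{1..<k}. t_tuples t n x). card J ^ s) + (\<Sum>J\<in>(\<lambda>j. {j}) ` {n + 1..2 * n}. card J ^ s)"
    unfolding small_classes_def
  proof (rule sum.union_disjoint)
    have "J \<subseteq> {1..n}" if "J \<in> (\<Union>t\<in>{1..<k}. t_tuples t n x)" for J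
      using that by (auto simp: t_tuples_def)
    moreover have "\<not> {j} \<subseteq> {1..n}" if "j \<in> {n + 1..2 * n}" for j using that by auto
    ultimately show "(\<Union>t\<in>{1..<k}. t_tuples t n x) \<inter> (\<lambda>j. {j}) ` {n + 1..2 * n} = {}" by blast
  qed (auto simp: finite_t_tuples)
  also have "(\<Sum>J\<in>(\<Union>t\<in>{1..<k}. t_tuples t n x). card J ^ s) = (\<Sum>t\<in>{1..<k}. \<Sum>J\<in>t_tuples t n x. card J ^ s)"
  proof (rule sum.UNION_disjoint)
    show "\<forall>t\<in>{1..<k}. \<forall>t'\<in>{1..<k}. t \<noteq> t' \<longrightarrow> t_tuples t n x \<inter> t_tuples t' n x = {}"
      unfolding t_tuples_def by blast
  qed (auto simp: finite_t_tuples)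
  also have "\<dots> = (\<Sum>t\<in>{1..<k}. card (t_tuples t n x) * t ^ s)"
    by (intro sum.cong refl) (simp add: t_tuples_def)
  also have "(\<Sum>J\<in>(\<lambda>j. {j}) ` {n + 1..2 * n}. card J ^ s) = n"
    by (subst sum.reindex) auto
  finally show ?thesis .
qed

text \<open>A value belongs to at most one small class, and all entries of the list lie in it. This
  supplies the assumption \<open>fiber\<close>.\<close>

lemma choices_fiber:
  assumes "s \<le> k"
  shows "card {b \<in> choices k n x s. \<exists>j\<in>set b. padded n m x j = v} \<le> k ^ k"
proof (cases "{b \<in> choices k n x s. \<exists>j\<in>set b. padded n m x j = v} = {}")
  case False
  then obtain b j J where J: "J \<in> small_classes k n x" and j: "j \<in> J" "padded n m x j = v"
    by (auto simp: choices_def)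
  have "{b \<in> choices k n x s. \<exists>j\<in>set b. padded n m x j = v} \<subseteq> {xs. set xs \<subseteq> J \<and> length xs = s}"
  proof
    fix b assume "b \<in> {b \<in> choices k n x s. \<exists>j\<in>set b. padded n m x j = v}"
    then obtain J' i where J': "J' \<in> small_classes k n x" "set b \<subseteq> J'" "length b = s"
      and i: "i \<in> J'" "padded n m x i = v" by (auto simp: choices_def)
    have "i \<in> J" using small_class(5)[OF J j(1), of i] i j small_class(1)[OF J'(1)] by auto
    then have "J' = J" using small_classes_disjoint[OF J'(1) J i(1)] by simp
    then show "b \<in> {xs. set xs \<subseteq> J \<and> length xs = s}" using J' by simp
  qed
  then have "card {b \<in> choices k n x s. \<exists>j\<in>set b. padded n m x j = v} \<le> card {xs. set xs \<subseteq> J \<and> length xs = s}"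
    using small_class(3)[OF J] by (intro card_mono finite_lists_length_eq)
  also have "\<dots> = card J ^ s" using small_class(3)[OF J] by (rule card_lists_length_eq)
  also have "\<dots> \<le> k ^ s" using small_class(4)[OF J] by (intro power_mono) auto
  also have "\<dots> \<le> k ^ k" using assms k2 by (intro power_increasing) auto
  finally show ?thesis .
next
  case True
  then show ?thesis by (simp only: card.empty)
qed

text \<open>On a negative input every class is small, so its consistent tuples obey the same
  counting formula as the choices of a positive input.\<close>

lemma eqlists_subset_choices:
  assumes neg: "\<not> k_distinctness k n x" and s: "s \<ge> 1"
  shows "eqlists (padded n m x) (2 * n) s \<subseteq> choices k n x s"
proof
  fix xs assume "xs \<in> eqlists (padded n m x) (2 * n) s"
  then have len: "length xs = s" and sub: "set xs \<subseteq> {1..2 * n}"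
    and eq: "\<And>i j. i \<in> set xs \<Longrightarrow> j \<in> set xs \<Longrightarrow> padded n m x i = padded n m x j"
    unfolding eqlists_def by blast+
  define i where "i = hd xs"
  have i: "i \<in> set xs" using len s by (cases xs) (auto simp: i_def)
  show "xs \<in> choices k n x s"
  proof (cases "i \<le> n")
    case True
    let ?J = "{j \<in> {1..n}. x j = x i}"
    have "i \<in> ?J" using i sub True by auto
    have "set xs \<subseteq> ?J"
    proof
      fix j assume j: "j \<in> set xs"
      have e: "padded n m x i = padded n m x j" by (rule eq[OF i j])
      have "x i \<le> m" using x[of i] \<open>i \<in> ?J\<close> by auto
      then show "j \<in> ?J" using e True sub j by (auto simp: padded_def split: if_splits)
    qed
    moreover have "card ?J < k"
    proof (rule ccontr)
      assume "\<not> card ?J < k"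
      then obtain S where "S \<subseteq> ?J" "card S = k" by (meson not_less obtain_subset_with_card_n)
      moreover have "x a = x b" if "a \<in> S" "b \<in> S" for a b
      proof -
        have "a \<in> ?J" "b \<in> ?J" using that \<open>S \<subseteq> ?J\<close> by blast+
        then show ?thesis by simp
      qed
      ultimately have "k_distinctness k n x" unfolding k_distinctness_def by blast
      then show False using neg by simp
    qed
    moreover have "card ?J \<ge> 1" using \<open>i \<in> ?J\<close> by (simp add: Suc_le_eq card_gt_0_iff) blast
    moreover have "?J \<in> t_tuples (card ?J) n x" unfolding t_tuples_def by auto
    ultimately have "?J \<in> small_classes k n x" unfolding small_classes_def by force
    then show ?thesis using \<open>set xs \<subseteq> ?J\<close> len unfolding choices_def by blast
  next
    case False
    have "set xs \<subseteq> {i}"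
    proof
      fix j assume j: "j \<in> set xs"
      have e: "padded n m x i = padded n m x j" by (rule eq[OF i j])
      have "j \<le> n \<Longrightarrow> x j \<le> m" using x[of j] sub j by auto
      then show "j \<in> {i}" using e False by (auto simp: padded_def split: if_splits)
    qed
    moreover have "{i} \<in> small_classes k n x"
      using False i sub by (auto simp: small_classes_def)
    ultimately show ?thesis using len unfolding choices_def by blast
  qed
qed

end

lemma card_eqlists_le:
  assumes k2: "k \<ge> 2" and y: "\<And>i. i \<in> {1..n} \<Longrightarrow> y i \<in> {1..m}"
    and neg: "\<not> k_distinctness k n y" and s: "s \<in> {1..<k}"
  shows "card (eqlists (padded n m y) (2 * n) s) \<le> (k * k ^ k + 1) * n"
proof -
  have fin: "finite (choices k n y s)"
    using choices_subset_eqlists[OF k2 y] finite_eqlists by (rule finite_subset)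
  have "card (eqlists (padded n m y) (2 * n) s) \<le> card (choices k n y s)"
    using eqlists_subset_choices[OF k2 y neg, of s] s fin by (intro card_mono) auto
  also have "\<dots> = (\<Sum>t\<in>{1..<k}. card (t_tuples t n y) * t ^ s) + n"
    using card_choices[OF k2 y] s by simp
  also have "(\<Sum>t\<in>{1..<k}. card (t_tuples t n y) * t ^ s) \<le> (\<Sum>t\<in>{1..<k}. n * k ^ k)"
  proof (intro sum_mono mult_mono)
    fix t assume t: "t \<in> {1..<k}"
    then show "card (t_tuples t n y) \<le> n" by (intro card_t_tuples_le) simp
    have "t ^ s \<le> k ^ s" using t by (intro power_mono) auto
    also have "\<dots> \<le> k ^ k" using s k2 by (intro power_increasing) auto
    finally show "t ^ s \<le> k ^ k" .
  qed auto
  also have "\<dots> \<le> k * (n * k ^ k)" by simp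
  finally show ?thesis by (simp add: algebra_simps)
qed

text \<open>The only use of the promise: the numbers of available tuples in two inputs differ by a factor of
  \<open>1 + O(n powr (-3/4))\<close>.\<close>

lemma card_eqlists_ratio:
  assumes k2: "k \<ge> 2" and n: "n > 0" and c: "c > 0"
    and x: "x \<in> promise_set k c n m L" and y: "y \<in> promise_set k c n m L"
    and neg: "\<not> k_distinctness k n y" and s: "s \<in> {1..<k}"
  shows "real (card (eqlists (padded n m y) (2 * n) s))
    \<le> (1 + 2 * c * real k * real k ^ k * real n powr (-3/4)) * real (card (choices k n x s))"
proof -
  have xr: "x i \<in> {1..m}" and yr: "y i \<in> {1..m}" if "i \<in> {1..n}" for i
    using x y that by (auto simp: promise_set_def)
  have fin: "finite (choices k n y s)"
    using choices_subset_eqlists[OF k2 yr] finite_eqlists by (rule finite_subset)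
  have cx: "card (choices k n x s) = (\<Sum>t\<in>{1..<k}. card (t_tuples t n x) * t ^ s) + n"
    using card_choices[OF k2 xr] s by simp
  have cy: "card (choices k n y s) = (\<Sum>t\<in>{1..<k}. card (t_tuples t n y) * t ^ s) + n"
    using card_choices[OF k2 yr] s by simp
  have "real (card (eqlists (padded n m y) (2 * n) s)) \<le> real (card (choices k n y s))"
    using eqlists_subset_choices[OF k2 yr neg, of s] s fin by (intro of_nat_mono card_mono) auto
  also have "\<dots> = real (card (choices k n x s)) +
     (\<Sum>t\<in>{1..<k}. (real (card (t_tuples t n y)) - real (card (t_tuples t n x))) * real t ^ s)"
    unfolding cx cy by (simp add: left_diff_distrib sum_subtractf)
  also have "\<dots> \<le> real (card (choices k n x s)) + (\<Sum>t\<in>{1..<k}. 2 * c * real n powr (1/4) * real k ^ k)"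
  proof (intro add_left_mono sum_mono mult_mono)
    fix t assume t: "t \<in> {1..<k}"
    then have "t \<in> {1..k - 1}" by auto
    then have "\<bar>real (card (t_tuples t n x)) - real (L t)\<bar> \<le> c * real n powr (1/4)"
      "\<bar>real (card (t_tuples t n y)) - real (L t)\<bar> \<le> c * real n powr (1/4)"
      using x y unfolding promise_set_def by blast+
    then show "real (card (t_tuples t n y)) - real (card (t_tuples t n x)) \<le> 2 * c * real n powr (1/4)"
      by linarith
    have "real t ^ s \<le> real k ^ s" using t by (intro power_mono) auto
    also have "\<dots> \<le> real k ^ k" using s k2 by (intro power_increasing) auto
    finally show "real t ^ s \<le> real k ^ k" .
  qed (use c in auto)
  also have "(\<Sum>t\<in>{1..<k}. 2 * c * real n powr (1/4) * real k ^ k) \<le> real k * (2 * c * real n powr (1/4) * real k ^ k)"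
  proof -
    have "(\<Sum>t\<in>{1..<k}. 2 * c * real n powr (1/4) * real k ^ k) = real (k - 1) * (2 * c * real n powr (1/4) * real k ^ k)"
      by simp
    also have "\<dots> \<le> real k * (2 * c * real n powr (1/4) * real k ^ k)"
      using c by (intro mult_right_mono) auto
    finally show ?thesis .
  qed
  \<comment> \<open>The additive error becomes relative: the split-off factor \<open>real n\<close>
    is at most the number of choices, thanks to the padding.\<close>
  also have "real n powr (1/4) = real n powr (-3/4) * real n"
  proof -
    have "real n powr (1/4) = real n powr (-3/4 + 1)" by simp
    also have "\<dots> = real n powr (-3/4) * real n powr 1" by (rule powr_add)
    finally show ?thesis using n by simp
  qed
  also have "real k * (2 * c * (real n powr (-3/4) * real n) * real k ^ k)
      = 2 * c * real k * real k ^ k * real n powr (-3/4) * real n" by simp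
  also have "\<dots> \<le> 2 * c * real k * real k ^ k * real n powr (-3/4) * real (card (choices k n x s))"
  proof (intro mult_left_mono)
    have "n \<le> card (choices k n x s)" using cx by simp
    then show "real n \<le> real (card (choices k n x s))" by (rule of_nat_mono)
  qed (use c in auto)
  finally show ?thesis by (simp add: algebra_simps)
qed

section \<open>Balancing the levels\<close>

text \<open>The saving over the trivial exponent \<open>1\<close>. It is the value for which the
  last level costs as much as the others, an equation recorded in
  \<open>cost_gap_eq\<close>.\<close>

definition cost_gap :: "nat \<Rightarrow> real" where
  "cost_gap k = 2 ^ (k - 2) / (2 ^ k - 1)"

text \<open>Closed form of the recursion \<open>e 0 = 1\<close>,
  \<open>e t = 1/2 - cost_gap k + e (t - 1) / 2\<close>, whose fixed point is
  \<open>1 - 2 * cost_gap k\<close>.\<close>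

definition size_exponent :: "nat \<Rightarrow> nat \<Rightarrow> real" where
  "size_exponent k t = 1 - 2 * cost_gap k + 2 * cost_gap k / 2 ^ t"

text \<open>Loading one \<open>t\<close>-tuple costs \<open>n powr step_exponent k t\<close>. The exponents make the total cost of
  every level the same.\<close>

definition step_exponent :: "nat \<Rightarrow> nat \<Rightarrow> real" where
  "step_exponent k t = (1 - size_exponent k (t - 1)) / 2 + (if t = k then 1 / 2 else 0)"

definition level_size :: "nat \<Rightarrow> nat \<Rightarrow> nat \<Rightarrow> nat" where
  "level_size k n t = (if t = 0 then 0 else if t < k then nat \<lceil>real n powr size_exponent k t\<rceil> else 1)"

lemma cost_gap_eq:
  assumes "k \<ge> 2"
  shows "4 * cost_gap k * (2 ^ k - 1) = 2 ^ k"
proof -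
  have "(2::real) ^ k = 2 ^ (k - 2 + 2)" using assms by (intro arg_cong[of _ _ "power 2"]) simp
  then have "(2::real) ^ k = 2 ^ (k - 2) * 2 ^ 2" by (simp only: power_add)
  moreover have "(2::real) ^ k - 1 > 0" using assms by simp
  ultimately show ?thesis by (simp add: cost_gap_def)
qed

lemma cost_gap_bounds:
  assumes "k \<ge> 2"
  shows "1 / 4 \<le> cost_gap k" "cost_gap k < 1 / 2"
proof -
  have "(2::real) ^ 2 \<le> 2 ^ k" using assms by (intro power_increasing) auto
  then have pow: "(2::real) ^ k \<ge> 4" by simp
  then have eq: "cost_gap k = 2 ^ k / (4 * (2 ^ k - 1))"
    using cost_gap_eq[OF assms] by (simp add: field_simps)
  show "1 / 4 \<le> cost_gap k" "cost_gap k < 1 / 2"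
    unfolding eq using pow by (simp_all add: field_simps)
qed

text \<open>The exponents decrease with the level and the first one is
  \<open>1 - cost_gap k\<close>, so \<open>cost_gap k \<ge> 1/4\<close> gives the bound
  \<open>3/4\<close> that matches the precision of the promise.\<close>

lemma size_exponent_bounds:
  assumes "k \<ge> 2"
  shows "0 < size_exponent k t" "size_exponent k t \<le> 1"
    and "1 \<le> t \<Longrightarrow> size_exponent k t \<le> 3 / 4"
    and "s \<le> t \<Longrightarrow> size_exponent k t \<le> size_exponent k s"
proof -
  note g = cost_gap_bounds[OF assms]
  have "2 * cost_gap k / 2 ^ t > 0" using g by simp
  then show "0 < size_exponent k t" unfolding size_exponent_def using g by linarith
  have mono: "2 * cost_gap k / 2 ^ t \<le> 2 * cost_gap k / 2 ^ s" if "s \<le> t" for s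
    using g that by (intro divide_left_mono power_increasing) auto
  show "size_exponent k t \<le> 1" unfolding size_exponent_def using mono[of 0] by simp
  show "1 \<le> t \<Longrightarrow> size_exponent k t \<le> 3 / 4" unfolding size_exponent_def using mono[of 1] g by simp
  show "s \<le> t \<Longrightarrow> size_exponent k t \<le> size_exponent k s" unfolding size_exponent_def using mono[of s] by simp
qed

text \<open>Below level \<open>k\<close> this is the recursion behind \<open>size_exponent\<close>;
  at level \<open>k\<close> it is the closing condition that determines
  \<open>cost_gap\<close>.\<close>

lemma balanced_exponents:
  assumes "k \<ge> 2"
  shows "1 \<le> t \<Longrightarrow> t < k \<Longrightarrow> size_exponent k t + step_exponent k t = 1 - cost_gap k"
    and "step_exponent k k = 1 - cost_gap k"
proof -
  assume t: "1 \<le> t" "t < k"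
  then obtain t' where "t = Suc t'" by (cases t) auto
  then show "size_exponent k t + step_exponent k t = 1 - cost_gap k"
    using t by (simp add: size_exponent_def step_exponent_def field_simps)
next
  obtain k' where k': "k = Suc k'" using assms by (cases k) auto
  define e where "e = 2 * cost_gap k / 2 ^ k"
  have "4 * cost_gap k * (2 ^ k - 1) / 2 ^ k = 1" using cost_gap_eq[OF assms] by simp
  then have "4 * cost_gap k - 2 * e = 1" by (simp add: e_def field_simps)
  then have gap: "cost_gap k = 1 / 4 + e / 2" by simp
  have e: "2 * cost_gap k / 2 ^ (k - 1) = 2 * e" using k' by (simp add: e_def)
  show "step_exponent k k = 1 - cost_gap k"
    unfolding step_exponent_def size_exponent_def e by (simp add: gap field_simps)
qed

lemma powr_ge_1: "n > 0 \<Longrightarrow> e \<ge> 0 \<Longrightarrow> real n powr e \<ge> 1"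
  by (rule ge_one_powr_ge_zero) auto

lemma level_size_bounds:
  assumes k: "k \<ge> 2" and n: "n > 0" and t: "1 \<le> t" "t < k"
  shows "real n powr size_exponent k t \<le> real (level_size k n t)"
    and "real (level_size k n t) \<le> 2 * real n powr size_exponent k t"
proof -
  have "real n powr size_exponent k t \<ge> 1"
    using size_exponent_bounds(1)[OF k, of t] n by (intro powr_ge_1) auto
  moreover have "level_size k n t = nat \<lceil>real n powr size_exponent k t\<rceil>"
    using t by (simp add: level_size_def)
  ultimately show "real n powr size_exponent k t \<le> real (level_size k n t)"
    "real (level_size k n t) \<le> 2 * real n powr size_exponent k t" by linarith+
qed

lemma level_size_le:
  assumes k: "k \<ge> 2" and n: "n > 0" and t: "1 \<le> t" "t \<le> k"
  shows "real (level_size k n t) \<le> 2 * real n powr (3/4)"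
proof (cases "t < k")
  case True
  have "real n powr size_exponent k t \<le> real n powr (3/4)"
    using size_exponent_bounds(3)[OF k t(1)] n by (intro powr_mono) auto
  then show ?thesis using level_size_bounds(2)[OF k n t(1) True] by simp
next
  case False
  then show ?thesis using powr_ge_1[OF n, of "3/4"] t by (simp add: level_size_def)
qed

lemma power_le_exp:
  fixes a b :: real
  assumes "a \<ge> 0" "a * real R \<le> b"
  shows "(1 + a) ^ R \<le> exp b"
proof -
  have "(1 + a) ^ R \<le> exp a ^ R" using assms by (intro power_mono exp_ge_add_one_self) auto
  also have "\<dots> = exp (a * real R)" by (simp add: exp_of_nat_mult[symmetric] mult.commute)
  finally show ?thesis using assms(2) by (meson exp_le_cancel_iff order_trans)
qed

text \<open>\<open>a\<close> is the coefficient in \<open>card_eqlists_ratio\<close> and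
  \<open>\<kappa>\<close> the fiber bound. In \<open>Q\<close>, the terms in \<open>\<kappa>\<close>
  come from \<open>step_cost\<close> with \<open>B = 2\<close>, the exponential bounds the ratio
  accumulated over all slots, and the last factor comes from \<open>card_eqlists_le\<close>.\<close>

lemma k_distinctness_upper_bound:
  fixes k n m :: nat and c :: real
  assumes k: "k \<ge> 2" and c: "c > 0" and n: "n > 0" and m: "m > 0"
  defines "a \<equiv> 2 * c * real k * real k ^ k" and "\<kappa> \<equiv> k ^ k"
  defines "Q \<equiv> real \<kappa> * (1 + 2 * real \<kappa>) * exp (2 * a * real k) * real (k * k ^ k + 1)"
  shows "\<exists>A. quantum_query_algorithm n m A \<and>
     computes_with_error n m A (k_distinctness k n) (promise_set k c n m L) (1/4) \<and>
     real (num_queries A) \<le> (32 * (real k)\<^sup>2 * sqrt Q + 2) * real n powr (1 - cost_gap k)"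
proof -
  define D where "D = promise_set k c n m L"
  define r where "r = level_size k n"
  define T where "T x = (SOME S. S \<subseteq> {1..n} \<and> card S = k \<and> (\<forall>i\<in>S. \<forall>j\<in>S. x i = x j))" for x :: "nat \<Rightarrow> nat"
  \<comment> \<open>The top level is deterministic, one fixed list of \<open>k\<close> equal
    elements; only the lower levels are random.\<close>
  define C where "C x s = (if s < k then choices k n x s else {sorted_list_of_set (T x)})" for x s
  define cost where "cost \<sigma> = sqrt Q * real n powr step_exponent k (fst (fst \<sigma>))" for \<sigma> :: "(nat \<times> nat) \<times> nat"
  have Q: "Q > 0" using k by (simp add: Q_def \<kappa>_def add_pos_nonneg)
  have a: "a \<ge> 0" using c by (simp add: a_def)
  interpret S: loading_scheme k r
    using k by unfold_locales (auto simp: r_def level_size_def)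
  have range: "x i \<in> {1..m}" if "x \<in> D" "i \<in> {1..n}" for x i
    using that by (auto simp: D_def promise_set_def)
  have finD: "finite D"
    by (rule finite_subset[of _ "{1..n} \<rightarrow>\<^sub>E {1..m}"]) (auto simp: D_def promise_set_def intro!: finite_PiE)
  have T: "T x \<subseteq> {1..n}" "card (T x) = k" "\<And>i j. i \<in> T x \<Longrightarrow> j \<in> T x \<Longrightarrow> x i = x j"
    if "k_distinctness k n x" for x
    using someI_ex[OF that[unfolded k_distinctness_def]] unfolding T_def by blast+
  have len_C: "card (C x s) \<ge> n" if "x \<in> D" "s \<in> {1..<k}" for x s
  proof -
    have "1 \<le> s" using that by simp
    from card_choices[OF k range[OF that(1)] this] show ?thesis using that by (simp add: C_def)
  qed

  \<comment> \<open>Admissibility of the choices of a positive input\<close>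
  have choice: "loading_choices k r (C x) (padded n m x) (2 * n) \<kappa>" if x: "x \<in> D" "k_distinctness k n x" for x
  proof
    fix s assume s: "s \<in> {1..k}"
    show "C x s \<subseteq> eqlists (padded n m x) (2 * n) s"
    proof (cases "s < k")
      case True
      then show ?thesis using choices_subset_eqlists[OF k range[OF x(1)]] by (simp add: C_def)
    next
      case False
      have fin: "finite (T x)" using T(1)[OF x(2)] finite_subset by blast
      have set: "set (sorted_list_of_set (T x)) = T x" using fin by simp
      have len: "length (sorted_list_of_set (T x)) = k" using T(2)[OF x(2)] by simp
      have "padded n m x i = padded n m x j" if "i \<in> T x" "j \<in> T x" for i j
        using T(1)[OF x(2)] T(3)[OF x(2) that] that by (auto simp: padded_def)
      moreover have "T x \<subseteq> {1..2 * n}" using T(1)[OF x(2)] by auto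
      ultimately have "sorted_list_of_set (T x) \<in> eqlists (padded n m x) (2 * n) k"
        unfolding eqlists_def mem_Collect_eq set len by blast
      then show ?thesis using False s by (simp add: C_def)
    qed
    show "C x s \<noteq> {}"
      using len_C[OF x(1), of s] n s by (cases "s < k") (auto simp: C_def)
    fix v
    show "card {b \<in> C x s. \<exists>j\<in>set b. padded n m x j = v} \<le> \<kappa>"
    proof (cases "s < k")
      case True
      then show ?thesis using choices_fiber[OF k range[OF x(1)], where s = s and v = v] by (simp add: C_def \<kappa>_def)
    next
      case False
      have "card {b \<in> C x s. \<exists>j\<in>set b. padded n m x j = v} \<le> card {sorted_list_of_set (T x)}"
        using False by (intro card_mono) (auto simp: C_def)
      also have "\<dots> \<le> \<kappa>" using k by (simp add: \<kappa>_def)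
      finally show ?thesis .
    qed
  qed
  define view where "view \<sigma> G x = restrict (\<lambda>\<rho>. map (padded n m x) (G \<rho>)) (S.places \<sigma>)"
    for \<sigma> and G :: "nat \<times> nat \<Rightarrow> nat list" and x
  have "\<exists>A. quantum_query_algorithm n m A \<and> computes_with_error n m A (k_distinctness k n) D (1/4) \<and>
    real (num_queries A) \<le> 16 * (\<Sum>\<sigma>\<in>S.steps. cost \<sigma>) + 2"
  proof (rule loading_procedure_upper_bound[where lab = S.label and idx = S.index and view = view and
        \<Omega> = "\<lambda>\<sigma> x. S.seeds (C x) \<times> {..r (snd \<sigma>)}" and Valid = "\<lambda>\<sigma> x. S.labels (padded n m x) (2 * n) \<sigma>",
        OF finD n m])
    show "x i \<in> {1..m}" if "x \<in> D" "i \<in> {1..n}" for x i using range that .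
    show "finite S.steps" by simp
    show "finite (S.labels (padded n m x) (2 * n) \<sigma>)" for \<sigma> x by (rule S.finite_labels)
    show "finite (S.seeds (C x) \<times> {..r (snd \<sigma>)})" if "x \<in> D" "k_distinctness k n x" for x and \<sigma> :: "(nat \<times> nat) \<times> nat"
      using loading_choices.finite_seeds[OF choice[OF that]] by simp
    show "cost \<sigma> > 0" for \<sigma> using Q n by (simp add: cost_def)
  next

    \<comment> \<open>The crossing condition\<close>
    fix x y assume x: "x \<in> D" "k_distinctness k n x" and y: "y \<in> D" "\<not> k_distinctness k n y"
    interpret X: loading_choices k r "C x" "padded n m x" "2 * n" \<kappa> by (rule choice[OF x])
    have eq: "{\<omega> \<in> S.seeds (C x) \<times> {..r (snd \<sigma>)}.
        S.label \<sigma> \<omega> \<in> S.labels (padded n m x) (2 * n) \<sigma> \<inter> S.labels (padded n m y) (2 * n) \<sigma> \<and>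
        view \<sigma> (S.label \<sigma> \<omega>) x = view \<sigma> (S.label \<sigma> \<omega>) y \<and>
        S.index \<sigma> \<omega> \<in> {1..n} \<and> x (S.index \<sigma> \<omega>) \<noteq> y (S.index \<sigma> \<omega>)}
      = {\<omega> \<in> S.seeds (C x) \<times> {..r (snd \<sigma>)}.
         (\<forall>\<rho>\<in>S.places \<sigma>. map (padded n m x) (S.label \<sigma> \<omega> \<rho>) = map (padded n m y) (S.label \<sigma> \<omega> \<rho>)) \<and>
         padded n m x (S.index \<sigma> \<omega>) \<noteq> padded n m y (S.index \<sigma> \<omega>)}" (is "?L = ?R")
      if \<sigma>: "\<sigma> \<in> S.steps" for \<sigma>
    proof (rule Set.set_eqI)
      fix \<omega> :: "(nat \<times> nat \<Rightarrow> nat list) \<times> nat"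
      show "\<omega> \<in> ?L \<longleftrightarrow> \<omega> \<in> ?R"
      proof (cases "\<omega> \<in> S.seeds (C x) \<times> {..r (snd \<sigma>)}")
        case True
        then obtain F q where \<omega>: "\<omega> = (F, q)" and F: "F \<in> S.seeds (C x)" and q: "q \<le> r (snd \<sigma>)" by auto
        have lx: "S.label \<sigma> \<omega> \<in> S.labels (padded n m x) (2 * n) \<sigma>"
          using S.label_in_labels[of "fst \<sigma>" "snd \<sigma>" q F "C x", OF _ q F X.C] \<sigma> \<omega> by simp
        have \<tau>: "fst \<sigma> \<in> S.slots" "snd \<sigma> < fst (fst \<sigma>)" using \<sigma> by (auto simp: S.steps_def)
        have "F (fst \<sigma>) \<in> eqlists (padded n m x) (2 * n) (fst (fst \<sigma>))"
          using X.seed_in_C[OF F \<tau>(1)] X.C[of "fst (fst \<sigma>)"] \<tau>(1) by (auto simp: S.slots_def)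
        then have "length (F (fst \<sigma>)) = fst (fst \<sigma>)" "set (F (fst \<sigma>)) \<subseteq> {1..2 * n}"
          unfolding eqlists_def by blast+
        then have "F (fst \<sigma>) ! snd \<sigma> \<in> {1..2 * n}" using \<tau>(2) nth_mem by (metis subsetD)
        then have "S.index \<sigma> \<omega> \<in> {1..2 * n}" by (simp add: \<omega> S.index_def)
        \<comment> \<open>Padding values do not depend on the input, so a separating index is
          automatically one that can be queried.\<close>
        then have idx: "padded n m x (S.index \<sigma> \<omega>) \<noteq> padded n m y (S.index \<sigma> \<omega>) \<longleftrightarrow>
            S.index \<sigma> \<omega> \<in> {1..n} \<and> x (S.index \<sigma> \<omega>) \<noteq> y (S.index \<sigma> \<omega>)"
          by (auto simp: padded_def)
        have vw: "view \<sigma> (S.label \<sigma> \<omega>) x = view \<sigma> (S.label \<sigma> \<omega>) y \<longleftrightarrow>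
          (\<forall>\<rho>\<in>S.places \<sigma>. map (padded n m x) (S.label \<sigma> \<omega> \<rho>) = map (padded n m y) (S.label \<sigma> \<omega> \<rho>))"
          unfolding view_def restrict_def fun_eq_iff by auto
        have ly: "S.label \<sigma> \<omega> \<in> S.labels (padded n m y) (2 * n) \<sigma>"
          if agree: "\<forall>\<rho>\<in>S.places \<sigma>. map (padded n m x) (S.label \<sigma> \<omega> \<rho>) = map (padded n m y) (S.label \<sigma> \<omega> \<rho>)"
        proof -
          have "S.label \<sigma> \<omega> \<rho> \<in> eqlists (padded n m y) (2 * n) (fst \<rho>)" if "\<rho> \<in> S.places \<sigma>" for \<rho>
            using eqlists_cong[OF bspec[OF agree that]] lx that by (auto simp: S.labels_def dest: PiE_mem)
          moreover have "S.label \<sigma> \<omega> \<in> extensional (S.places \<sigma>)"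
            using lx by (auto simp: S.labels_def PiE_def)
          ultimately show ?thesis by (simp add: S.labels_def PiE_iff)
        qed
        show ?thesis using True lx ly idx vw by auto
      qed auto
    qed
    \<comment> \<open>Without any difference the slot \<open>(k, 0)\<close> would exhibit
      \<open>k\<close> equal elements in the negative input.\<close>
    have "\<exists>\<sigma>\<in>S.steps. padded n m x (F (fst \<sigma>) ! snd \<sigma>) \<noteq> padded n m y (F (fst \<sigma>) ! snd \<sigma>)"
      if F: "F \<in> S.seeds (C x)" for F
    proof (rule ccontr)
      assume "\<not> ?thesis"
      then have agree: "padded n m x (F (fst \<sigma>) ! snd \<sigma>) = padded n m y (F (fst \<sigma>) ! snd \<sigma>)" if "\<sigma> \<in> S.steps" for \<sigma>
        using that by blast
      have slot: "(k, 0) \<in> S.slots" using k S.rk by (simp add: S.slots_def)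
      then have "F (k, 0) \<in> C x k" using X.seed_in_C[OF F, of "(k, 0)"] by simp
      then have Fk: "F (k, 0) = sorted_list_of_set (T x)" by (simp add: C_def)
      have finT: "finite (T x)" using T(1)[OF x(2)] finite_subset by blast
      have "x i = y i" if i: "i \<in> T x" for i
      proof -
        obtain l where l: "l < k" "sorted_list_of_set (T x) ! l = i"
          using i finT T(2)[OF x(2)] by (metis in_set_conv_nth length_sorted_list_of_set set_sorted_list_of_set)
        have "((k, 0), l) \<in> S.steps" using slot l by (simp add: S.steps_def)
        from agree[OF this] show ?thesis using l Fk T(1)[OF x(2)] i by (auto simp: padded_def)
      qed
      then have "y i = y j" if "i \<in> T x" "j \<in> T x" for i j using T(3)[OF x(2)] that by metis
      then have "k_distinctness k n y" unfolding k_distinctness_def using T(1,2)[OF x(2)] by blast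
      then show False using y by simp
    qed
    then have "(\<Sum>\<sigma>\<in>S.steps. real (card {\<omega> \<in> S.seeds (C x) \<times> {..r (snd \<sigma>)}.
         (\<forall>\<rho>\<in>S.places \<sigma>. map (padded n m x) (S.label \<sigma> \<omega> \<rho>) = map (padded n m y) (S.label \<sigma> \<omega> \<rho>)) \<and>
         padded n m x (S.index \<sigma> \<omega>) \<noteq> padded n m y (S.index \<sigma> \<omega>)}) / real (card (S.seeds (C x) \<times> {..r (snd \<sigma>)}))) = 1"
      by (rule X.card_crossing)
    then show "(\<Sum>\<sigma>\<in>S.steps. real (card {\<omega> \<in> S.seeds (C x) \<times> {..r (snd \<sigma>)}.
        S.label \<sigma> \<omega> \<in> S.labels (padded n m x) (2 * n) \<sigma> \<inter> S.labels (padded n m y) (2 * n) \<sigma> \<and>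
        view \<sigma> (S.label \<sigma> \<omega>) x = view \<sigma> (S.label \<sigma> \<omega>) y \<and>
        S.index \<sigma> \<omega> \<in> {1..n} \<and> x (S.index \<sigma> \<omega>) \<noteq> y (S.index \<sigma> \<omega>)}) / real (card (S.seeds (C x) \<times> {..r (snd \<sigma>)}))) = 1"
      by (simp only: eq cong: sum.cong)
  next

    \<comment> \<open>The cost of a single step\<close>
    fix \<sigma> x y assume \<sigma>: "\<sigma> \<in> S.steps" and x: "x \<in> D" "k_distinctness k n x" and y: "y \<in> D" "\<not> k_distinctness k n y"
    interpret X: loading_choices k r "C x" "padded n m x" "2 * n" \<kappa> by (rule choice[OF x])
    obtain t j l where \<sigma>_eq: "\<sigma> = ((t, j), l)" by (metis surj_pair)
    have t: "1 \<le> t" "t \<le> k" and l: "l < t" using \<sigma> by (auto simp: \<sigma>_eq S.steps_def S.slots_def)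
    let ?\<gamma> = "1 + a * real n powr (-3/4)"
    let ?E = "real (card (eqlists (padded n m y) (2 * n) l))"
    have n1: "real n \<ge> 1" using n by simp
    \<comment> \<open>The \<open>2\<close> accounts for rounding in \<open>level_size\<close>; the
      rest is \<open>n \<le> card (C x l)\<close> from the padding.\<close>
    have B: "r l \<le> 2 * card (C x l)" if "l > 0"
    proof -
      have "real (r l) \<le> 2 * real n powr size_exponent k l"
        unfolding r_def using that l t by (intro level_size_bounds(2)[OF k n]) auto
      also have "\<dots> \<le> 2 * real n powr 1"
        using n1 size_exponent_bounds(2)[OF k] by (intro mult_left_mono powr_mono) auto
      finally have "r l \<le> 2 * n" using n1 by simp
      also have "\<dots> \<le> 2 * card (C x l)" using len_C[OF x(1), of l] that l t by simp
      finally show ?thesis .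
    qed
    have ratio: "real (card (eqlists (padded n m y) (2 * n) s)) \<le> ?\<gamma> * real (card (C x s))" if "s \<in> {1..<k}" for s
      using card_eqlists_ratio[OF k n c _ _ y(2) that] x y that by (simp add: D_def C_def a_def)
    have step: "(\<Sum>i\<in>{1..n}. \<Sum>G\<in>S.labels (padded n m x) (2 * n) \<sigma>. (X.edge_prob \<sigma> G i)\<^sup>2) *
        (real n * real (card (S.labels (padded n m y) (2 * n) \<sigma>)))
      \<le> real n * (real \<kappa> * (1 + real 2 * real \<kappa>)) * ?\<gamma> ^ card S.slots * (?E / ((real (r l) + 1) * real (card (C x (fst (t, j))))))"
      unfolding \<sigma>_eq
      by (rule X.step_cost[where B = 2, OF _ B _ S.finite_labels _ ratio])
        (use \<sigma> a in \<open>auto simp: \<sigma>_eq\<close>)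
    \<comment> \<open>There are at most \<open>2 * k * n powr (3/4)\<close> slots, so the powers of
      \<open>n\<close> in the exponent cancel.\<close>
    have growth: "?\<gamma> ^ card S.slots \<le> exp (2 * a * real k)"
    proof (rule power_le_exp)
      have "real (card S.slots) = (\<Sum>s\<in>{1..k}. real (r s))" by (simp add: S.slots_def)
      also have "\<dots> \<le> (\<Sum>s\<in>{1..k}. 2 * real n powr (3/4))"
        unfolding r_def by (intro sum_mono level_size_le[OF k n]) auto
      finally have R: "real (card S.slots) \<le> real k * (2 * real n powr (3/4))" by simp
      have "a * real n powr (-3/4) * real (card S.slots) \<le> a * real n powr (-3/4) * (real k * (2 * real n powr (3/4)))"
        using R a by (intro mult_left_mono) auto
      also have "\<dots> = 2 * a * real k * (real n powr (-3/4) * real n powr (3/4))" by simp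
      also have "real n powr (-3/4) * real n powr (3/4) = 1" using n by (simp flip: powr_add)
      finally show "a * real n powr (-3/4) * real (card S.slots) \<le> 2 * a * real k" by simp
    qed (use a in auto)
    \<comment> \<open>The sizes decrease with the level, so the longest prefix
      \<open>l = t - 1\<close> is the worst case. The empty prefix is separate: level
      \<open>0\<close> has no slots, but its only list is \<open>[]\<close>.\<close>
    have E: "?E / (real (r l) + 1) \<le> real (k * k ^ k + 1) * real n powr (1 - size_exponent k (t - 1))"
    proof (cases "l = 0")
      case True
      have "eqlists (padded n m y) (2 * n) l = {[]}" using True by (auto simp: eqlists_def)
      then have one: "?E / (real (r l) + 1) = 1" using S.r0 True by simp
      have "1 * 1 \<le> real (k * k ^ k + 1) * real n powr (1 - size_exponent k (t - 1))"
        using powr_ge_1[OF n, of "1 - size_exponent k (t - 1)"] size_exponent_bounds(2)[OF k, of "t - 1"]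
        by (intro mult_mono) auto
      then show ?thesis unfolding one by simp
    next
      case False
      then have l1: "1 \<le> l" "l < k" using l t by auto
      have "card (eqlists (padded n m y) (2 * n) l) \<le> (k * k ^ k + 1) * n"
        by (rule card_eqlists_le[OF k range[OF y(1)] y(2)]) (use l1 in auto)
      then have En: "?E \<le> real (k * k ^ k + 1) * real n" by (metis of_nat_le_iff of_nat_mult)
      have "real n powr size_exponent k (t - 1) \<le> real n powr size_exponent k l"
        using l n1 by (intro powr_mono size_exponent_bounds(4)[OF k]) auto
      also have "\<dots> \<le> real (r l) + 1" using level_size_bounds(1)[OF k n l1] by (simp add: r_def)
      finally have rl: "real n powr size_exponent k (t - 1) \<le> real (r l) + 1" .
      have "?E / (real (r l) + 1) \<le> (real (k * k ^ k + 1) * real n) / (real n powr size_exponent k (t - 1))"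
        using En rl n1 by (intro frac_le) auto
      also have "\<dots> = real (k * k ^ k + 1) * real n powr (1 - size_exponent k (t - 1))"
        using n by (simp add: powr_diff)
      finally show ?thesis .
    qed
    \<comment> \<open>The factor \<open>n\<close> stands for the queried index. Below level
      \<open>k\<close> it is absorbed by the at least \<open>n\<close> choices of the tuple; at
      level \<open>k\<close> there is one choice, which explains the \<open>1 / 2\<close> in
      \<open>step_exponent\<close>.\<close>
    have tail: "real n * real n powr (1 - size_exponent k (t - 1)) / real (card (C x t)) \<le> (real n powr step_exponent k t)\<^sup>2"
    proof -
      have sq: "(real n powr step_exponent k t)\<^sup>2 = real n powr (2 * step_exponent k t)"
        by (simp add: power2_eq_square flip: powr_add)
      show ?thesis
      proof (cases "t = k")
        case True
        have "2 * step_exponent k t = 1 + (1 - size_exponent k (t - 1))"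
          using True by (simp add: step_exponent_def field_simps)
        then have "real n powr (2 * step_exponent k t) = real n powr 1 * real n powr (1 - size_exponent k (t - 1))"
          by (simp only: powr_add)
        then have "real n * real n powr (1 - size_exponent k (t - 1)) = real n powr (2 * step_exponent k t)"
          using n by simp
        then show ?thesis unfolding sq using True by (simp add: C_def)
      next
        case False
        have "real n \<le> real (card (C x t))" using len_C[OF x(1), of t] t False by simp
        then have "real n * real n powr (1 - size_exponent k (t - 1)) / real (card (C x t))
           \<le> real (card (C x t)) * real n powr (1 - size_exponent k (t - 1)) / real (card (C x t))"
          by (intro divide_right_mono mult_right_mono) auto
        also have "\<dots> \<le> real n powr (1 - size_exponent k (t - 1))" by simp
        finally have "real n * real n powr (1 - size_exponent k (t - 1)) / real (card (C x t))
          \<le> real n powr (1 - size_exponent k (t - 1))" .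
        moreover have "2 * step_exponent k t = 1 - size_exponent k (t - 1)"
          using False by (simp add: step_exponent_def)
        ultimately show ?thesis unfolding sq by (simp only:)
      qed
    qed
    have "(\<Sum>i\<in>{1..n}. \<Sum>G\<in>S.labels (padded n m x) (2 * n) \<sigma>. (X.edge_prob \<sigma> G i)\<^sup>2) *
        (real n * real (card (S.labels (padded n m y) (2 * n) \<sigma>)))
      \<le> real n * (real \<kappa> * (1 + 2 * real \<kappa>)) * ?\<gamma> ^ card S.slots * (?E / (real (r l) + 1) / real (card (C x t)))"
      using step by simp
    also have "\<dots> \<le> real n * (real \<kappa> * (1 + 2 * real \<kappa>)) * exp (2 * a * real k) *
        (real (k * k ^ k + 1) * real n powr (1 - size_exponent k (t - 1)) / real (card (C x t)))"
      using growth E a by (intro mult_mono divide_right_mono) auto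
    also have "\<dots> = Q * (real n * real n powr (1 - size_exponent k (t - 1)) / real (card (C x t)))"
      by (simp add: Q_def)
    also have "\<dots> \<le> Q * (real n powr step_exponent k t)\<^sup>2"
      using tail Q by (intro mult_left_mono) auto
    also have "\<dots> = (cost \<sigma>)\<^sup>2"
      using Q by (simp add: cost_def \<sigma>_eq power_mult_distrib)
    finally show "(\<Sum>i\<in>{1..n}. \<Sum>G\<in>S.labels (padded n m x) (2 * n) \<sigma>.
        (real (card {\<omega> \<in> S.seeds (C x) \<times> {..r (snd \<sigma>)}. S.label \<sigma> \<omega> = G \<and> S.index \<sigma> \<omega> = i})
          / real (card (S.seeds (C x) \<times> {..r (snd \<sigma>)})))\<^sup>2) *
        (real n * real (card (S.labels (padded n m y) (2 * n) \<sigma>))) \<le> (cost \<sigma>)\<^sup>2"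
      unfolding X.edge_prob_def .
  qed

  \<comment> \<open>The sum over all steps\<close>
  moreover have "16 * (\<Sum>\<sigma>\<in>S.steps. cost \<sigma>) + 2 \<le> (32 * (real k)\<^sup>2 * sqrt Q + 2) * real n powr (1 - cost_gap k)"
  proof -
    have "(\<Sum>\<sigma>\<in>S.steps. cost \<sigma>) = (\<Sum>\<tau>\<in>S.slots. \<Sum>l<fst \<tau>. cost (\<tau>, l))"
      unfolding S.steps_def by (subst sum.Sigma) auto
    also have "\<dots> = (\<Sum>\<tau>\<in>S.slots. real (fst \<tau>) * (sqrt Q * real n powr step_exponent k (fst \<tau>)))"
      by (simp add: cost_def)
    also have "\<dots> = (\<Sum>t\<in>{1..k}. \<Sum>j<r t. real t * (sqrt Q * real n powr step_exponent k t))"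
      unfolding S.slots_def by (subst sum.Sigma) (auto simp: case_prod_unfold)
    also have "\<dots> = (\<Sum>t\<in>{1..k}. real t * sqrt Q * (real (r t) * real n powr step_exponent k t))"
      by (intro sum.cong refl) simp
    \<comment> \<open>Each level contributes at most \<open>k\<close> steps per tuple and, by
      balance, \<open>2 * n powr (1 - cost_gap k)\<close> up to the constant, the \<open>2\<close>
      again from rounding.\<close>
    also have "\<dots> \<le> (\<Sum>t\<in>{1..k}. real k * sqrt Q * (2 * real n powr (1 - cost_gap k)))"
    proof (rule sum_mono)
      fix t assume t: "t \<in> {1..k}"
      have level: "real (r t) * real n powr step_exponent k t \<le> 2 * real n powr (1 - cost_gap k)"
      proof (cases "t = k")
        case True
        then show ?thesis using balanced_exponents(2)[OF k] S.rk by simp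
      next
        case False
        then have t': "1 \<le> t" "t < k" using t by auto
        have "real (r t) * real n powr step_exponent k t \<le> 2 * real n powr size_exponent k t * real n powr step_exponent k t"
          using level_size_bounds(2)[OF k n t'] by (intro mult_right_mono) (auto simp: r_def)
        also have "\<dots> = 2 * real n powr (1 - cost_gap k)"
          using balanced_exponents(1)[OF k t'] by (simp add: mult.assoc flip: powr_add)
        finally show ?thesis .
      qed
      show "real t * sqrt Q * (real (r t) * real n powr step_exponent k t)
          \<le> real k * sqrt Q * (2 * real n powr (1 - cost_gap k))"
        by (rule mult_mono[OF _ level]) (use t Q in \<open>auto intro!: mult_right_mono\<close>)
    qed
    also have "\<dots> = 2 * (real k)\<^sup>2 * sqrt Q * real n powr (1 - cost_gap k)"
      by (simp add: power2_eq_square)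
    finally have "16 * (\<Sum>\<sigma>\<in>S.steps. cost \<sigma>) \<le> 32 * (real k)\<^sup>2 * sqrt Q * real n powr (1 - cost_gap k)"
      by (simp add: mult_ac)
    moreover have "real n powr (1 - cost_gap k) \<ge> 1"
      using cost_gap_bounds(2)[OF k] by (intro powr_ge_1[OF n]) auto
    ultimately show ?thesis unfolding distrib_right by linarith
  qed
  ultimately show ?thesis unfolding D_def by (meson order_trans)
qed

theorem theorem1:
  fixes k :: nat and c :: real
  assumes "k \<ge> 2" and "c > 0"
  shows "\<exists>K::real. \<forall>(n::nat) (m::nat) (L :: nat \<Rightarrow> nat). n > 0 \<longrightarrow> m > 0 \<longrightarrow>
    (\<exists>A. quantum_query_algorithm n m A \<and>
         computes_with_error n m A (k_distinctness k n) (promise_set k c n m L) (1/4) \<and>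
         real (num_queries A) \<le> K * real n powr (1 - 2 ^ (k - 2) / (2 ^ k - 1)))"
  using k_distinctness_upper_bound[OF assms] unfolding cost_gap_def by blast

end
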